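(* Let $A$ be a $C^*$-algebra, let $\mathcal{P}A=A*A*\cdots$ be the free product of an infinite sequence of copies of $A$, with shift endomorphism $\sigma$ and with $A$ regarded as a $C^*$-subalgebra of $\mathcal{P}A$ via $\theta_0$. For every completely positive contraction $\phi:A\to A$ there is a unique $\sigma$-expectation $E:\mathcal{P}A\to A$ satisfying $$\phi(a)=E(\sigma(a)),\qquad a\in A.$$
   Context: $\mathcal{P}A$: a $C^*$-algebra with $*$-homomorphisms $\theta_0,\theta_1,\dots:A\to\mathcal{P}A$ such that $\mathcal{P}A$ is generated by $\theta_0(A)\cup\theta_1(A)\cup\cdots$ and such that for every sequence $\pi_0,\pi_1,\dots$ of $*$-homomorphisms of $A$ into some other $C^*$-algebra $B$ there is a unique $*$-homomorphism $\rho:\mathcal{P}A\to B$ with $\pi_k=\rho\circ\theta_k$ for $k=0,1,\dots$ (neither units nor preservation of units are required). The shift $\sigma:\mathcal{P}A\to\mathcal{P}A$ is the unique $*$-endomorphism with $\sigma\circ\theta_k=\theta_{k+1}$, $k\ge 0$. The map $\theta_0$ is injective and $A$ is identified with $\theta_0(A)\subseteq\mathcal{P}A$. For a subset $S$ of a $C^*$-algebra, $[S]$ denotes its norm-closed linear span. For an inclusion $A\subseteq B$ of $C^*$-algebras, $[ABA]$ (closed span of products $axb$, $a,b\in A$, $x\in B$) is the hereditary subalgebra of $B$ generated by $A$. A conditional expectation $E:B\to A$ is an idempotent positive linear map with range $A$ satisfying $E(ax)=aE(x)$ for $a\in A$, $x\in B$. If $A\subseteq B$ and $\alpha$ is a $*$-endomorphism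 of $B$ such that $B$ is generated as a $C^*$-algebra by $A\cup\alpha(A)\cup\alpha^2(A)\cup\cdots$, an $\alpha$-expectation is a conditional expectation $E:B\to A$ such that: (E1) $E\circ\alpha=E\circ\alpha\circ E$; (E2) $E(xy)=E(x)E(y)$ for all $x,y\in[ABA]$. A $\sigma$-expectation is the case $B=\mathcal{P}A$, $\alpha=\sigma$. *)

theory Defs
  imports "HOL-Analysis.Analysis"
begin

section \<open>C*-algebras as a type class\<close>

text \<open>
  C*-algebras are not assumed to be unital, and homomorphisms between unital
  ones need not preserve units; the zero algebra is allowed.
\<close>

class cstar_algebra = real_normed_algebra + banach +
  fixes scaleC :: "complex \<Rightarrow> 'a \<Rightarrow> 'a"  (infixr "*\<^sub>C" 75)
    and adj :: "'a \<Rightarrow> 'a"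
  assumes scaleC_add_right: "z *\<^sub>C (x + y) = z *\<^sub>C x + z *\<^sub>C y"
    and scaleC_add_left: "(w + z) *\<^sub>C x = w *\<^sub>C x + z *\<^sub>C x"
    and scaleC_scaleC: "w *\<^sub>C z *\<^sub>C x = (w * z) *\<^sub>C x"
    and scaleR_eq_scaleC: "r *\<^sub>R x = complex_of_real r *\<^sub>C x"
    and mult_scaleC_left: "(z *\<^sub>C x) * y = z *\<^sub>C (x * y)"
    and mult_scaleC_right: "x * (z *\<^sub>C y) = z *\<^sub>C (x * y)"
    and norm_scaleC: "norm (z *\<^sub>C x) = cmod z * norm x"
    and adj_adj: "adj (adj x) = x"
    and adj_add: "adj (x + y) = adj x + adj y"
    and adj_scaleC: "adj (z *\<^sub>C x) = cnj z *\<^sub>C adj x"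
    and adj_mult: "adj (x * y) = adj y * adj x"
    and cstar_identity: "norm (adj x * x) = (norm x)\<^sup>2"

instantiation complex :: cstar_algebra
begin

definition scaleC_complex :: "complex \<Rightarrow> complex \<Rightarrow> complex"
  where "scaleC_complex z x = z * x"

definition adj_complex :: "complex \<Rightarrow> complex"
  where "adj_complex = cnj"

instance
  by standard
    (auto simp: scaleC_complex_def adj_complex_def algebra_simps scaleR_conv_of_real
      norm_mult power2_eq_square)

end

lemma scaleC_one: "1 *\<^sub>C x = (x::'a::cstar_algebra)"
  using scaleR_eq_scaleC[of 1 x] by simp

interpretation complex_vector: vector_space "scaleC :: complex \<Rightarrow> 'a \<Rightarrow> 'a::cstar_algebra"
  by unfold_locales (auto simp: scaleC_add_right scaleC_add_left scaleC_scaleC scaleC_one)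

abbreviation clinear :: "('a::cstar_algebra \<Rightarrow> 'b::cstar_algebra) \<Rightarrow> bool"
  where "clinear \<equiv> Vector_Spaces.linear scaleC scaleC"

definition star_hom :: "('a::cstar_algebra \<Rightarrow> 'b::cstar_algebra) \<Rightarrow> bool"
  where "star_hom f \<longleftrightarrow>
    clinear f \<and> (\<forall>x y. f (x * y) = f x * f y) \<and> (\<forall>x. f (adj x) = adj (f x))"

definition cstar_subalgebra :: "'a::cstar_algebra set \<Rightarrow> bool"
  where "cstar_subalgebra S \<longleftrightarrow>
    complex_vector.subspace S \<and> (\<forall>x\<in>S. \<forall>y\<in>S. x * y \<in> S) \<and> (\<forall>x\<in>S. adj x \<in> S) \<and> closed S"

definition positive :: "'a::cstar_algebra \<Rightarrow> bool"
  where "positive x \<longleftrightarrow> (\<exists>y. x = adj y * y)"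

text \<open>
  An \<open>n \<times> n\<close> matrix is a function of two indices, of which only the values at
  \<open>i, j < n\<close> matter.  It is positive in \<open>M\<^sub>n(A)\<close> iff it is \<open>Y\<^sup>* Y\<close> for some \<open>Y\<close>
  in \<open>M\<^sub>n(A)\<close>, where \<open>(Y\<^sup>* Y)\<^sub>i\<^sub>j\<close> is the sum of the \<open>(Y\<^sub>k\<^sub>i)\<^sup>* Y\<^sub>k\<^sub>j\<close>.
\<close>

definition matrix_positive :: "nat \<Rightarrow> (nat \<Rightarrow> nat \<Rightarrow> 'a::cstar_algebra) \<Rightarrow> bool"
  where "matrix_positive n X \<longleftrightarrow>
    (\<exists>Y. \<forall>i<n. \<forall>j<n. X i j = (\<Sum>k<n. adj (Y k i) * Y k j))"

definition completely_positive :: "('a::cstar_algebra \<Rightarrow> 'b::cstar_algebra) \<Rightarrow> bool"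
  where "completely_positive \<phi> \<longleftrightarrow> clinear \<phi> \<and>
    (\<forall>n X. matrix_positive n X \<longrightarrow> matrix_positive n (\<lambda>i j. \<phi> (X i j)))"

definition contraction :: "('a::cstar_algebra \<Rightarrow> 'b::cstar_algebra) \<Rightarrow> bool"
  where "contraction \<phi> \<longleftrightarrow> (\<forall>x. norm (\<phi> x) \<le> norm x)"


section \<open>C*-algebras on a carrier set\<close>

text \<open>
  The universal property of the free product quantifies over C*-algebras inside
  a formula, which a type class does not permit.  For this purpose only,
  C*-algebras are also given as records.
\<close>

record 'b star_structure =
  carrier :: "'b set"
  add :: "'b \<Rightarrow> 'b \<Rightarrow> 'b"
  zero :: 'b
  scale :: "complex \<Rightarrow> 'b \<Rightarrow> 'b"
  mul :: "'b \<Rightarrow> 'b \<Rightarrow> 'b"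
  star :: "'b \<Rightarrow> 'b"
  nrm :: "'b \<Rightarrow> real"

definition sdist :: "'b star_structure \<Rightarrow> 'b \<Rightarrow> 'b \<Rightarrow> real"
  where "sdist B x y = nrm B (add B x (scale B (-1) y))"

locale cstar_structure =
  fixes B :: "'b star_structure"
  assumes zero_closed: "zero B \<in> carrier B"
    and add_closed: "\<lbrakk>x \<in> carrier B; y \<in> carrier B\<rbrakk> \<Longrightarrow> add B x y \<in> carrier B"
    and scale_closed: "x \<in> carrier B \<Longrightarrow> scale B z x \<in> carrier B"
    and mul_closed: "\<lbrakk>x \<in> carrier B; y \<in> carrier B\<rbrakk> \<Longrightarrow> mul B x y \<in> carrier B"
    and star_closed: "x \<in> carrier B \<Longrightarrow> star B x \<in> carrier B"
    and add_assoc: "\<lbrakk>x \<in> carrier B; y \<in> carrier B; u \<in> carrier B\<rbrakk> \<Longrightarrow>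
      add B (add B x y) u = add B x (add B y u)"
    and add_commute: "\<lbrakk>x \<in> carrier B; y \<in> carrier B\<rbrakk> \<Longrightarrow> add B x y = add B y x"
    and add_zero: "x \<in> carrier B \<Longrightarrow> add B x (zero B) = x"
    and add_minus: "x \<in> carrier B \<Longrightarrow> add B x (scale B (-1) x) = zero B"
    and scale_add_right: "\<lbrakk>x \<in> carrier B; y \<in> carrier B\<rbrakk> \<Longrightarrow>
      scale B z (add B x y) = add B (scale B z x) (scale B z y)"
    and scale_add_left: "x \<in> carrier B \<Longrightarrow>
      scale B (w + z) x = add B (scale B w x) (scale B z x)"
    and scale_scale: "x \<in> carrier B \<Longrightarrow> scale B w (scale B z x) = scale B (w * z) x"
    and scale_one: "x \<in> carrier B \<Longrightarrow> scale B 1 x = x"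
    and mul_assoc: "\<lbrakk>x \<in> carrier B; y \<in> carrier B; u \<in> carrier B\<rbrakk> \<Longrightarrow>
      mul B (mul B x y) u = mul B x (mul B y u)"
    and mul_add_left: "\<lbrakk>x \<in> carrier B; y \<in> carrier B; u \<in> carrier B\<rbrakk> \<Longrightarrow>
      mul B (add B x y) u = add B (mul B x u) (mul B y u)"
    and mul_add_right: "\<lbrakk>x \<in> carrier B; y \<in> carrier B; u \<in> carrier B\<rbrakk> \<Longrightarrow>
      mul B u (add B x y) = add B (mul B u x) (mul B u y)"
    and mul_scale_left: "\<lbrakk>x \<in> carrier B; y \<in> carrier B\<rbrakk> \<Longrightarrow>
      mul B (scale B z x) y = scale B z (mul B x y)"
    and mul_scale_right: "\<lbrakk>x \<in> carrier B; y \<in> carrier B\<rbrakk> \<Longrightarrow>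
      mul B x (scale B z y) = scale B z (mul B x y)"
    and star_star: "x \<in> carrier B \<Longrightarrow> star B (star B x) = x"
    and star_add: "\<lbrakk>x \<in> carrier B; y \<in> carrier B\<rbrakk> \<Longrightarrow>
      star B (add B x y) = add B (star B x) (star B y)"
    and star_scale: "x \<in> carrier B \<Longrightarrow> star B (scale B z x) = scale B (cnj z) (star B x)"
    and star_mul: "\<lbrakk>x \<in> carrier B; y \<in> carrier B\<rbrakk> \<Longrightarrow>
      star B (mul B x y) = mul B (star B y) (star B x)"
    and nrm_nonneg: "x \<in> carrier B \<Longrightarrow> 0 \<le> nrm B x"
    and nrm_eq_zero: "x \<in> carrier B \<Longrightarrow> nrm B x = 0 \<longleftrightarrow> x = zero B"
    and nrm_triangle: "\<lbrakk>x \<in> carrier B; y \<in> carrier B\<rbrakk> \<Longrightarrow>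
      nrm B (add B x y) \<le> nrm B x + nrm B y"
    and nrm_scale: "x \<in> carrier B \<Longrightarrow> nrm B (scale B z x) = cmod z * nrm B x"
    and nrm_mul: "\<lbrakk>x \<in> carrier B; y \<in> carrier B\<rbrakk> \<Longrightarrow>
      nrm B (mul B x y) \<le> nrm B x * nrm B y"
    and nrm_cstar: "x \<in> carrier B \<Longrightarrow> nrm B (mul B (star B x) x) = (nrm B x)\<^sup>2"
    and complete: "\<lbrakk>range s \<subseteq> carrier B;
        \<forall>e>0. \<exists>N. \<forall>m\<ge>N. \<forall>n\<ge>N. sdist B (s m) (s n) < e\<rbrakk> \<Longrightarrow>
      \<exists>x\<in>carrier B. (\<lambda>n. sdist B (s n) x) \<longlonglongrightarrow> 0"

definition type_structure :: "'a::cstar_algebra star_structure"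
  where "type_structure =
    \<lparr>carrier = UNIV, add = (+), zero = 0, scale = scaleC, mul = (*), star = adj, nrm = norm\<rparr>"

definition star_hom_into :: "'b star_structure \<Rightarrow> ('a::cstar_algebra \<Rightarrow> 'b) \<Rightarrow> bool"
  where "star_hom_into B f \<longleftrightarrow>
    range f \<subseteq> carrier B \<and>
    (\<forall>x y. f (x + y) = add B (f x) (f y)) \<and>
    (\<forall>z x. f (z *\<^sub>C x) = scale B z (f x)) \<and>
    (\<forall>x y. f (x * y) = mul B (f x) (f y)) \<and>
    (\<forall>x. f (adj x) = star B (f x))"

lemma scaleC_minus_one: "(-1) *\<^sub>C x = - (x::'a::cstar_algebra)"
  using scaleR_eq_scaleC[of "-1" x] by simp

lemma cstar_structure_type: "cstar_structure (type_structure :: 'a::cstar_algebra star_structure)"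
proof -
  have sdist: "sdist type_structure x y = dist x y" for x y :: 'a
    by (simp add: sdist_def type_structure_def scaleC_minus_one dist_norm)
  show ?thesis
  proof unfold_locales
    fix s :: "nat \<Rightarrow> 'a"
    assume "\<forall>e>0. \<exists>N. \<forall>m\<ge>N. \<forall>n\<ge>N. sdist type_structure (s m) (s n) < e"
    then have "Cauchy s"
      unfolding sdist Cauchy_def by blast
    then obtain x where "s \<longlonglongrightarrow> x"
      using Cauchy_convergent convergent_def by blast
    then show "\<exists>x\<in>carrier type_structure. (\<lambda>n. sdist type_structure (s n) x) \<longlonglongrightarrow> 0"
      unfolding sdist using tendsto_dist_iff[of s x sequentially]
      by (auto simp: type_structure_def)
  qed (auto simp: type_structure_def scaleC_add_right scaleC_add_left scaleC_scaleC scaleC_one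
      scaleC_minus_one algebra_simps mult_scaleC_left mult_scaleC_right adj_adj adj_add
      adj_scaleC adj_mult cstar_identity norm_scaleC norm_triangle_ineq norm_mult_ineq)
qed

lemma star_hom_into_type: "star_hom_into type_structure f \<longleftrightarrow> star_hom f"
  by (auto simp: star_hom_into_def star_hom_def type_structure_def Vector_Spaces.linear_iff
      complex_vector.vector_space_axioms)


section \<open>The infinite free product of copies of \<open>A\<close>, and its shift\<close>

definition universal_at ::
    "'b itself \<Rightarrow> (nat \<Rightarrow> 'a::cstar_algebra \<Rightarrow> 'p::cstar_algebra) \<Rightarrow> bool"
  where "universal_at T \<theta> \<longleftrightarrow>
    (\<forall>(B :: 'b star_structure) (\<pi> :: nat \<Rightarrow> 'a \<Rightarrow> 'b).
      cstar_structure B \<longrightarrow> (\<forall>k. star_hom_into B (\<pi> k)) \<longrightarrow>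
      (\<exists>!\<rho>. star_hom_into B \<rho> \<and> (\<forall>k. \<pi> k = \<rho> \<circ> \<theta> k)))"

text \<open>
  A formula cannot quantify over the type of the test algebra \<open>B\<close>, so the carriers
  of the test algebras are the subsets of one type.  The type chosen is large enough
  for this to be the full universal property.  Indeed, given \<open>\<pi>\<^sub>0, \<pi>\<^sub>1, \<dots> : A \<rightarrow> B\<close>
  into any C*-algebra \<open>B\<close>, the C*-subalgebra of \<open>B\<close> generated by the ranges contains all
  that is relevant.  Finite sums of words \<open>\<pi>\<^sub>k\<^sub>1(a\<^sub>1) \<dots> \<pi>\<^sub>k\<^sub>n(a\<^sub>n)\<close>, each word being coded by
  the list of its letters \<open>(k\<^sub>i, a\<^sub>i)\<close>, are dense in it (scalars can be absorbed in a
  letter).  Choosing for each element a sequence of codes of sums converging to it embeds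
  this subalgebra into the type below, along which its structure is transported.
\<close>

type_synonym 'a test_type = "nat \<Rightarrow> (nat \<times> 'a) list list"

definition free_product :: "(nat \<Rightarrow> 'a::cstar_algebra \<Rightarrow> 'p::cstar_algebra) \<Rightarrow> bool"
  where "free_product \<theta> \<longleftrightarrow>
    (\<forall>k. star_hom (\<theta> k)) \<and>
    cstar_subalgebra hull (\<Union>k. range (\<theta> k)) = UNIV \<and>
    universal_at TYPE('a test_type) \<theta>"

definition is_shift ::
    "(nat \<Rightarrow> 'a::cstar_algebra \<Rightarrow> 'p::cstar_algebra) \<Rightarrow> ('p \<Rightarrow> 'p) \<Rightarrow> bool"
  where "is_shift \<theta> \<sigma> \<longleftrightarrow> star_hom \<sigma> \<and> (\<forall>k. \<sigma> \<circ> \<theta> k = \<theta> (Suc k))"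


section \<open>Conditional expectations and \<open>\<alpha>\<close>-expectations\<close>

text \<open>
  In this section \<open>A\<close> is a C*-subalgebra of the algebra \<open>B\<close> formed by the type \<open>'b\<close>, and
  \<open>E : B \<rightarrow> A\<close> is regarded as a map \<open>B \<rightarrow> B\<close>.  The notion of an \<open>\<alpha>\<close>-expectation is meant
  for a *-endomorphism \<open>\<alpha>\<close> of \<open>B\<close> such that \<open>A \<union> \<alpha>(A) \<union> \<alpha>\<^sup>2(A) \<union> \<dots>\<close> generates \<open>B\<close>.
  For \<open>\<alpha>\<close> the shift of the free product and \<open>A\<close> the range of \<open>\<theta>\<^sub>0\<close> these conditions hold, since
  then \<open>\<alpha>\<^sup>k(A)\<close> is the range of \<open>\<theta>\<^sub>k\<close>.
\<close>

definition conditional_expectation :: "'b::cstar_algebra set \<Rightarrow> ('b \<Rightarrow> 'b) \<Rightarrow> bool"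
  where "conditional_expectation A E \<longleftrightarrow>
    clinear E \<and> (\<forall>x. positive x \<longrightarrow> positive (E x)) \<and> E \<circ> E = E \<and> range E = A \<and>
    (\<forall>a\<in>A. \<forall>x. E (a * x) = a * E x)"

definition hereditary :: "'b::cstar_algebra set \<Rightarrow> 'b set"
  where "hereditary A = closure (complex_vector.span {a * x * b | a x b. a \<in> A \<and> b \<in> A})"

definition alpha_expectation ::
    "'b::cstar_algebra set \<Rightarrow> ('b \<Rightarrow> 'b) \<Rightarrow> ('b \<Rightarrow> 'b) \<Rightarrow> bool"
  where "alpha_expectation A \<alpha> E \<longleftrightarrow>
    conditional_expectation A E \<and>
    E \<circ> \<alpha> = E \<circ> \<alpha> \<circ> E \<and>
    (\<forall>x\<in>hereditary A. \<forall>y\<in>hereditary A. E (x * y) = E x * E y)"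

end

theory Submission
  imports Defs "HOL-Library.Poly_Mapping"
begin

text \<open>
  An element of the free product is a limit of sums of words
  \<open>\<theta>\<^sub>k\<^sub>1(a\<^sub>1) \<dots> \<theta>\<^sub>k\<^sub>n(a\<^sub>n)\<close>, and a \<open>\<sigma>\<close>-expectation \<open>E\<close> with \<open>E \<circ> \<sigma> = \<phi>\<close> on \<open>A\<close> has no choice on words.
  It is multiplicative at a letter of index \<open>0\<close>, that is \<open>E(x a y) = E(x) a E(y)\<close> for \<open>a \<in> A\<close>, and
  a word without letters of index \<open>0\<close> is a shift \<open>\<sigma>(w)\<close>, on which \<open>E(\<sigma>(w)) = E(\<sigma>(E(w))) = \<phi>(E(w))\<close>.  The
  former comes from the multiplicativity of \<open>E\<close> on the hereditary subalgebra by approximate units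
  (\<open>T_multiplicative_over_range\<close>).  A
  conditional expectation is moreover contractive (\<open>norm_T_le\<close>), whence uniqueness follows from
  density (\<open>uniqueness\<close>).

  For existence the same recursion defines the moments \<open>\<mu>(w)\<close> of formal words, with \<open>\<mu>([]) = 1\<close> in
  the unitization of \<open>A\<close>, and hence a linear map \<open>E\<close> on the free *-algebra over all letters \<open>(k, a)\<close>.
  The crucial point is that \<open>E\<close> is positive, and even satisfies \<open>E(x)\<^sup>* E(x) \<le> E(x\<^sup>* x)\<close>.  This is proved
  by an induction for matrices (\<open>limit_gram_moment_defect\<close>): complete positivity of \<open>\<phi>\<close>
  preserves the Schwarz inequality of the moments of the unshifted words, and the Kadison-Schwarz
  inequality of \<open>\<phi>\<close> (\<open>limit_gram_schwarz_defect\<close>) supplies the rest.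

  The positive form \<open>E(x\<^sup>* y)\<close> makes the free *-algebra a pre-Hilbert module on which it acts by left
  multiplication; the operator norm \<open>p\<close> of this action is a C*-seminorm with \<open>\<parallel>E(x)\<parallel> \<le> p(x)\<close>.  The
  completion with respect to \<open>p\<close> is a C*-algebra to which the universal property applies.  Since
  a *-homomorphism is contractive, \<open>p(x)\<close> is at most the norm of the element of the free product
  denoted by \<open>x\<close> (\<open>p_le_norm_eval\<close>).  So \<open>E\<close> descends to the free product and extends by continuity, and
  its properties pass from words to limits (\<open>existence\<close>).

  The facts about C*-algebras on which this rests (square roots, positivity of \<open>u\<^sup>* u\<close>, approximate units,
  contractivity of *-homomorphisms) are derived without spectral theory.  The
  tools are the power series of the square root on the closed unit ball and the following
  observation: if \<open>v\<close>, \<open>w\<close> are commuting and self-adjoint and \<open>v\<^sup>2 + w\<^sup>2 = 1\<close>, then \<open>v + \<i> w\<close> is unitary, so that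
  \<open>\<parallel>v\<parallel> \<le> 1\<close>.
\<close>

section \<open>Basic calculus in C*-algebras\<close>

lemmas scaleC_simps = mult_scaleC_left mult_scaleC_right scaleC_scaleC scaleC_one

lemma scaleC_zero_left [simp]: "0 *\<^sub>C x = (0::'a::cstar_algebra)"
  by (rule complex_vector.scale_zero_left)

lemma scaleC_zero_right [simp]: "z *\<^sub>C 0 = (0::'a::cstar_algebra)"
  by (rule complex_vector.scale_zero_right)

lemma adj_zero [simp]: "adj 0 = (0::'a::cstar_algebra)"
  using adj_scaleC[of 0 0] by simp

lemma adj_minus: "adj (- x) = - adj (x::'a::cstar_algebra)"
  using adj_scaleC[of "-1" x] by (simp add: scaleC_minus_one)

lemma adj_diff: "adj (x - y) = adj x - adj (y::'a::cstar_algebra)"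
  using adj_add[of x "- y"] by (simp add: adj_minus)

lemma adj_scaleR: "adj (r *\<^sub>R x) = r *\<^sub>R adj (x::'a::cstar_algebra)"
  by (simp add: scaleR_eq_scaleC adj_scaleC)

lemma adj_sum: "adj (\<Sum>i\<in>I. f i) = (\<Sum>i\<in>I. adj (f i :: 'a::cstar_algebra))"
  by (induction I rule: infinite_finite_induct) (auto simp: adj_add)

lemma le_of_square_le_mult: "0 \<le> b \<Longrightarrow> a\<^sup>2 \<le> b * a \<Longrightarrow> a \<le> (b::real)"
  by (cases "a \<le> 0") (auto simp: power2_eq_square)

lemma norm_adj [simp]: "norm (adj x) = norm (x::'a::cstar_algebra)"
proof -
  have le: "norm y \<le> norm (adj y)" for y :: 'a
    using norm_mult_ineq[of "adj y" y] by (rule_tac le_of_square_le_mult) (simp_all add: cstar_identity)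
  show ?thesis
    using le[of x] le[of "adj x"] by (simp add: adj_adj)
qed

lemma bounded_linear_adj: "bounded_linear (adj :: 'a::cstar_algebra \<Rightarrow> 'a)"
  by (rule bounded_linear_intro[where K = 1]) (auto simp: adj_add adj_scaleR)

lemma norm_mult_adj: "norm (x * adj x) = (norm (x::'a::cstar_algebra))\<^sup>2"
  using cstar_identity[of "adj x"] by (simp add: adj_adj)

lemma adj_mult_eq_zero: "adj x * x = 0 \<longleftrightarrow> x = (0::'a::cstar_algebra)"
  using cstar_identity[of x] by auto

lemma bounded_linear_scaleC: "bounded_linear (\<lambda>x::'a::cstar_algebra. z *\<^sub>C x)"
  by (rule bounded_linear_intro[where K = "cmod z"])
    (auto simp: scaleC_add_right scaleR_eq_scaleC scaleC_scaleC mult.commute norm_scaleC)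

lemma clinear_iff:
  "clinear f \<longleftrightarrow> (\<forall>x y. f (x + y) = f x + f y) \<and> (\<forall>z x. f (z *\<^sub>C x) = z *\<^sub>C f x)"
  by (auto simp: Vector_Spaces.linear_iff complex_vector.vector_space_axioms)

lemma clinear_bounded_linear:
  fixes f :: "'a::cstar_algebra \<Rightarrow> 'b::cstar_algebra"
  assumes "clinear f" and "\<And>x. norm (f x) \<le> K * norm x"
  shows "bounded_linear f"
  using assms by (intro bounded_linear_intro[where K = K])
    (auto simp: clinear_iff scaleR_eq_scaleC mult.commute)

section \<open>The unitization of a C*-algebra\<close>

datatype 'a unitization = Unitize (alg: 'a) (scal: complex)

text \<open>
  The norm of the unitization combines the operator norm of left multiplication with the modulus of
  the scalar part.  If the algebra has a unit already, the operator norm alone vanishes on the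
  difference of the two units; the maximum is a C*-norm in every case.
\<close>

definition lmul :: "'a::cstar_algebra unitization \<Rightarrow> 'a \<Rightarrow> 'a"
  where "lmul x b = alg x * b + scal x *\<^sub>C b"

lemma bounded_linear_lmul: "bounded_linear (lmul x)"
  unfolding lmul_def
  by (intro bounded_linear_add bounded_linear_mult_right bounded_linear_scaleC)

instantiation unitization :: (cstar_algebra) real_normed_algebra_1
begin

definition "0 = Unitize 0 0"
definition "1 = Unitize 0 1"
definition "x + y = Unitize (alg x + alg y) (scal x + scal y)"
definition "x - y = Unitize (alg x - alg y) (scal x - scal y)"
definition "- x = Unitize (- alg x) (- scal x)"
definition "x * y = Unitize (alg x * alg y + scal y *\<^sub>C alg x + scal x *\<^sub>C alg y) (scal x * scal y)"
definition "r *\<^sub>R x = Unitize (r *\<^sub>R alg x) (r *\<^sub>R scal x)"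
definition "norm x = max (onorm (lmul x)) (cmod (scal x))"
definition "dist x y = norm (x - y :: 'a unitization)"
definition "sgn x = inverse (norm x) *\<^sub>R (x :: 'a unitization)"
definition "uniformity = (INF e\<in>{0 <..}. principal {(x, y :: 'a unitization). dist x y < e})"
definition "open (S :: 'a unitization set) = (\<forall>x\<in>S. \<forall>\<^sub>F (x', y) in uniformity. x' = x \<longrightarrow> y \<in> S)"

lemmas unitization_defs = zero_unitization_def one_unitization_def plus_unitization_def
  minus_unitization_def uminus_unitization_def times_unitization_def scaleR_unitization_def

lemma lmul_plus: "lmul (x + y) = (\<lambda>b. lmul x b + lmul y b)"
  by (auto simp: lmul_def unitization_defs algebra_simps scaleC_add_left)

lemma lmul_times: "lmul (x * y) = lmul x \<circ> lmul y"
  by (auto simp: lmul_def unitization_defs algebra_simps scaleC_add_left scaleC_add_right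
      scaleC_simps)

lemma lmul_scaleR: "lmul (r *\<^sub>R x) = (\<lambda>b. r *\<^sub>R lmul x b)"
  by (auto simp: lmul_def unitization_defs algebra_simps scaleR_eq_scaleC scaleC_scaleC
      scaleC_add_right scaleC_simps scaleC_complex_def)

instance
proof
  fix x y z :: "'a unitization" and a b :: real
  show "norm x = 0 \<longleftrightarrow> x = 0"
  proof
    assume 0: "norm x = 0"
    have "0 \<le> onorm (lmul x)"
      by (rule onorm_pos_le[OF bounded_linear_lmul])
    with 0 have "onorm (lmul x) = 0" and s: "scal x = 0"
      by (auto simp: norm_unitization_def max_def split: if_splits)
    then have "lmul x (adj (alg x)) = 0"
      using onorm_eq_0[OF bounded_linear_lmul] by blast
    with s have "alg x * adj (alg x) = 0"
      by (simp add: lmul_def)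
    then have "alg x = 0"
      using norm_mult_adj[of "alg x"] by simp
    with s show "x = 0"
      by (cases x) (simp add: unitization_defs)
  next
    assume "x = 0"
    then have "lmul x = (\<lambda>_. 0)" and "scal x = 0"
      by (auto simp: lmul_def unitization_defs)
    then show "norm x = 0"
      by (simp add: norm_unitization_def onorm_zero)
  qed
  show "norm (x + y) \<le> norm x + norm y"
  proof -
    have "onorm (lmul (x + y)) \<le> onorm (lmul x) + onorm (lmul y)"
      unfolding lmul_plus by (rule onorm_triangle[OF bounded_linear_lmul bounded_linear_lmul])
    moreover have "cmod (scal (x + y)) \<le> cmod (scal x) + cmod (scal y)"
      by (simp add: unitization_defs norm_triangle_ineq)
    ultimately show ?thesis
      by (simp add: norm_unitization_def max_def)
  qed
  show "norm (a *\<^sub>R x) = \<bar>a\<bar> * norm x"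
    unfolding norm_unitization_def lmul_scaleR onorm_scaleR[OF bounded_linear_lmul]
    by (simp add: unitization_defs max_mult_distrib_left)
  show "norm (x * y) \<le> norm x * norm y"
  proof -
    have "onorm (lmul (x * y)) \<le> onorm (lmul x) * onorm (lmul y)"
      unfolding lmul_times by (rule onorm_compose[OF bounded_linear_lmul bounded_linear_lmul])
    also have "\<dots> \<le> norm x * norm y"
      using onorm_pos_le[OF bounded_linear_lmul[of x]] onorm_pos_le[OF bounded_linear_lmul[of y]]
      by (intro mult_mono) (auto simp: norm_unitization_def)
    finally have *: "onorm (lmul (x * y)) \<le> norm x * norm y" .
    have "cmod (scal (x * y)) = cmod (scal x) * cmod (scal y)"
      by (simp add: unitization_defs norm_mult)
    also have "\<dots> \<le> norm x * norm y"
      by (intro mult_mono) (auto simp: norm_unitization_def le_max_iff_disj)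
    finally show ?thesis
      using * by (simp add: norm_unitization_def[of "x * y"])
  qed
  show "norm (1 :: 'a unitization) = 1"
  proof -
    have "lmul (1 :: 'a unitization) = (\<lambda>b. b)"
      by (auto simp: lmul_def unitization_defs scaleC_one)
    then show ?thesis
      using onorm_id_le[where 'a = 'a] by (simp add: norm_unitization_def unitization_defs max_def)
  qed
  show "dist x y = norm (x - y)" "sgn x = inverse (norm x) *\<^sub>R x"
    "uniformity = (INF e\<in>{0 <..}. principal {(x, y :: 'a unitization). dist x y < e})"
    by (fact dist_unitization_def sgn_unitization_def uniformity_unitization_def)+
  show "open S \<longleftrightarrow> (\<forall>x\<in>S. \<forall>\<^sub>F (x', y) in uniformity. x' = x \<longrightarrow> y \<in> S)"
    for S :: "'a unitization set"
    by (fact open_unitization_def)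
qed (auto simp: unitization_defs algebra_simps scaleR_add_left scaleR_add_right scaleC_add_left
    scaleC_add_right scaleC_simps scaleR_eq_scaleC scaleC_complex_def)

end

definition emb :: "'a::cstar_algebra \<Rightarrow> 'a unitization"
  where "emb a = Unitize a 0"

lemma alg_simps [simp]:
  "alg (0 :: 'a::cstar_algebra unitization) = 0"
  "alg (1 :: 'a unitization) = 0"
  "alg (x + y) = alg x + alg y"
  "alg (x - y) = alg x - alg y"
  "alg (- x) = - alg x"
  "alg (emb a) = a"
  "scal (0 :: 'a unitization) = 0"
  "scal (1 :: 'a unitization) = 1"
  "scal (x + y) = scal x + scal y"
  "scal (x - y) = scal x - scal y"
  "scal (- x) = - scal x"
  "scal (x * y) = scal x * scal y"
  "scal (emb a) = 0"
  for x y :: "'a::cstar_algebra unitization"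
  by (auto simp: unitization_defs emb_def)

lemma norm_emb [simp]: "norm (emb a) = norm a"
proof -
  have "lmul (emb a) = (\<lambda>b. a * b)"
    by (auto simp: lmul_def emb_def)
  moreover have "onorm (\<lambda>b. a * b) = norm a"
  proof (rule antisym)
    show "onorm (\<lambda>b. a * b) \<le> norm a"
      by (rule onorm_bound) (auto simp: norm_mult_ineq)
    show "norm a \<le> onorm (\<lambda>b. a * b)"
    proof (cases "a = 0")
      case False
      have "norm a * norm a \<le> onorm (\<lambda>b. a * b) * norm a"
        using onorm[OF bounded_linear_mult_right[of a], of "adj a"]
        by (simp add: norm_mult_adj power2_eq_square)
      then show ?thesis
        using False by simp
    qed (simp add: onorm_zero)
  qed
  ultimately show ?thesis
    by (simp add: norm_unitization_def)
qed

lemma norm_scal_le: "cmod (scal x) \<le> norm x"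
  by (simp add: norm_unitization_def)

lemma norm_alg_le: "norm (alg x) \<le> 2 * norm x"
proof -
  have "norm (Unitize 0 (scal x) :: 'a unitization) \<le> cmod (scal x)"
  proof -
    have "onorm (lmul (Unitize 0 (scal x) :: 'a unitization)) \<le> cmod (scal x)"
      by (rule onorm_bound) (auto simp: lmul_def norm_scaleC)
    then show ?thesis
      by (simp add: norm_unitization_def)
  qed
  moreover have "emb (alg x) = x - Unitize 0 (scal x)"
    by (cases x) (simp add: emb_def unitization_defs)
  ultimately have "norm (emb (alg x)) \<le> norm x + cmod (scal x)"
    using norm_triangle_ineq4[of x "Unitize 0 (scal x)"] by simp
  then show ?thesis
    using norm_scal_le[of x] by simp
qed

instantiation unitization :: (cstar_algebra) cstar_algebra
begin

definition "z *\<^sub>C x = Unitize (z *\<^sub>C alg x) (z * scal x)"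
definition "adj x = Unitize (adj (alg x)) (cnj (scal x))"

lemma adj_lmul: "adj (lmul x b) * c = adj b * lmul (adj x) c"
  by (simp add: lmul_def adj_unitization_def adj_add adj_mult adj_scaleC algebra_simps scaleC_simps)

instance
proof
  fix X :: "nat \<Rightarrow> 'a unitization"
  assume "Cauchy X"
  have bl_scal: "bounded_linear (scal :: 'a unitization \<Rightarrow> complex)"
    by (rule bounded_linear_intro[where K = 1]) (auto simp: norm_scal_le scaleR_unitization_def)
  have bl_alg: "bounded_linear (alg :: 'a unitization \<Rightarrow> 'a)"
    by (rule bounded_linear_intro[where K = 2])
      (auto simp: norm_alg_le[unfolded mult.commute[of 2]] scaleR_unitization_def)
  obtain a where a: "(\<lambda>n. alg (X n)) \<longlonglongrightarrow> a"
    using bounded_linear.Cauchy[OF bl_alg \<open>Cauchy X\<close>] Cauchy_convergent convergent_def by blast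
  obtain s where s: "(\<lambda>n. scal (X n)) \<longlonglongrightarrow> s"
    using bounded_linear.Cauchy[OF bl_scal \<open>Cauchy X\<close>] Cauchy_convergent convergent_def by blast
  have bl_emb: "bounded_linear (emb :: 'a \<Rightarrow> 'a unitization)"
  proof (rule bounded_linear_intro[where K = 1])
    show "norm (emb b) \<le> norm b * 1" for b :: 'a
      by simp
  qed (auto simp: unitization_defs emb_def)
  have bl_const: "bounded_linear (\<lambda>z. Unitize 0 z :: 'a unitization)"
  proof (rule bounded_linear_intro[where K = 1])
    show "norm (Unitize 0 z :: 'a unitization) \<le> norm z * 1" for z
      using onorm_bound[of "cmod z" "lmul (Unitize 0 z :: 'a unitization)"]
      by (simp add: lmul_def norm_scaleC norm_unitization_def)
  qed (auto simp: unitization_defs)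
  have "(\<lambda>n. emb (alg (X n)) + Unitize 0 (scal (X n))) \<longlonglongrightarrow> emb a + Unitize 0 s"
    by (intro tendsto_add bounded_linear.tendsto[OF bl_emb] bounded_linear.tendsto[OF bl_const] a s)
  moreover have "emb (alg (X n)) + Unitize 0 (scal (X n)) = X n" for n
    by (cases "X n") (simp add: emb_def unitization_defs)
  ultimately show "convergent X"
    by (auto simp: convergent_def)
next
  fix x y :: "'a unitization" and w z :: complex and r :: real
  have norm_le: "norm (z *\<^sub>C x) \<le> cmod z * norm x" for z and x :: "'a unitization"
  proof -
    have eq: "lmul (z *\<^sub>C x) b = z *\<^sub>C lmul x b" for b
      by (simp add: lmul_def scaleC_unitization_def scaleC_simps scaleC_add_right)
    have "onorm (lmul (z *\<^sub>C x)) \<le> cmod z * onorm (lmul x)"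
    proof (rule onorm_bound)
      show "norm (lmul (z *\<^sub>C x) b) \<le> cmod z * onorm (lmul x) * norm b" for b
        using onorm[OF bounded_linear_lmul[of x], of b]
        by (simp add: eq norm_scaleC mult_left_mono mult.assoc)
    qed (simp add: onorm_pos_le[OF bounded_linear_lmul])
    also have "\<dots> \<le> cmod z * norm x"
      by (simp add: mult_left_mono norm_unitization_def)
    finally show ?thesis
      by (simp add: norm_unitization_def[of "z *\<^sub>C x"])
         (simp add: scaleC_unitization_def norm_mult mult_left_mono norm_scal_le)
  qed
  show "norm (z *\<^sub>C x) = cmod z * norm x"
  proof (cases "z = 0")
    case True
    have "0 *\<^sub>C x = 0"
      by (simp add: scaleC_unitization_def unitization_defs)
    with True show ?thesis
      by simp
  next
    case False
    have "x = inverse z *\<^sub>C z *\<^sub>C x"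
      using False by (cases x) (simp add: scaleC_unitization_def scaleC_simps)
    then have "norm x \<le> cmod (inverse z) * norm (z *\<^sub>C x)"
      using norm_le[of "inverse z" "z *\<^sub>C x"] by simp
    then have "cmod z * norm x \<le> norm (z *\<^sub>C x)"
      using False by (simp add: norm_inverse norm_divide field_simps)
    with norm_le[of z x] show ?thesis
      by simp
  qed
  have onorm_sq: "(onorm (lmul x))\<^sup>2 \<le> onorm (lmul (adj x * x))" for x :: "'a unitization"
  proof -
    have "norm (lmul x b) \<le> sqrt (onorm (lmul (adj x * x))) * norm b" for b
    proof -
      have "(norm (lmul x b))\<^sup>2 = norm (adj b * lmul (adj x * x) b)"
        by (simp flip: cstar_identity add: adj_lmul lmul_times)
      also have "\<dots> \<le> norm b * (onorm (lmul (adj x * x)) * norm b)"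
        using onorm[OF bounded_linear_lmul[of "adj x * x"], of b]
        by (intro order_trans[OF norm_mult_ineq]) (simp add: mult_left_mono)
      finally have "(norm (lmul x b))\<^sup>2 \<le> (sqrt (onorm (lmul (adj x * x))) * norm b)\<^sup>2"
        by (simp add: power_mult_distrib onorm_pos_le[OF bounded_linear_lmul] power2_eq_square ac_simps)
      then show ?thesis
        by (rule power2_le_imp_le) (simp add: onorm_pos_le[OF bounded_linear_lmul])
    qed
    then have "onorm (lmul x) \<le> sqrt (onorm (lmul (adj x * x)))"
      by (intro onorm_bound) (auto simp: onorm_pos_le[OF bounded_linear_lmul])
    then show ?thesis
      using real_sqrt_ge_0_iff onorm_pos_le[OF bounded_linear_lmul]
      by (metis power_mono real_sqrt_pow2)
  qed
  have norm_sq: "(norm x)\<^sup>2 \<le> norm (adj x * x)" for x :: "'a unitization"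
  proof -
    have s: "scal (adj x * x) = cnj (scal x) * scal x"
      by (simp add: times_unitization_def adj_unitization_def)
    have *: "(cmod (scal x))\<^sup>2 \<le> norm (adj x * x)"
      by (rule order_trans[OF _ norm_scal_le]) (simp only: s norm_mult complex_mod_cnj power2_eq_square order_refl)
    have "(onorm (lmul x))\<^sup>2 \<le> norm (adj x * x)"
      using onorm_sq[of x] by (simp add: norm_unitization_def)
    with * show ?thesis
      by (cases "onorm (lmul x) \<le> cmod (scal x)")
        (simp_all add: norm_unitization_def[of x] max_def)
  qed
  have adj_adj_u: "adj (adj x) = x" for x :: "'a unitization"
    by (cases x) (simp add: adj_unitization_def adj_adj)
  have le: "norm y \<le> norm (adj y)" for y :: "'a unitization"
    using order_trans[OF norm_sq norm_mult_ineq, of y] by (rule_tac le_of_square_le_mult) auto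
  have "norm (adj x) = norm x"
    using le[of x] le[of "adj x"] by (simp add: adj_adj_u)
  then show "norm (adj x * x) = (norm x)\<^sup>2"
    using norm_sq[of x] norm_mult_ineq[of "adj x" x] by (simp add: power2_eq_square)
  show "adj (adj x) = x"
    by (rule adj_adj_u)
qed (auto simp: unitization_defs scaleC_unitization_def adj_unitization_def algebra_simps
    scaleC_add_left scaleC_add_right scaleC_simps scaleR_eq_scaleC scaleC_complex_def
    adj_add adj_mult adj_scaleC)

end

lemma unitization_simps [simp]:
  "alg (z *\<^sub>C x) = z *\<^sub>C alg x"
  "scal (z *\<^sub>C x) = z * scal x"
  "alg (adj x) = adj (alg x)"
  "scal (adj x) = cnj (scal x)"
  for x y :: "'a::cstar_algebra unitization"
  by (auto simp: scaleC_unitization_def adj_unitization_def)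

lemma alg_mult [simp]: "alg (x * y) = alg x * alg y + scal y *\<^sub>C alg x + scal x *\<^sub>C alg y"
  by (simp add: times_unitization_def)

lemma unitization_eq_iff: "x = y \<longleftrightarrow> alg x = alg y \<and> scal x = scal y"
  by (cases x; cases y) auto

lemma emb_alg: "scal x = 0 \<Longrightarrow> emb (alg x) = x"
  by (simp add: unitization_eq_iff)

lemma emb_eq_iff [simp]: "emb a = emb b \<longleftrightarrow> a = b"
  by (simp add: emb_def)

lemma emb_arith:
  "emb (a + b) = emb a + emb b"
  "emb (a - b) = emb a - emb b"
  "emb (- a) = - emb a"
  "emb 0 = 0"
  "emb (a * b) = emb a * emb b"
  "emb (z *\<^sub>C a) = z *\<^sub>C emb a"
  "emb (adj a) = adj (emb a)"
  by (auto simp: unitization_eq_iff)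

lemma emb_sum: "emb (\<Sum>i\<in>I. f i) = (\<Sum>i\<in>I. emb (f i))"
  by (induction I rule: infinite_finite_induct) (auto simp: emb_arith)

lemma bounded_linear_emb: "bounded_linear emb"
  by (rule bounded_linear_intro[where K = 1])
    (auto simp: emb_arith scaleR_eq_scaleC)

lemma bounded_linear_alg: "bounded_linear (alg :: 'a::cstar_algebra unitization \<Rightarrow> 'a)"
  by (rule bounded_linear_intro[where K = 2]) (auto simp: norm_alg_le[unfolded mult.commute[of 2]] scaleR_eq_scaleC)

lemma bounded_linear_scal: "bounded_linear (scal :: 'a::cstar_algebra unitization \<Rightarrow> complex)"
  by (rule bounded_linear_intro[where K = 1])
    (auto simp: norm_scal_le scaleR_unitization_def)

section \<open>Square roots and the positive cone\<close>

text \<open>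
  The coefficients of the power series of \<open>t \<mapsto> sqrt (1 - t)\<close>.
\<close>

definition sqrt_coeff :: "nat \<Rightarrow> real"
  where "sqrt_coeff n = (-1) ^ n * ((1/2) gchoose n)"

lemma sqrt_coeff_0: "sqrt_coeff 0 = 1"
  by (simp add: sqrt_coeff_def)

lemma gchoose_minus_half_sign: "0 \<le> (-1) ^ m * ((- (1/2) :: real) gchoose m)"
proof -
  have "(-1) ^ m * ((- (1/2) :: real) gchoose m) = (of_nat m - 1/2) gchoose m"
    by (subst gbinomial_negated_upper[of "- (1/2)"]) (simp flip: power_mult_distrib mult.assoc)
  also have "\<dots> = (\<Prod>i<m. (of_nat m - 1/2 :: real) - of_nat i) / fact m"
    by (simp add: gbinomial_prod_rev atLeast0LessThan)
  also have "\<dots> \<ge> 0"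
    by (intro divide_nonneg_nonneg prod_nonneg) auto
  finally show ?thesis .
qed

lemma sqrt_coeff_Suc_le_0: "sqrt_coeff (Suc n) \<le> 0"
proof -
  have "sqrt_coeff (Suc n) = - (1 / (2 * Suc n)) * ((-1) ^ n * ((- (1/2) :: real) gchoose n))"
    using gbinomial_absorption'[of "Suc n" "1/2 :: real"] by (simp add: sqrt_coeff_def field_simps)
  also have "\<dots> \<le> 0"
    using gchoose_minus_half_sign[of n]
    by (metis mult_nonpos_nonneg neg_le_0_iff_le of_nat_0_le_iff zero_le_divide_1_iff
        zero_le_mult_iff zero_le_numeral)
  finally show ?thesis .
qed

text \<open>
  The partial sums of the series at \<open>t = 1\<close> have a closed form, which shows that they are nonnegative.  As only the
  constant coefficient is positive, the series converges absolutely on the closed unit ball.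
\<close>

lemma sum_sqrt_coeff_Suc_le: "(\<Sum>i<n. - sqrt_coeff (Suc i)) \<le> 1"
proof -
  have "(\<Sum>k\<le>n. sqrt_coeff k) = (-1) ^ n * ((1/2 - 1 :: real) gchoose n)"
    using gbinomial_sum_lower_neg[of "1/2 :: real" n] by (simp add: sqrt_coeff_def mult.commute)
  also have "\<dots> \<ge> 0"
    using gchoose_minus_half_sign[of n] by simp
  finally have "0 \<le> (\<Sum>k\<le>n. sqrt_coeff k)" .
  also have "(\<Sum>k\<le>n. sqrt_coeff k) = 1 + (\<Sum>i<n. sqrt_coeff (Suc i))"
    by (simp add: sum.atMost_shift sqrt_coeff_0)
  finally show ?thesis
    by (simp add: sum_negf)
qed

lemma summable_sqrt_coeff: "summable (\<lambda>n. - sqrt_coeff (Suc n))"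
  by (rule summableI_nonneg_bounded[where x = 1])
    (use sqrt_coeff_Suc_le_0 sum_sqrt_coeff_Suc_le in auto)

lemma suminf_sqrt_coeff_le: "suminf (\<lambda>n. - sqrt_coeff (Suc n)) \<le> 1"
  by (rule suminf_le_const[OF summable_sqrt_coeff sum_sqrt_coeff_Suc_le])

lemma sqrt_coeff_convolution:
  "(\<Sum>i\<le>n. sqrt_coeff i * sqrt_coeff (n - i)) = (if n = 0 then 1 else if n = 1 then -1 else 0)"
proof -
  have "(\<Sum>i\<le>n. sqrt_coeff i * sqrt_coeff (n - i)) =
      (\<Sum>i\<in>{0..n}. (-1) ^ n * (((1/2) gchoose i) * ((1/2) gchoose (n - i))))"
    unfolding atMost_atLeast0
    by (rule sum.cong) (auto simp: sqrt_coeff_def simp flip: power_add)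
  also have "\<dots> = (-1) ^ n * ((1/2 + 1/2 :: real) gchoose n)"
    by (simp only: gbinomial_Vandermonde flip: sum_distrib_left)
  also have "\<dots> = (-1) ^ n * (of_nat (1 choose n))"
    using binomial_gbinomial[of 1 n, where 'a = real] by simp
  also have "\<dots> = (if n = 0 then 1 else if n = 1 then -1 else 0)"
    by (cases n) (auto simp: binomial_eq_0)
  finally show ?thesis .
qed

definition sqrt1m :: "'u::{real_normed_algebra_1,banach} \<Rightarrow> 'u"
  where "sqrt1m x = suminf (\<lambda>n. sqrt_coeff n *\<^sub>R x ^ n)"

context
  fixes x :: "'u::{real_normed_algebra_1,banach}"
  assumes x: "norm x \<le> 1"
begin

lemma norm_sqrt_series_le: "norm (sqrt_coeff (Suc n) *\<^sub>R x ^ Suc n) \<le> - sqrt_coeff (Suc n)"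
proof -
  have "norm (x ^ Suc n) \<le> 1"
    using norm_power_ineq[of x "Suc n"] power_le_one[of "norm x" "Suc n"] x by simp
  then have "\<bar>sqrt_coeff (Suc n)\<bar> * norm (x ^ Suc n) \<le> \<bar>sqrt_coeff (Suc n)\<bar> * 1"
    by (intro mult_left_mono) auto
  then show ?thesis
    using sqrt_coeff_Suc_le_0[of n] by simp
qed

lemma summable_norm_sqrt1m: "summable (\<lambda>n. norm (sqrt_coeff n *\<^sub>R x ^ n))"
proof -
  have "summable (\<lambda>n. norm (sqrt_coeff (Suc n) *\<^sub>R x ^ Suc n))"
    by (rule summable_comparison_test'[OF summable_sqrt_coeff, of 0])
      (use norm_sqrt_series_le in \<open>simp del: norm_scaleR power_Suc\<close>)
  then show ?thesis
    by (subst (asm) summable_Suc_iff)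
qed

lemmas summable_sqrt1m = summable_norm_cancel[OF summable_norm_sqrt1m]

lemma sqrt1m_power2: "sqrt1m x * sqrt1m x = 1 - x"
proof -
  have "(\<lambda>n. \<Sum>i\<le>n. (sqrt_coeff i *\<^sub>R x ^ i) * (sqrt_coeff (n - i) *\<^sub>R x ^ (n - i))) sums
      (sqrt1m x * sqrt1m x)"
    unfolding sqrt1m_def by (rule Cauchy_product_sums[OF summable_norm_sqrt1m summable_norm_sqrt1m])
  moreover have "(\<Sum>i\<le>n. (sqrt_coeff i *\<^sub>R x ^ i) * (sqrt_coeff (n - i) *\<^sub>R x ^ (n - i))) =
      (if n = 0 then 1 else if n = 1 then -1 else 0) *\<^sub>R x ^ n" for n
  proof -
    have "(\<Sum>i\<le>n. (sqrt_coeff i *\<^sub>R x ^ i) * (sqrt_coeff (n - i) *\<^sub>R x ^ (n - i))) =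
        (\<Sum>i\<le>n. (sqrt_coeff i * sqrt_coeff (n - i)) *\<^sub>R x ^ n)"
      by (rule sum.cong) (auto simp: mult.commute simp flip: power_add)
    then show ?thesis
      by (simp only: sqrt_coeff_convolution flip: scaleR_sum_left)
  qed
  ultimately have "(\<lambda>n. (if n = 0 then 1 else if n = 1 then -1 else 0) *\<^sub>R x ^ n) sums
      (sqrt1m x * sqrt1m x)"
    by simp
  moreover have "(\<lambda>n. (if n = 0 then 1 else if n = 1 then -1 else 0) *\<^sub>R x ^ n) sums (1 - x)"
    using sums_finite[of "{..1}" "\<lambda>n. (if n = 0 then 1 else if n = 1 then -1 else 0) *\<^sub>R x ^ n"]
    by (simp add: numeral_2_eq_2)
  ultimately show ?thesis
    by (rule sums_unique2)
qed

lemma norm_one_minus_sqrt1m_le: "norm (1 - sqrt1m x) \<le> 1"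
proof -
  have "sqrt1m x = 1 + suminf (\<lambda>n. sqrt_coeff (Suc n) *\<^sub>R x ^ Suc n)"
    unfolding sqrt1m_def using suminf_split_head[OF summable_sqrt1m] by (simp add: sqrt_coeff_0)
  then have "norm (1 - sqrt1m x) = norm (suminf (\<lambda>n. sqrt_coeff (Suc n) *\<^sub>R x ^ Suc n))"
    by simp
  also have "\<dots> \<le> suminf (\<lambda>n. - sqrt_coeff (Suc n))"
    by (rule norm_suminf_le) (rule norm_sqrt_series_le summable_sqrt_coeff)+
  also have "\<dots> \<le> 1"
    by (rule suminf_sqrt_coeff_le)
  finally show ?thesis .
qed

lemma sqrt1m_commute: "y * x = x * y \<Longrightarrow> y * sqrt1m x = sqrt1m x * y"
proof -
  assume y: "y * x = x * y"
  have "y * x ^ n = x ^ n * y" for n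
    using y by (metis power_commuting_commutes)
  then show ?thesis
    unfolding sqrt1m_def
    by (simp add: suminf_mult2[OF summable_sqrt1m] flip: suminf_mult[OF summable_sqrt1m])
qed

end

lemma adj_one [simp]: "adj 1 = (1::'u::{cstar_algebra,real_normed_algebra_1})"
  by (metis adj_adj adj_mult mult_1_right)

lemma adj_power: "adj (x ^ n) = adj x ^ n" for x :: "'u::{cstar_algebra,real_normed_algebra_1}"
  by (induction n) (auto simp: adj_mult power_commutes)

lemma adj_sqrt1m:
  fixes x :: "'u::{cstar_algebra,real_normed_algebra_1}"
  assumes "norm x \<le> 1" and "adj x = x"
  shows "adj (sqrt1m x) = sqrt1m x"
  unfolding sqrt1m_def bounded_linear.suminf[OF bounded_linear_adj summable_sqrt1m[OF assms(1)]]
  by (simp add: adj_scaleR adj_power assms(2))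

text \<open>
  That every \<open>u\<^sup>* u\<close> is positive is a theorem, \<open>pos_adj_mult\<close>.  The definition by self-adjoint roots is
  the one that works with \<open>norm_le_of_sum_squares\<close>.
\<close>

definition pos :: "'u::{cstar_algebra,real_normed_algebra_1} \<Rightarrow> bool"
  where "pos h \<longleftrightarrow> (\<exists>r. adj r = r \<and> h = r * r)"

lemma pos_adj: "pos h \<Longrightarrow> adj h = h"
  by (auto simp: pos_def adj_mult)

lemma posI: "adj r = r \<Longrightarrow> pos (r * r)"
  by (auto simp: pos_def)

text \<open>
  If \<open>v\<close>, \<open>w\<close> are commuting and self-adjoint then \<open>v + \<i> w\<close> is normal and
  \<open>(v + \<i> w)\<^sup>* (v + \<i> w) = v\<^sup>2 + w\<^sup>2\<close>, so that the C*-identity bounds its real part \<open>v\<close>.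
\<close>

lemma norm_le_of_sum_squares:
  fixes v w :: "'u::{cstar_algebra,real_normed_algebra_1}"
  assumes v: "adj v = v" and w: "adj w = w" and vw: "v * w = w * v"
  shows "(norm v)\<^sup>2 \<le> norm (v * v + w * w)"
proof -
  define u where "u = v + \<i> *\<^sub>C w"
  have adj_u: "adj u = v - \<i> *\<^sub>C w"
    using v w complex_vector.scale_minus_left[of \<i> w] by (simp add: u_def adj_add adj_scaleC)
  have "adj u * u = v * v + w * w"
    by (simp only: adj_u) (simp add: u_def algebra_simps scaleC_simps vw scaleC_minus_one)
  then have u: "(norm u)\<^sup>2 = norm (v * v + w * w)"
    using cstar_identity[of u] by simp
  have "2 *\<^sub>R v = u + adj u"
    by (simp only: adj_u) (simp add: u_def scaleR_2)
  then have "2 * norm v \<le> norm u + norm u"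
    using norm_triangle_ineq[of u "adj u"] by (metis abs_numeral norm_adj norm_scaleR)
  then have "(norm v)\<^sup>2 \<le> (norm u)\<^sup>2"
    by (intro power_mono) auto
  with u show ?thesis
    by simp
qed

lemma norm_self_adjoint_square: "adj r = r \<Longrightarrow> norm (r * r) = (norm r)\<^sup>2"
  using cstar_identity[of r] by simp

lemma adj_of_real_scale [simp]: "adj (of_real s) = (of_real s :: 'u::{cstar_algebra,real_normed_algebra_1})"
  by (simp add: of_real_def adj_scaleR)

text \<open>
  Positivity of a self-adjoint \<open>h\<close> is the metric condition \<open>norm (s - h) \<le> s\<close>; from this it
  follows that the positive elements form a closed cone.  For \<open>h = r\<^sup>2\<close>, the root \<open>w\<close> of \<open>s - h\<close>
  commutes with \<open>r\<close> and \<open>w\<^sup>2 + r\<^sup>2 = s\<close>, which bounds \<open>w\<close>.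
\<close>

lemma pos_imp_norm_le:
  fixes h :: "'u::{cstar_algebra,real_normed_algebra_1}"
  assumes "pos h" and s: "norm h \<le> s"
  shows "norm (of_real s - h) \<le> s"
proof (cases "s = 0")
  case False
  with s have "s > 0"
    using norm_ge_zero[of h] by linarith
  obtain r where r: "adj r = r" "h = r * r"
    using assms by (auto simp: pos_def)
  define x where "x = inverse s *\<^sub>R h"
  have nx: "norm x \<le> 1"
    using s \<open>s > 0\<close> by (simp add: x_def field_simps)
  have ax: "adj x = x"
    using pos_adj[OF \<open>pos h\<close>] by (simp add: x_def adj_scaleR)
  define w where "w = sqrt s *\<^sub>R sqrt1m x"
  have ww: "w * w = of_real s - h"
    using \<open>s > 0\<close>
    by (simp add: w_def sqrt1m_power2[OF nx] scaleR_diff_right of_real_def)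
       (simp add: x_def)
  have aw: "adj w = w"
    by (simp add: w_def adj_scaleR adj_sqrt1m[OF nx ax])
  have "r * x = x * r"
    by (simp add: x_def r mult.assoc)
  then have "w * r = r * w"
    by (simp add: w_def sqrt1m_commute[OF nx])
  then have "(norm w)\<^sup>2 \<le> norm (w * w + r * r)"
    by (intro norm_le_of_sum_squares aw r)
  also have "w * w + r * r = of_real s"
    using ww r by simp
  finally show ?thesis
    using \<open>s > 0\<close> norm_self_adjoint_square[OF aw] ww by simp
qed (use s in simp)

text \<open>
  Write \<open>h = s (1 - x)\<close>, where \<open>norm x \<le> 1\<close>.  The power series for the root of \<open>1 - x\<close> commutes with
  everything that commutes with \<open>h\<close>.
\<close>

lemma self_adjoint_root:
  fixes h :: "'u::{cstar_algebra,real_normed_algebra_1}"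
  assumes h: "adj h = h" and n: "norm (of_real s - h) \<le> s"
  obtains r where "adj r = r" "h = r * r" "\<And>y. y * h = h * y \<Longrightarrow> y * r = r * y"
proof (cases "s = 0")
  case True
  then show ?thesis
    using n that[of 0] by simp
next
  case False
  have "s > 0"
    using n norm_ge_zero[of "of_real s - h"] False by linarith
  define x where "x = 1 - inverse s *\<^sub>R h"
  have x_eq: "x = inverse s *\<^sub>R (of_real s - h)"
    using False by (simp add: x_def scaleR_diff_right of_real_def)
  have nx: "norm x \<le> 1"
    unfolding x_eq norm_scaleR using n \<open>s > 0\<close> by (simp add: field_simps)
  have ax: "adj x = x"
    using h by (simp add: x_def adj_diff adj_scaleR)
  show ?thesis
  proof (rule that[of "sqrt s *\<^sub>R sqrt1m x"])
    show "h = sqrt s *\<^sub>R sqrt1m x * sqrt s *\<^sub>R sqrt1m x"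
      using \<open>s > 0\<close> by (simp add: sqrt1m_power2[OF nx]) (simp add: x_def)
    fix y assume "y * h = h * y"
    then have "y * x = x * y"
      by (simp add: x_def algebra_simps)
    then show "y * sqrt s *\<^sub>R sqrt1m x = sqrt s *\<^sub>R sqrt1m x * y"
      by (simp add: sqrt1m_commute[OF nx])
  qed (simp add: adj_scaleR adj_sqrt1m[OF nx ax])
qed

lemma pos_of_norm_le: "adj h = h \<Longrightarrow> norm (of_real s - h) \<le> s \<Longrightarrow> pos h"
  by (metis self_adjoint_root pos_def)

lemma pos_commuting_root:
  assumes "pos h"
  obtains r where "adj r = r" "h = r * r" "\<And>y. y * h = h * y \<Longrightarrow> y * r = r * y"
  using self_adjoint_root[OF pos_adj[OF assms] pos_imp_norm_le[OF assms order_refl]] by blast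

lemma pos_zero [simp]: "pos 0"
  using posI[of 0] by simp

lemma pos_of_real: "0 \<le> s \<Longrightarrow> pos (of_real s)"
  using pos_of_norm_le[of "of_real s" s] by simp

lemma pos_add:
  assumes "pos h" "pos k"
  shows "pos (h + k)"
proof (rule pos_of_norm_le)
  show "adj (h + k) = h + k"
    using assms by (simp add: adj_add pos_adj)
  have eq: "of_real (norm h + norm k) - (h + k) = (of_real (norm h) - h) + (of_real (norm k) - k)"
    by simp
  show "norm (of_real (norm h + norm k) - (h + k)) \<le> norm h + norm k"
    unfolding eq
    using norm_triangle_ineq[of "of_real (norm h) - h" "of_real (norm k) - k"]
      pos_imp_norm_le[OF assms(1) order_refl] pos_imp_norm_le[OF assms(2) order_refl]
    by simp
qed

lemma pos_sum: "(\<And>i. i \<in> I \<Longrightarrow> pos (f i)) \<Longrightarrow> pos (\<Sum>i\<in>I. f i)"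
  by (induction I rule: infinite_finite_induct) (auto intro: pos_add)

lemma pos_scaleR:
  assumes "pos h" "0 \<le> t"
  shows "pos (t *\<^sub>R h)"
proof -
  obtain r where r: "adj r = r" "h = r * r"
    using assms by (auto simp: pos_def)
  then show ?thesis
    using posI[of "sqrt t *\<^sub>R r"] \<open>0 \<le> t\<close> by (simp add: adj_scaleR)
qed

lemma pos_limit:
  assumes "\<And>n. pos (h n)" and lim: "h \<longlonglongrightarrow> k"
  shows "pos k"
proof (rule pos_of_norm_le)
  have "(\<lambda>n. adj (h n)) \<longlonglongrightarrow> adj k"
    by (rule bounded_linear.tendsto[OF bounded_linear_adj lim])
  then show "adj k = k"
    using assms by (simp add: pos_adj LIMSEQ_unique)
  have "(\<lambda>n. norm (of_real (norm (h n)) - h n)) \<longlonglongrightarrow> norm (of_real (norm k) - k)"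
    by (intro tendsto_intros lim)
  moreover have "(\<lambda>n. norm (h n)) \<longlonglongrightarrow> norm k"
    by (intro tendsto_intros lim)
  ultimately show "norm (of_real (norm k) - k) \<le> norm k"
    by (rule LIMSEQ_le) (use assms pos_imp_norm_le in blast)
qed

text \<open>
  The roots of \<open>h\<close> and \<open>k\<close> can be chosen to commute, so that \<open>h k\<close> is the square of their product.
\<close>

lemma pos_mult_commuting:
  assumes "pos h" "pos k" "h * k = k * h"
  shows "pos (h * k)"
proof -
  obtain r where r: "adj r = r" "h = r * r" "\<And>y. y * h = h * y \<Longrightarrow> y * r = r * y"
    using pos_commuting_root[OF assms(1)] by blast
  obtain s where s: "adj s = s" "k = s * s" "\<And>y. y * k = k * y \<Longrightarrow> y * s = s * y"
    using pos_commuting_root[OF assms(2)] by blast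
  have "k * r = r * k"
    using r(3) assms(3) by metis
  then have sr: "r * s = s * r"
    using s(3) by metis
  then have "h * k = (r * s) * (r * s)"
    unfolding r(2) s(2) by (metis mult.assoc)
  then show ?thesis
    using posI[of "r * s"] sr r(1) s(1) by (simp add: adj_mult)
qed

lemma pos_antisym:
  assumes "pos h" "pos (- h)"
  shows "h = 0"
proof -
  obtain r where r: "adj r = r" "h = r * r"
    using assms(1) by (auto simp: pos_def)
  obtain s where s: "adj s = s" "- h = s * s" "\<And>y. y * (- h) = (- h) * y \<Longrightarrow> y * s = s * y"
    using pos_commuting_root[OF assms(2)] by blast
  have "r * s = s * r"
    using s(3)[of r] r by (simp add: mult.assoc)
  then have "(norm r)\<^sup>2 \<le> norm (r * r + s * s)"
    by (rule norm_le_of_sum_squares[OF r(1) s(1)])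
  also have "r * r + s * s = 0"
    using r s by (metis add.right_inverse)
  finally show ?thesis
    using r by simp
qed

text \<open>
  For exponents \<open>2\<^sup>k\<close> this is the C*-identity; any exponent is complemented to a power of two.
\<close>

lemma norm_self_adjoint_power:
  fixes x :: "'u::{cstar_algebra,real_normed_algebra_1}"
  assumes "adj x = x"
  shows "norm (x ^ n) = norm x ^ n"
proof (cases "x = 0")
  case False
  have pow2: "norm (x ^ (2 ^ k)) = norm x ^ (2 ^ k)" for k
  proof (induction k)
    case (Suc k)
    have "norm (x ^ (2 ^ Suc k)) = norm (x ^ (2 ^ k) * x ^ (2 ^ k))"
      by (simp flip: power_add add: mult_2)
    also have "\<dots> = (norm (x ^ (2 ^ k)))\<^sup>2"
      by (rule norm_self_adjoint_square) (simp add: adj_power assms)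
    also have "\<dots> = norm x ^ (2 ^ Suc k)"
      by (simp add: Suc.IH flip: power_mult) (simp add: mult.commute)
    finally show ?case .
  qed simp
  have n: "n + (2 ^ n - n) = 2 ^ n"
    using less_exp[of n] by simp
  have "norm x ^ n * norm x ^ (2 ^ n - n) = norm (x ^ n * x ^ (2 ^ n - n))"
    by (simp only: n pow2 flip: power_add)
  also have "\<dots> \<le> norm (x ^ n) * norm x ^ (2 ^ n - n)"
    by (intro order_trans[OF norm_mult_ineq] mult_left_mono norm_power_ineq norm_ge_zero)
  finally have "norm x ^ n \<le> norm (x ^ n)"
    using False by simp
  then show ?thesis
    using norm_power_ineq[of x n] by simp
qed (cases n, auto)

text \<open>
  \<open>v\<^sup>* v\<close> and \<open>v v\<^sup>*\<close> have the same nonzero spectrum.  In terms of norms: the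
  powers of \<open>s - v\<^sup>* v\<close> are controlled by those of \<open>s - v v\<^sup>*\<close>.
\<close>

lemma pos_adj_mult_swap:
  fixes v :: "'u::{cstar_algebra,real_normed_algebra_1}"
  assumes "pos (v * adj v)"
  shows "pos (adj v * v)"
proof (rule pos_of_norm_le[where s = "(norm v)\<^sup>2"])
  define s where "s = (norm v)\<^sup>2"
  define T where "T = of_real s - adj v * v"
  define U where "U = of_real s - v * adj v"
  have s: "s \<ge> 0"
    by (simp add: s_def)
  have adjT: "adj T = T"
    by (simp add: T_def adj_diff adj_mult adj_adj)
  have U: "norm U \<le> s"
    unfolding U_def by (rule pos_imp_norm_le[OF assms]) (simp add: s_def norm_mult_adj)
  have comm: "T * adj v = adj v * U"
    by (simp add: T_def U_def algebra_simps of_real_def)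
  have "T ^ n * adj v = adj v * U ^ n" for n
  proof (induction n)
    case (Suc n)
    have "T ^ Suc n * adj v = T * (T ^ n * adj v)"
      by (simp add: mult.assoc)
    also have "\<dots> = adj v * U ^ Suc n"
      by (simp add: Suc.IH comm flip: mult.assoc)
    finally show ?case .
  qed simp
  then have "norm (T ^ n * (adj v * v)) = norm (adj v * U ^ n * v)" for n
    by (simp flip: mult.assoc)
  moreover have "norm (adj v * U ^ n * v) \<le> norm v * s ^ n * norm v" for n
  proof -
    have "norm (adj v * U ^ n) \<le> norm (adj v) * norm (U ^ n)"
      by (rule norm_mult_ineq)
    also have "\<dots> \<le> norm v * s ^ n"
      using norm_power_ineq[of U n] power_mono[OF U norm_ge_zero, of n]
      by (simp add: mult_left_mono)
    finally show ?thesis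
      by (intro order_trans[OF norm_mult_ineq[of "adj v * U ^ n" v]] mult_right_mono) auto
  qed
  ultimately have bound: "norm (T ^ n * (adj v * v)) \<le> s * s ^ n" for n
    by (simp add: s_def power2_eq_square ac_simps)
  have "norm T \<le> s"
  proof (rule ccontr)
    assume "\<not> norm T \<le> s"
    define M where "M = norm T"
    have M: "M > s"
      using \<open>\<not> norm T \<le> s\<close> by (simp add: M_def)
    have "(M - s) * M ^ n \<le> s * s ^ n" for n
    proof -
      have "T ^ Suc n = s *\<^sub>R T ^ n - T ^ n * (adj v * v)"
        by (simp only: power_Suc2) (simp add: T_def right_diff_distrib of_real_def)
      then have "norm (T ^ Suc n) \<le> norm (s *\<^sub>R T ^ n) + norm (T ^ n * (adj v * v))"
        by (metis norm_triangle_ineq4)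
      then have "M ^ Suc n \<le> s * M ^ n + s * s ^ n"
        using bound[of n] s unfolding norm_self_adjoint_power[OF adjT] norm_scaleR M_def by simp
      then show ?thesis
        by (simp add: algebra_simps)
    qed
    then have le: "M - s \<le> s * (s / M) ^ n" for n
      using M s by (simp add: field_simps power_divide)
    have "(\<lambda>n. s * (s / M) ^ n) \<longlonglongrightarrow> s * 0"
      using M s by (intro tendsto_intros LIMSEQ_power_zero) auto
    then have "M - s \<le> s * 0"
      by (rule LIMSEQ_le_const) (use le in blast)
    with M show False
      by simp
  qed
  then show "norm (of_real ((norm v)\<^sup>2) - adj v * v) \<le> (norm v)\<^sup>2"
    by (simp only: T_def s_def)
qed (simp add: adj_mult adj_adj)

text \<open>
  The element \<open>k\<^sup>2\<close> is the absolute value of \<open>h\<close>: the root \<open>r\<close> of the normalized \<open>h\<^sup>2\<close> lies within distance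
  \<open>1\<close> of \<open>1\<close> and therefore has a root itself.
\<close>

lemma abs_root:
  fixes h :: "'u::{cstar_algebra,real_normed_algebra_1}"
  assumes "adj h = h"
  obtains k where "adj k = k" "k * h = h * k" "(k * k) * (k * k) = h * h"
proof (cases "h = 0")
  case True
  then show ?thesis
    using that[of 0] by simp
next
  case False
  define t where "t = norm (h * h)"
  have "t = (norm h)\<^sup>2"
    using norm_self_adjoint_square[OF assms] by (simp add: t_def)
  then have t: "t > 0"
    using False by simp
  define x where "x = 1 - inverse t *\<^sub>R (h * h)"
  have x_eq: "x = inverse t *\<^sub>R (of_real t - h * h)"
    using t by (simp add: x_def scaleR_diff_right of_real_def)
  have "norm (of_real t - h * h) \<le> t"
    by (rule pos_imp_norm_le[OF posI[OF assms]]) (simp add: t_def)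
  then have nx: "norm x \<le> 1"
    unfolding x_eq norm_scaleR using t by (simp add: field_simps)
  have ax: "adj x = x"
    using assms by (simp add: x_def adj_diff adj_scaleR adj_mult)
  define r where "r = sqrt1m x"
  have ar: "adj r = r"
    unfolding r_def by (rule adj_sqrt1m[OF nx ax])
  have rr: "r * r = inverse t *\<^sub>R (h * h)"
    unfolding r_def sqrt1m_power2[OF nx] by (simp add: x_def)
  have "norm (of_real 1 - r) \<le> 1"
    using norm_one_minus_sqrt1m_le[OF nx] by (simp add: r_def)
  then obtain q where q: "adj q = q" "r = q * q" "\<And>y. y * r = r * y \<Longrightarrow> y * q = q * y"
    using self_adjoint_root[OF ar] by blast
  have "h * x = x * h"
    by (simp add: x_def algebra_simps)
  then have "h * r = r * h"
    unfolding r_def by (rule sqrt1m_commute[OF nx])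
  then have "h * q = q * h"
    by (rule q(3))
  define c where "c = sqrt (sqrt t)"
  have "c * c = sqrt t"
    using t by (simp add: c_def)
  then have "c * c * (c * c) = t"
    using t by simp
  then have "((c *\<^sub>R q) * (c *\<^sub>R q)) * ((c *\<^sub>R q) * (c *\<^sub>R q)) = t *\<^sub>R (r * r)"
    by (simp add: q(2) mult.assoc)
  also have "\<dots> = h * h"
    using t by (simp add: rr)
  finally show ?thesis
    by (intro that[of "c *\<^sub>R q"]) (auto simp: adj_scaleR q(1) \<open>h * q = q * h\<close>)
qed

text \<open>
  If \<open>h = u\<^sup>* u\<close> and \<open>m = \<bar>h\<bar> - h\<close> then \<open>v = u m\<close> satisfies \<open>v\<^sup>* v = m h m = - (k m)\<^sup>2\<close>, which
  is negative, while the sum of \<open>v\<^sup>* v\<close> and \<open>v v\<^sup>*\<close> is a sum of squares.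
\<close>

theorem pos_adj_mult:
  fixes u :: "'u::{cstar_algebra,real_normed_algebra_1}"
  shows "pos (adj u * u)"
proof -
  define h where "h = adj u * u"
  have ah: "adj h = h"
    by (simp add: h_def adj_mult adj_adj)
  obtain k where k: "adj k = k" "k * h = h * k" "(k * k) * (k * k) = h * h"
    using abs_root[OF ah] by blast
  define m where "m = k * k - h"
  define c where "c = k * m"
  define v where "v = u * m"
  have am: "adj m = m"
    by (simp add: m_def adj_diff adj_mult k ah)
  have km: "k * m = m * k"
    by (simp add: m_def algebra_simps k(2))
  have ac: "adj c = c"
    by (simp add: c_def adj_mult am k km)
  have kkh: "k * k * h = h * (k * k)"
    by (metis k(2) mult.assoc)
  have "h * m = - (k * k * m)"
    using k(3) kkh by (simp add: m_def algebra_simps)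
  have "adj v * v = m * (h * m)"
    by (simp add: v_def adj_mult am h_def mult.assoc)
  also have "\<dots> = - (m * k * (k * m))"
    by (simp add: \<open>h * m = - (k * k * m)\<close> mult.assoc)
  finally have vv: "adj v * v = - (c * c)"
    by (simp add: c_def km)
  define a where "a = (1/2) *\<^sub>R (v + adj v)"
  define b where "b = (1/2) *\<^sub>C \<i> *\<^sub>C (adj v - v)"
  have aa: "adj a = a"
    by (simp add: a_def adj_scaleR adj_add adj_adj add.commute)
  have ab: "adj b = b"
  proof -
    have "adj b = (1/2) *\<^sub>C (- \<i>) *\<^sub>C (v - adj v)"
      by (simp add: b_def adj_scaleC adj_diff adj_adj)
    then show ?thesis
      by (simp add: b_def complex_vector.scale_right_diff_distrib scaleC_scaleC
          complex_vector.scale_minus_left)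
  qed
  have aaa: "4 *\<^sub>R (a * a) = v * v + v * adj v + adj v * v + adj v * adj v"
    by (simp add: a_def algebra_simps)
  have "b * b = ((1/2) * \<i> * ((1/2) * \<i>)) *\<^sub>C ((adj v - v) * (adj v - v))"
    by (simp add: b_def scaleC_simps)
  also have "(1/2) * \<i> * ((1/2) * \<i>) = complex_of_real (- 1/4)"
    by simp
  finally have "b * b = (- 1/4) *\<^sub>R ((adj v - v) * (adj v - v))"
    by (simp only: scaleR_eq_scaleC)
  then have "4 *\<^sub>R (b * b) = - ((adj v - v) * (adj v - v))"
    by simp
  then have bbb: "4 *\<^sub>R (b * b) = v * adj v + adj v * v - v * v - adj v * adj v"
    by (simp add: algebra_simps)
  \<comment> \<open>\<open>v = a + \<i> b\<close>, hence \<open>v\<^sup>* v + v v\<^sup>* = 2 (a\<^sup>2 + b\<^sup>2)\<close>\<close>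
  have "2 *\<^sub>R (v * adj v) = 4 *\<^sub>R (a * a) + 4 *\<^sub>R (b * b) - 2 *\<^sub>R (adj v * v)"
    unfolding aaa bbb by (simp add: scaleR_2 algebra_simps)
  then have "v * adj v = 2 *\<^sub>R (a * a) + 2 *\<^sub>R (b * b) - adj v * v"
  proof -
    assume *: "2 *\<^sub>R (v * adj v) = 4 *\<^sub>R (a * a) + 4 *\<^sub>R (b * b) - 2 *\<^sub>R (adj v * v)"
    have "v * adj v = (1/2) *\<^sub>R (2 *\<^sub>R (v * adj v))"
      by simp
    then show ?thesis
      unfolding * by (simp add: scaleR_add_right scaleR_diff_right)
  qed
  also have "\<dots> = 2 *\<^sub>R (a * a) + 2 *\<^sub>R (b * b) + c * c"
    by (simp add: vv)
  also have "pos \<dots>"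
    by (intro pos_add pos_scaleR posI aa ab ac) auto
  finally have "pos (- (c * c))"
    using pos_adj_mult_swap[of v] vv by simp
  then have "c * c = 0"
    using pos_antisym[OF posI[OF ac]] by simp
  then have "v = 0"
    using vv adj_mult_eq_zero[of v] by simp
  then have "h * m = 0"
    by (simp add: h_def v_def mult.assoc)
  then have hkk: "h * (k * k) = h * h"
    by (simp add: m_def algebra_simps)
  have "m * m = 0"
    using hkk kkh k(3) by (simp add: m_def algebra_simps)
  then have "m = 0"
    using adj_mult_eq_zero[of m] am by simp
  then show ?thesis
    using posI[OF k(1)] by (simp add: m_def h_def)
qed

lemma pos_conjugate:
  assumes "pos h"
  shows "pos (adj x * h * x)"
proof -
  obtain r where r: "adj r = r" "h = r * r"
    using assms by (auto simp: pos_def)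
  then have "adj x * h * x = adj (r * x) * (r * x)"
    by (simp add: adj_mult mult.assoc)
  then show ?thesis
    by (metis pos_adj_mult)
qed

lemma pos_norm_minus:
  assumes "adj h = h" "norm h \<le> s"
  shows "pos (of_real s - h)"
  using assms by (intro pos_of_norm_le[where s = s]) (auto simp: adj_diff)

text \<open>
  With \<open>s = norm b\<close> the element \<open>s - a = (s - b) + (b - a)\<close> is positive, and \<open>a + (s - a) = s\<close> is a sum of two
  commuting squares.
\<close>

lemma norm_mono:
  fixes a b :: "'u::{cstar_algebra,real_normed_algebra_1}"
  assumes "pos a" "pos (b - a)"
  shows "norm a \<le> norm b"
proof -
  have "adj b = b"
    using pos_adj[OF assms(1)] pos_adj[OF assms(2)] by (simp add: adj_diff)
  then have "pos ((of_real (norm b) - b) + (b - a))"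
    by (intro pos_add assms pos_norm_minus) auto
  then have p: "pos (of_real (norm b) - a)"
    by simp
  obtain r where r: "adj r = r" "a = r * r"
    using assms by (auto simp: pos_def)
  obtain q where q: "adj q = q" "of_real (norm b) - a = q * q"
      "\<And>y. y * (of_real (norm b) - a) = (of_real (norm b) - a) * y \<Longrightarrow> y * q = q * y"
    using pos_commuting_root[OF p] by blast
  have "r * q = q * r"
    by (rule q(3)) (simp add: r algebra_simps of_real_def)
  then have "(norm r)\<^sup>2 \<le> norm (r * r + q * q)"
    by (rule norm_le_of_sum_squares[OF r(1) q(1)])
  also have "r * r + q * q = of_real (norm b)"
    using r q by (simp flip: q(2))
  finally show ?thesis
    using norm_self_adjoint_square[OF r(1)] r by simp
qed

lemma norm_le_of_pos_diff: "pos a \<Longrightarrow> 0 \<le> s \<Longrightarrow> pos (of_real s - a) \<Longrightarrow> norm a \<le> s"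
  using norm_mono[of a "of_real s"] by simp

lemma pos_one_minus_power:
  fixes x :: "'u::{cstar_algebra,real_normed_algebra_1}"
  assumes "pos x" "norm x \<le> 1"
  shows "pos ((1 - x) ^ k)"
proof (induction k)
  case 0
  then show ?case
    using pos_of_real[of 1] by simp
next
  case (Suc k)
  have "pos (1 - x)"
    using pos_norm_minus[OF pos_adj[OF assms(1)] assms(2)] by simp
  from pos_mult_commuting[OF this Suc] show ?case
    by (simp add: power_commutes)
qed

lemma telescope_one_minus_power:
  "(\<Sum>k<n. x * (1 - x) ^ k) = 1 - (1 - x :: 'u::ring_1) ^ n"
  by (induction n) (simp_all add: left_diff_distrib)

lemma pos_mult_power_one_minus:
  fixes x :: "'u::{cstar_algebra,real_normed_algebra_1}"
  assumes "pos x" "norm x \<le> 1"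
  shows "pos (x * (1 - x) ^ k)"
  by (rule pos_mult_commuting[OF assms(1) pos_one_minus_power[OF assms]],
      rule power_commuting_commutes[symmetric]) (simp add: algebra_simps)

text \<open>
  The elements \<open>x (1 - x)\<^sup>k\<close> decrease in \<open>k\<close>, and the first \<open>m + 1\<close> of them add up to at most \<open>1\<close>.
\<close>

lemma norm_mult_power_one_minus_le:
  fixes x :: "'u::{cstar_algebra,real_normed_algebra_1}"
  assumes "pos x" "norm x \<le> 1"
  shows "norm (x * (1 - x) ^ m) \<le> 1 / Suc m"
proof -
  note * = pos_mult_power_one_minus[OF assms]
  have comm: "x * (1 - x) ^ k = (1 - x) ^ k * x" for k
    by (rule power_commuting_commutes[symmetric]) (simp add: algebra_simps)
  have dec: "pos (x * (1 - x) ^ k - x * (1 - x) ^ (k + j))" for k j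
  proof (induction j)
    case (Suc j)
    have "pos (x * (x * (1 - x) ^ (k + j)))"
      by (rule pos_mult_commuting[OF assms(1) *]) (metis comm mult.assoc)
    also have "x * (x * (1 - x) ^ (k + j)) = x * (1 - x) ^ (k + j) - x * (1 - x) ^ (k + Suc j)"
      by (simp add: algebra_simps)
    finally have "pos \<dots>" .
    from pos_add[OF Suc this] show ?case
      by simp
  qed simp
  have "pos (\<Sum>k<Suc m. x * (1 - x) ^ k - x * (1 - x) ^ m)"
  proof (rule pos_sum)
    fix k assume "k \<in> {..<Suc m}"
    then show "pos (x * (1 - x) ^ k - x * (1 - x) ^ m)"
      using dec[of k "m - k"] by simp
  qed
  also have "(\<Sum>k<Suc m. x * (1 - x) ^ k - x * (1 - x) ^ m) =
      1 - (1 - x) ^ Suc m - real (Suc m) *\<^sub>R (x * (1 - x) ^ m)"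
    unfolding sum_subtractf telescope_one_minus_power
    by (simp only: sum_constant card_lessThan scaleR_conv_of_real of_real_of_nat_eq)
  finally have "pos (1 - real (Suc m) *\<^sub>R (x * (1 - x) ^ m))"
    using pos_add[OF _ pos_one_minus_power[OF assms, of "Suc m"]] by force
  then have "norm (real (Suc m) *\<^sub>R (x * (1 - x) ^ m)) \<le> 1"
    by (intro norm_le_of_pos_diff pos_scaleR *) auto
  then have "real (Suc m) * norm (x * (1 - x) ^ m) \<le> 1"
    by (simp del: of_nat_Suc)
  then show ?thesis
    by (simp add: field_simps)
qed

section \<open>Approximate units and C*-seminorms\<close>

text \<open>
  A root of an element of the algebra has a scalar part with square \<open>0\<close>, hence lies in the algebra.
\<close>

lemma positive_iff_pos_emb: "positive x \<longleftrightarrow> pos (emb x)"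
proof
  assume "positive x"
  then obtain y where "x = adj y * y"
    by (auto simp: positive_def)
  then show "pos (emb x)"
    using pos_adj_mult[of "emb y"] by (simp add: emb_arith)
next
  assume "pos (emb x)"
  then obtain r where r: "adj r = r" "emb x = r * r"
    by (auto simp: pos_def)
  have "scal r * scal r = 0"
    by (metis alg_simps(12) alg_simps(13) r(2))
  then have "emb (alg r) = r"
    by (simp add: emb_alg)
  then have "emb x = emb (adj (alg r) * alg r)"
    by (simp add: emb_arith r)
  then show "positive x"
    by (auto simp: positive_def)
qed

lemma of_real_eq_scaleC: "of_real r = complex_of_real r *\<^sub>C (1 :: 'b::cstar_algebra unitization)"
  by (simp only: of_real_def[where 'a = "'b unitization"] scaleR_eq_scaleC)

lemma scal_power: "scal (x ^ n) = scal x ^ n"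
  by (induction n) auto

lemma scal_sum: "scal (\<Sum>i\<in>I. f i) = (\<Sum>i\<in>I. scal (f i))"
  by (induction I rule: infinite_finite_induct) auto

text \<open>
  Take \<open>u\<^sub>m = 1 - (1 - x)\<^sup>m\<close>, with \<open>x\<close> a multiple of \<open>h = \<Sum>\<^sub>i e\<^sub>i e\<^sub>i\<^sup>*\<close> of norm at most \<open>1\<close>.  It lies in the
  algebra, and \<open>e\<^sub>i e\<^sub>i\<^sup>* \<le> h\<close> yields
  \<open>\<parallel>u\<^sub>m e\<^sub>i - e\<^sub>i\<parallel>\<^sup>2 \<le> \<parallel>(1 - x)\<^sup>m h (1 - x)\<^sup>m\<parallel>\<close>, which is \<open>O(1/m)\<close>.
\<close>

lemma approximate_unit:
  fixes e :: "nat \<Rightarrow> 'a::cstar_algebra"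
  obtains u :: "nat \<Rightarrow> 'a" where "\<And>m. adj (u m) = u m" "\<And>m. norm (u m) \<le> 1"
    "\<And>i. i < n \<Longrightarrow> (\<lambda>m. u m * e i) \<longlonglongrightarrow> e i"
proof -
  define h where "h = (\<Sum>i<n. emb (e i) * adj (emb (e i)))"
  define t where "t = norm h + 1"
  define x where "x = inverse t *\<^sub>R h"
  have t: "t > 0"
    by (simp add: t_def add_nonneg_pos)
  have pe: "pos (emb (e i) * adj (emb (e i)))" for i
    using pos_adj_mult[of "adj (emb (e i))"] by (simp add: adj_adj)
  have ph: "pos h"
    unfolding h_def by (intro pos_sum pe)
  have px: "pos x"
    unfolding x_def using t by (intro pos_scaleR ph) auto
  have nx: "norm x \<le> 1"
    using t by (simp add: x_def field_simps) (simp add: t_def)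
  have sx: "scal x = 0"
    by (simp add: x_def h_def scal_sum scaleR_eq_scaleC)
  define w where "w m = 1 - (1 - x) ^ m" for m
  define u where "u m = alg (w m)" for m
  have "scal (w m) = 0" for m
    by (simp add: w_def scal_power sx)
  then have emb_u: "emb (u m) = w m" for m
    by (simp add: u_def emb_alg)
  have adj_p: "adj ((1 - x) ^ m) = (1 - x) ^ m" for m
    by (rule pos_adj[OF pos_one_minus_power[OF px nx]])
  show ?thesis
  proof (rule that[of u])
    fix m
    have "emb (adj (u m)) = emb (u m)"
      by (simp only: emb_arith emb_u) (simp add: w_def adj_diff adj_p)
    then show "adj (u m) = u m"
      by (simp only: emb_eq_iff)
    have "pos (w m)"
      unfolding w_def telescope_one_minus_power[symmetric]
      by (intro pos_sum pos_mult_power_one_minus px nx)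
    moreover have "pos (of_real 1 - w m)"
      using pos_one_minus_power[OF px nx, of m] by (simp add: w_def)
    ultimately have "norm (w m) \<le> 1"
      by (intro norm_le_of_pos_diff) auto
    then show "norm (u m) \<le> 1"
      by (metis emb_u norm_emb)
  next
    fix i assume i: "i < n"
    have bound: "norm (u m * e i - e i) \<le> sqrt (t * (1 / Suc (2 * m)))" for m
    proof -
      let ?p = "(1 - x) ^ m"
      let ?q = "?p * emb (e i)"
      have "norm (u m * e i - e i) = norm (emb (u m * e i - e i))"
        by simp
      also have "emb (u m * e i - e i) = - ?q"
        by (simp only: emb_arith emb_u) (simp add: w_def algebra_simps)
      finally have "(norm (u m * e i - e i))\<^sup>2 = norm (?q * adj ?q)"
        by (simp add: norm_mult_adj)
      also have "?q * adj ?q = adj ?p * (emb (e i) * adj (emb (e i))) * ?p"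
        by (simp add: adj_mult adj_p mult.assoc)
      also have "norm \<dots> \<le> norm (adj ?p * h * ?p)"
      proof (rule norm_mono)
        show "pos (adj ?p * (emb (e i) * adj (emb (e i))) * ?p)"
          by (rule pos_conjugate[OF pe])
        have "h - emb (e i) * adj (emb (e i)) = (\<Sum>j\<in>{..<n} - {i}. emb (e j) * adj (emb (e j)))"
          unfolding h_def using i by (subst sum.remove[of _ i]) auto
        then have "pos (h - emb (e i) * adj (emb (e i)))"
          by (auto intro: pos_sum pe)
        then have "pos (adj ?p * (h - emb (e i) * adj (emb (e i))) * ?p)"
          by (rule pos_conjugate)
        then show "pos (adj ?p * h * ?p - adj ?p * (emb (e i) * adj (emb (e i))) * ?p)"
          by (simp only: right_diff_distrib left_diff_distrib)
      qed
      also have "adj ?p * h * ?p = t *\<^sub>R (x * (1 - x) ^ (2 * m))"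
      proof -
        have "h = t *\<^sub>R x"
          using t by (simp add: x_def)
        moreover have "?p * x = x * ?p"
          by (rule power_commuting_commutes) (simp add: algebra_simps)
        ultimately show ?thesis
          by (simp add: adj_p mult_2 power_add mult.assoc)
      qed
      also have "norm \<dots> \<le> t * (1 / Suc (2 * m))"
        using mult_left_mono[OF norm_mult_power_one_minus_le[OF px nx, of "2 * m"], of t] t
        by (simp del: of_nat_Suc)
      finally show ?thesis
        by (rule real_le_rsqrt)
    qed
    have "(\<lambda>m. sqrt (t * (1 / Suc (2 * m)))) \<longlonglongrightarrow> sqrt (t * 0)"
    proof (intro tendsto_intros)
      have "strict_mono (\<lambda>m::nat. 2 * m)"
        by (simp add: strict_mono_def)
      from LIMSEQ_subseq_LIMSEQ[OF LIMSEQ_inverse_real_of_nat this]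
      show "(\<lambda>m. 1 / real (Suc (2 * m))) \<longlonglongrightarrow> 0"
        by (simp add: o_def inverse_eq_divide)
    qed
    then have "(\<lambda>m. sqrt (t * (1 / Suc (2 * m)))) \<longlonglongrightarrow> 0"
      by (simp only: mult_zero_right real_sqrt_zero)
    then have "(\<lambda>m. u m * e i - e i) \<longlonglongrightarrow> 0"
      by (rule Lim_null_comparison[OF always_eventually[OF allI[OF bound]]])
    then show "(\<lambda>m. u m * e i) \<longlonglongrightarrow> e i"
      by (simp add: LIM_zero_iff)
  qed
qed

lemma limit_of_products:
  fixes a :: "'a::cstar_algebra"
  obtains u :: "nat \<Rightarrow> 'a" where "(\<lambda>m. u m * a) \<longlonglongrightarrow> a"
  using approximate_unit[of 1 "\<lambda>_. a"] by (metis less_one)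

text \<open>
  For a *-homomorphism \<open>f\<close> into an algebra with norm \<open>n\<close> the map \<open>x \<mapsto> n (f x)\<close> is such a seminorm.  It is
  not supposed to be continuous; that it is follows from \<open>le_norm\<close>.
\<close>

locale cstar_seminorm =
  fixes N :: "'a::cstar_algebra \<Rightarrow> real"
  assumes nonneg: "0 \<le> N x"
    and add_le: "N (x + y) \<le> N x + N y"
    and mult_le: "N (x * y) \<le> N x * N y"
    and scaleC: "N (z *\<^sub>C x) = cmod z * N x"
    and cstar: "N (adj x * x) = (N x)\<^sup>2"
begin

lemma adj_eq: "N (adj x) = N x"
proof -
  have le: "N y \<le> N (adj y)" for y
    using mult_le[of "adj y" y] by (rule_tac le_of_square_le_mult) (simp_all add: nonneg cstar)
  show ?thesis
    using le[of x] le[of "adj x"] by (simp add: adj_adj)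
qed

lemma minus: "N (- x) = N x"
  using scaleC[of "-1" x] by (simp add: scaleC_minus_one)

lemma diff_le: "N (x - y) \<le> N x + N y"
  using add_le[of x "- y"] by (simp add: minus)

text \<open>
  A self-adjoint contraction \<open>h\<close> is, up to the sign, the imaginary part of a unitary \<open>1 + g\<close> of the
  unitization, with \<open>g\<close> in the algebra; and left multiplication by \<open>1 + g\<close> preserves \<open>N\<close>.
\<close>

lemma self_adjoint_le_2:
  assumes "adj h = h" "norm h \<le> 1"
  shows "N h \<le> 2"
proof -
  define H where "H = emb h"
  have aH: "adj H = H"
    by (simp add: H_def assms flip: emb_arith)
  have nHH: "norm (H * H) \<le> 1"
    using norm_self_adjoint_square[OF aH] assms(2) by (simp add: H_def power_le_one)
  define q where "q = sqrt1m (H * H)"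
  have aq: "adj q = q"
    unfolding q_def by (rule adj_sqrt1m[OF nHH]) (simp add: adj_mult aH)
  have qq: "q * q = 1 - H * H"
    unfolding q_def by (rule sqrt1m_power2[OF nHH])
  have Hq: "H * q = q * H"
    unfolding q_def by (rule sqrt1m_commute[OF nHH]) (simp add: mult.assoc)
  \<comment> \<open>the root of \<open>1\<close> that is \<open>scal q\<close> cannot be \<open>-1\<close>, which has distance \<open>2\<close> from \<open>1\<close>\<close>
  have "scal q = 1"
  proof -
    have "scal q * scal q = 1"
      using qq by (metis alg_simps(8,10,12,13) H_def diff_zero mult_zero_left)
    then have "scal q = 1 \<or> scal q = -1"
      by (simp add: square_eq_1_iff)
    moreover have "cmod (1 - scal q) \<le> 1"
      using order_trans[OF norm_scal_le norm_one_minus_sqrt1m_le[OF nHH]] by (simp add: q_def)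
    ultimately show ?thesis
      by auto
  qed
  \<comment> \<open>\<open>1 + g = q - \<i> H\<close> is unitary since \<open>q\<^sup>2 + H\<^sup>2 = 1\<close>\<close>
  define g where "g = q - 1 - \<i> *\<^sub>C H"
  have adj_g: "adj g = q - 1 + \<i> *\<^sub>C H"
    by (simp add: g_def adj_diff adj_scaleC aH aq complex_vector.scale_minus_left)
  have unitary: "adj (1 + g) * (1 + g) = 1"
  proof -
    have "adj (1 + g) * (1 + g) = (q + \<i> *\<^sub>C H) * (q - \<i> *\<^sub>C H)"
      by (simp add: adj_add adj_g) (simp add: g_def)
    also have "\<dots> = q * q + H * H"
      by (simp add: algebra_simps scaleC_simps Hq scaleC_minus_one)
    finally show ?thesis
      by (simp add: qq)
  qed
  define G where "G = alg g"
  have eG: "emb G = g"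
    unfolding G_def by (rule emb_alg) (simp add: g_def \<open>scal q = 1\<close> H_def)
  have isometric: "N (z + G * z) = N z" for z
  proof -
    have "emb (adj (z + G * z) * (z + G * z)) = adj (emb z) * (adj (1 + g) * (1 + g)) * emb z"
      by (simp only: emb_arith eG) (simp add: adj_add adj_mult algebra_simps)
    then have "adj (z + G * z) * (z + G * z) = adj z * z"
      by (simp add: unitary flip: emb_arith)
    then have "(N (z + G * z))\<^sup>2 = (N z)\<^sup>2"
      by (metis cstar)
    then show ?thesis
      by (simp add: nonneg power2_eq_iff_nonneg)
  qed
  have "N (G * adj G) \<le> N (adj G + G * adj G) + N (adj G)"
    using diff_le[of "adj G + G * adj G" "adj G"] by simp
  then have "(N (adj G))\<^sup>2 \<le> 2 * N (adj G)"
    using cstar[of "adj G"] by (simp add: isometric adj_adj)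
  then have "N (adj G) \<le> 2"
    using nonneg[of "adj G"] by (cases "N (adj G) = 0") (auto simp: power2_eq_square)
  then have NG: "N G \<le> 2" "N (adj G) \<le> 2"
    by (simp_all add: adj_eq)
  have "emb ((\<i> / 2) *\<^sub>C (G - adj G)) = (\<i> / 2) *\<^sub>C ((-2 * \<i>) *\<^sub>C H)"
  proof -
    have "g - adj g = (-\<i> - \<i>) *\<^sub>C H"
      unfolding adj_g
      by (simp only: complex_vector.scale_left_diff_distrib complex_vector.scale_minus_left)
        (simp add: g_def)
    then show ?thesis
      by (simp only: emb_arith eG) simp
  qed
  then have "emb ((\<i> / 2) *\<^sub>C (G - adj G)) = emb h"
    by (simp add: scaleC_simps H_def)
  then have "N h = 1/2 * N (G - adj G)"
    using scaleC[of "\<i>/2" "G - adj G"] by (simp add: norm_divide)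
  also have "\<dots> \<le> 2"
    using diff_le[of G "adj G"] NG by simp
  finally show ?thesis .
qed

text \<open>
  If \<open>N h > 1\<close>, then the values \<open>N h ^ (2 ^ k)\<close> of \<open>N\<close> on powers of \<open>h\<close> exceed the bound \<open>2\<close>.
\<close>

lemma self_adjoint_le_1:
  assumes "adj h = h" "norm h \<le> 1"
  shows "N h \<le> 1"
proof (rule ccontr)
  have pow: "N h ^ (2 ^ k) \<le> 2" if "adj h = h" "norm h \<le> 1" for h k
    using that
  proof (induction k arbitrary: h)
    case 0
    then show ?case
      using self_adjoint_le_2 by simp
  next
    case (Suc k)
    have "norm (h * h) \<le> 1"
      using cstar_identity[of h] Suc.prems by (simp add: power_le_one)
    then have "N (h * h) ^ (2 ^ k) \<le> 2"
      by (intro Suc.IH) (auto simp: adj_mult Suc.prems)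
    moreover have "N (h * h) = (N h)\<^sup>2"
      using cstar[of h] Suc.prems by simp
    ultimately show ?case
      by (simp flip: power_mult add: mult.commute)
  qed
  assume "\<not> N h \<le> 1"
  then have "1 < N h" by simp
  then obtain n where "2 < N h ^ n"
    using real_arch_pow by blast
  also have "\<dots> \<le> N h ^ (2 ^ n)"
    using \<open>1 < N h\<close> by (intro power_increasing) auto
  finally show False
    using pow[OF assms, of n] by simp
qed

theorem le_norm: "N x \<le> norm x"
proof (cases "x = 0")
  case True
  then show ?thesis
    using scaleC[of 0 x] by simp
next
  case False
  define z where "z = complex_of_real (inverse ((norm x)\<^sup>2))"
  define h where "h = z *\<^sub>C (adj x * x)"
  have cz: "cmod z = inverse ((norm x)\<^sup>2)"
    by (simp add: z_def norm_inverse norm_power)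
  have "adj h = h"
    by (simp add: h_def z_def adj_scaleC adj_mult adj_adj)
  moreover have "norm h \<le> 1"
    using False by (simp add: h_def norm_scaleC cstar_identity cz)
  ultimately have "N h \<le> 1"
    by (rule self_adjoint_le_1)
  then have "(N x)\<^sup>2 \<le> (norm x)\<^sup>2"
    using False by (simp add: h_def scaleC cstar cz field_simps)
  then show ?thesis
    by (rule power2_le_imp_le) simp
qed

end

lemma star_hom_simps:
  assumes "star_hom f"
  shows "f (x + y) = f x + f y" "f (z *\<^sub>C x) = z *\<^sub>C f x" "f (x * y) = f x * f y"
    "f (adj x) = adj (f x)" "f (x - y) = f x - f y" "f 0 = 0"
proof -
  show *: "f (x + y) = f x + f y" "f (z *\<^sub>C x) = z *\<^sub>C f x" "f (x * y) = f x * f y"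
    "f (adj x) = adj (f x)" for x y z
    using assms by (auto simp: star_hom_def clinear_iff)
  show "f (x - y) = f x - f y"
    using *(1)[of x "- y"] *(2)[of "-1" y] by (simp add: scaleC_minus_one)
  show "f 0 = 0"
    using *(2)[of 0 0] by simp
qed

lemma star_hom_norm_le: "star_hom f \<Longrightarrow> norm (f x) \<le> norm x"
proof -
  assume f: "star_hom f"
  interpret cstar_seminorm "\<lambda>x. norm (f x)"
    by unfold_locales
      (simp_all add: star_hom_simps[OF f] norm_triangle_ineq norm_mult_ineq norm_scaleC cstar_identity)
  show ?thesis
    by (rule le_norm)
qed

lemma star_hom_bounded_linear: "star_hom f \<Longrightarrow> bounded_linear f"
  by (rule clinear_bounded_linear[where K = 1]) (auto simp: star_hom_def star_hom_norm_le)

section \<open>Limits of Gram matrices and completely positive contractions\<close>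

text \<open>
  Gram matrices stand for the positive matrices over the algebra.  The vectors form a list, of
  any length, so that sums are immediate; and limits are admitted because the Schwarz inequality of a map
  on an algebra without unit is obtained from approximate units.
\<close>

definition gram :: "nat \<Rightarrow> (nat \<Rightarrow> nat \<Rightarrow> 'a::cstar_algebra) \<Rightarrow> bool"
  where "gram n X \<longleftrightarrow> (\<exists>ys. \<forall>i<n. \<forall>j<n. X i j = (\<Sum>y\<leftarrow>ys. adj (y i) * y j))"

definition limit_gram :: "nat \<Rightarrow> (nat \<Rightarrow> nat \<Rightarrow> 'a::cstar_algebra) \<Rightarrow> bool"
  where "limit_gram n X \<longleftrightarrow>
    (\<exists>G. (\<forall>l. gram n (G l)) \<and> (\<forall>i<n. \<forall>j<n. (\<lambda>l. G l i j) \<longlonglongrightarrow> X i j))"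

lemma gram_imp_limit_gram: "gram n X \<Longrightarrow> limit_gram n X"
  unfolding limit_gram_def by (rule exI[of _ "\<lambda>_. X"]) auto

lemma limit_gram_cong:
  "limit_gram n X \<Longrightarrow> (\<And>i j. i < n \<Longrightarrow> j < n \<Longrightarrow> X i j = Y i j) \<Longrightarrow> limit_gram n Y"
  unfolding limit_gram_def by auto

lemma gram_zero: "gram n (\<lambda>i j. 0)"
  unfolding gram_def by (rule exI[of _ "[]"]) simp

lemma gram_add:
  assumes "gram n X" "gram n Y"
  shows "gram n (\<lambda>i j. X i j + Y i j)"
proof -
  obtain xs ys where
    "\<forall>i<n. \<forall>j<n. X i j = (\<Sum>y\<leftarrow>xs. adj (y i) * y j)"
    "\<forall>i<n. \<forall>j<n. Y i j = (\<Sum>y\<leftarrow>ys. adj (y i) * y j)"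
    using assms unfolding gram_def by blast
  then show ?thesis
    unfolding gram_def by (intro exI[of _ "xs @ ys"]) simp
qed

lemma limit_gram_add:
  assumes "limit_gram n X" "limit_gram n Y"
  shows "limit_gram n (\<lambda>i j. X i j + Y i j)"
proof -
  obtain G H where
    "\<forall>l. gram n (G l)" "\<forall>i<n. \<forall>j<n. (\<lambda>l. G l i j) \<longlonglongrightarrow> X i j"
    "\<forall>l. gram n (H l)" "\<forall>i<n. \<forall>j<n. (\<lambda>l. H l i j) \<longlonglongrightarrow> Y i j"
    using assms unfolding limit_gram_def by blast
  then show ?thesis
    unfolding limit_gram_def
    by (intro exI[of _ "\<lambda>l i j. G l i j + H l i j"]) (auto intro: gram_add tendsto_add)
qed

lemma emb_sandwich:
  assumes "\<And>y. emb (f' y) = emb (f y) * c" and "\<And>y. emb (g' y) = emb (g y) * d"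
  shows "emb (\<Sum>y\<leftarrow>ys. adj (f' y) * g' y) = adj c * emb (\<Sum>y\<leftarrow>ys. adj (f y) * g y) * d"
proof (induction ys)
  case (Cons y ys)
  then show ?case
    by (simp add: emb_arith assms adj_mult distrib_left distrib_right) (simp add: mult.assoc)
qed (simp add: emb_arith)

lemma gram_conjugate:
  assumes "gram n X"
  shows "gram n (\<lambda>i j. alg (adj (d i) * emb (X i j) * d j))"
proof -
  obtain ys where ys: "\<And>i j. i < n \<Longrightarrow> j < n \<Longrightarrow> X i j = (\<Sum>y\<leftarrow>ys. adj (y i) * y j)"
    using assms unfolding gram_def by blast
  define z where "z y i = alg (emb (y i) * d i)" for y i
  have z: "emb (z y i) = emb (y i) * d i" for y i
    unfolding z_def by (rule emb_alg) simp
  have "alg (adj (d i) * emb (X i j) * d j) = (\<Sum>y\<leftarrow>map z ys. adj (y i) * y j)"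
    if "i < n" "j < n" for i j
  proof -
    have "emb (\<Sum>y\<leftarrow>map z ys. adj (y i) * y j) = adj (d i) * emb (X i j) * d j"
      unfolding ys[OF that]
      using emb_sandwich[of "\<lambda>y. z y i" "\<lambda>y. y i" "d i" "\<lambda>y. z y j" "\<lambda>y. y j" "d j" ys, OF z z]
      by (simp only: map_map o_def)
    from arg_cong[OF this, of alg] show ?thesis
      by (simp only: alg_simps(6))
  qed
  then show ?thesis
    unfolding gram_def by blast
qed

lemma limit_gram_conjugate:
  assumes "limit_gram n X"
  shows "limit_gram n (\<lambda>i j. alg (adj (d i) * emb (X i j) * d j))"
proof -
  obtain G where "\<forall>l. gram n (G l)" "\<forall>i<n. \<forall>j<n. (\<lambda>l. G l i j) \<longlonglongrightarrow> X i j"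
    using assms unfolding limit_gram_def by blast
  then show ?thesis
    unfolding limit_gram_def
    by (intro exI[of _ "\<lambda>l i j. alg (adj (d i) * emb (G l i j) * d j)"])
      (auto intro!: gram_conjugate bounded_linear.tendsto[OF bounded_linear_alg] tendsto_mult
        tendsto_const bounded_linear.tendsto[OF bounded_linear_emb] simp del: alg_mult)
qed

lemma limit_gram_quadratic_form:
  fixes X :: "nat \<Rightarrow> nat \<Rightarrow> 'a::cstar_algebra"
  assumes "limit_gram n X"
  shows "pos (\<Sum>i<n. \<Sum>j<n. (cnj (c i) * c j) *\<^sub>C emb (X i j))"
proof -
  obtain G where G: "\<And>l. gram n (G l)" "\<And>i j. i < n \<Longrightarrow> j < n \<Longrightarrow> (\<lambda>l. G l i j) \<longlonglongrightarrow> X i j"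
    using assms unfolding limit_gram_def by blast
  show ?thesis
  proof (rule pos_limit)
    show "(\<lambda>l. \<Sum>i<n. \<Sum>j<n. (cnj (c i) * c j) *\<^sub>C emb (G l i j)) \<longlonglongrightarrow>
        (\<Sum>i<n. \<Sum>j<n. (cnj (c i) * c j) *\<^sub>C emb (X i j))"
      by (intro tendsto_sum bounded_linear.tendsto[OF bounded_linear_scaleC]
          bounded_linear.tendsto[OF bounded_linear_emb] G(2)) auto
    fix l
    obtain ys where ys: "\<And>i j. i < n \<Longrightarrow> j < n \<Longrightarrow> G l i j = (\<Sum>y\<leftarrow>ys. adj (y i) * y j)"
      using G(1)[of l] unfolding gram_def by blast
    define s where "s y = emb (\<Sum>j<n. c j *\<^sub>C y j)" for y :: "nat \<Rightarrow> 'a"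
    have s: "adj (s y) * s y = (\<Sum>i<n. \<Sum>j<n. (cnj (c i) * c j) *\<^sub>C emb (adj (y i) * y j))" for y :: "nat \<Rightarrow> 'a"
      by (simp add: s_def emb_sum adj_sum emb_arith adj_scaleC sum_product scaleC_simps)
        (simp add: mult.commute)
    have "(\<Sum>i<n. \<Sum>j<n. (cnj (c i) * c j) *\<^sub>C emb (G l i j)) =
        (\<Sum>i<n. \<Sum>j<n. (cnj (c i) * c j) *\<^sub>C emb (\<Sum>y\<leftarrow>ys. adj (y i) * y j))"
      by (intro sum.cong refl) (simp add: ys)
    also have "\<dots> = (\<Sum>y\<leftarrow>ys. adj (s y) * s y)"
      by (induction ys) (simp_all add: s emb_arith scaleC_add_right sum.distrib)
    also have "pos \<dots>"
      by (induction ys) (auto intro: pos_add pos_adj_mult)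
    finally show "pos (\<Sum>i<n. \<Sum>j<n. (cnj (c i) * c j) *\<^sub>C emb (G l i j))" .
  qed
qed

locale cp_contraction =
  fixes \<phi> :: "'a::cstar_algebra \<Rightarrow> 'a"
  assumes cp: "completely_positive \<phi>" and contr: "contraction \<phi>"
begin

lemma clin: "clinear \<phi>"
  using cp by (simp add: completely_positive_def)

lemma phi_linear: "\<phi> (x + y) = \<phi> x + \<phi> y" "\<phi> (z *\<^sub>C x) = z *\<^sub>C \<phi> x"
  using clin by (auto simp: clinear_iff)

lemma phi_diff: "\<phi> (x - y) = \<phi> x - \<phi> y"
  using phi_linear(1)[of x "- y"] phi_linear(2)[of "-1" y] by (simp add: scaleC_minus_one)

lemma phi_zero [simp]: "\<phi> 0 = 0"
  using phi_diff[of 0 0] by simp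

lemma norm_phi_le: "norm (\<phi> x) \<le> norm x"
  using contr by (simp add: contraction_def)

lemma bounded_linear_phi: "bounded_linear \<phi>"
  by (rule clinear_bounded_linear[OF clin, of 1]) (simp add: norm_phi_le)

text \<open>
  Complete positivity is stated for square matrices \<open>Y\<close>; a rectangular \<open>Y\<close> is padded with zeros.
\<close>

lemma gram_phi:
  assumes "gram n X"
  shows "gram n (\<lambda>i j. \<phi> (X i j))"
proof -
  obtain ys where ys: "\<And>i j. i < n \<Longrightarrow> j < n \<Longrightarrow> X i j = (\<Sum>y\<leftarrow>ys. adj (y i) * y j)"
    using assms unfolding gram_def by blast
  define N where "N = max n (length ys)"
  define Y where "Y k i = (if k < length ys then (ys ! k) i else 0)" for k i
  define X' where "X' i j = (\<Sum>k<N. adj (Y k i) * Y k j)" for i j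
  have "X' i j = (\<Sum>k<length ys. adj (Y k i) * Y k j)" for i j
    unfolding X'_def by (rule sum.mono_neutral_right) (auto simp: N_def Y_def)
  then have X': "X' i j = X i j" if "i < n" "j < n" for i j
    unfolding ys[OF that] by (simp add: sum_list_sum_nth Y_def atLeast0LessThan)
  have "matrix_positive N X'"
    unfolding matrix_positive_def X'_def by blast
  then have "matrix_positive N (\<lambda>i j. \<phi> (X' i j))"
    using cp by (simp add: completely_positive_def)
  then obtain Z where Z: "\<And>i j. i < N \<Longrightarrow> j < N \<Longrightarrow> \<phi> (X' i j) = (\<Sum>k<N. adj (Z k i) * Z k j)"
    unfolding matrix_positive_def by blast
  have "\<phi> (X i j) = (\<Sum>y\<leftarrow>map Z [0..<N]. adj (y i) * y j)" if "i < n" "j < n" for i j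
    using Z[of i j] X'[OF that] that
    by (simp add: N_def sum_list_distinct_conv_sum_set o_def atLeast0LessThan flip: lessThan_atLeast0)
  then show ?thesis
    unfolding gram_def by blast
qed

lemma limit_gram_phi:
  assumes "limit_gram n X"
  shows "limit_gram n (\<lambda>i j. \<phi> (X i j))"
proof -
  obtain G where "\<forall>l. gram n (G l)" "\<forall>i<n. \<forall>j<n. (\<lambda>l. G l i j) \<longlonglongrightarrow> X i j"
    using assms unfolding limit_gram_def by blast
  then show ?thesis
    unfolding limit_gram_def
    by (intro exI[of _ "\<lambda>l i j. \<phi> (G l i j)"])
      (auto intro: gram_phi bounded_linear.tendsto[OF bounded_linear_phi])
qed

lemma gram_rank_one: "gram n (\<lambda>i j. adj (x i) * x j)"
  unfolding gram_def by (rule exI[of _ "[x]"]) simp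

lemma adj_sum_list: "adj (sum_list xs) = sum_list (map adj (xs :: 'b::cstar_algebra list))"
  by (induction xs) (auto simp: adj_add)

text \<open>
  The Gram matrix of \<open>\<phi> (x\<^sup>* x)\<close>, \<open>\<phi> (x\<^sup>* y)\<close>, \<open>\<phi> (y\<^sup>* x)\<close>, \<open>\<phi> (y\<^sup>* y)\<close> is Hermitian, which gives the claim on products;
  and products are dense.
\<close>

lemma phi_adj: "\<phi> (adj a) = adj (\<phi> a)"
proof -
  have *: "\<phi> (adj x * y) = adj (\<phi> (adj y * x))" for x y
  proof -
    define e where "e i = (if i = 0 then x else y)" for i :: nat
    obtain ys where ys: "\<And>i j. i < 2 \<Longrightarrow> j < 2 \<Longrightarrow> \<phi> (adj (e i) * e j) = (\<Sum>y\<leftarrow>ys. adj (y i) * y j)"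
      using gram_phi[OF gram_rank_one[of 2 e]] unfolding gram_def by blast
    have "adj (\<phi> (adj (e 1) * e 0)) = \<phi> (adj (e 0) * e 1)"
      by (simp add: ys adj_sum_list o_def adj_mult adj_adj)
    then show ?thesis
      by (simp add: e_def)
  qed
  obtain u where u: "(\<lambda>m. u m * adj a) \<longlonglongrightarrow> adj a"
    by (rule limit_of_products)
  have 1: "(\<lambda>m. \<phi> (u m * adj a)) \<longlonglongrightarrow> \<phi> (adj a)"
    by (rule bounded_linear.tendsto[OF bounded_linear_phi u])
  have "(\<lambda>m. adj (\<phi> (adj (u m * adj a)))) \<longlonglongrightarrow> adj (\<phi> (adj (adj a)))"
    by (intro bounded_linear.tendsto[OF bounded_linear_phi]
        bounded_linear.tendsto[OF bounded_linear_adj] u)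
  moreover have "adj (\<phi> (adj (u m * adj a))) = \<phi> (u m * adj a)" for m
    using *[of "adj (u m)" "adj a"] by (simp add: adj_mult adj_adj)
  ultimately have "(\<lambda>m. \<phi> (u m * adj a)) \<longlonglongrightarrow> adj (\<phi> a)"
    by (simp add: adj_adj)
  with 1 show ?thesis
    by (rule LIMSEQ_unique)
qed

text \<open>
  For \<open>u\<close> a self-adjoint contraction the matrix of the \<open>\<phi> (x\<^sub>i\<^sup>* x\<^sub>j)\<close> with \<open>x\<^sub>0 = u\<close>, \<open>x\<^sub>i\<^sub>+\<^sub>1 = e\<^sub>i\<close> is
  a Gram matrix of vectors \<open>y\<^sub>i\<close>.  The vectors \<open>y\<^sub>i\<^sub>+\<^sub>1 - y\<^sub>0 c\<^sub>i\<close>, where \<open>c\<^sub>i = \<phi> (u e\<^sub>i)\<close>, and \<open>r c\<^sub>i\<close>,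
  where \<open>r\<^sup>2 = 1 - \<phi> (u\<^sup>2)\<close>, together have the Gram matrix of the claim.
\<close>

lemma gram_schwarz_defect_approximate:
  assumes u: "adj u = u" "norm u \<le> 1"
  shows "gram n (\<lambda>i j. \<phi> (adj (e i) * e j) - adj (\<phi> (u * e i)) * \<phi> (u * e j))"
proof -
  define x where "x i = (case i of 0 \<Rightarrow> u | Suc i \<Rightarrow> e i)" for i
  obtain ys where ys: "\<And>i j. i < Suc n \<Longrightarrow> j < Suc n \<Longrightarrow>
      \<phi> (adj (x i) * x j) = (\<Sum>y\<leftarrow>ys. adj (y i) * y j)"
    using gram_phi[OF gram_rank_one[of "Suc n" x]] unfolding gram_def by blast
  define c where "c i = \<phi> (u * e i)" for i
  have c: "c i = (\<Sum>y\<leftarrow>ys. adj (y 0) * y (Suc i))" if "i < n" for i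
    using ys[of 0 "Suc i"] that by (simp add: x_def c_def u)
  have adj_c: "adj (c i) = (\<Sum>y\<leftarrow>ys. adj (y (Suc i)) * y 0)" if "i < n" for i
    using c[OF that] by (simp add: adj_sum_list o_def adj_mult adj_adj)
  have uu: "\<phi> (u * u) = (\<Sum>y\<leftarrow>ys. adj (y 0) * y 0)"
    using ys[of 0 0] by (simp add: x_def u)
  have ee: "\<phi> (adj (e i) * e j) = (\<Sum>y\<leftarrow>ys. adj (y (Suc i)) * y (Suc j))" if "i < n" "j < n" for i j
    using ys[of "Suc i" "Suc j"] that by (simp add: x_def)
  have "norm (\<phi> (u * u)) \<le> 1"
    using norm_phi_le[of "u * u"] cstar_identity[of u] power_le_one[of "norm u" 2] u by simp
  moreover have "adj (\<phi> (u * u)) = \<phi> (u * u)"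
    by (simp add: adj_mult u flip: phi_adj)
  ultimately have "pos (of_real 1 - emb (\<phi> (u * u)))"
    by (intro pos_norm_minus) (simp_all flip: emb_arith)
  then obtain r where r: "adj r = r" "r * r = 1 - emb (\<phi> (u * u))"
    by (auto simp: pos_def)
  define z where "z y i = y (Suc i) - y 0 * c i" for y i
  define w where "w i = alg (r * emb (c i))" for i
  have w: "emb (w i) = r * emb (c i)" for i
    unfolding w_def by (rule emb_alg) simp
  have "emb (adj (w i) * w j) = adj (emb (c i)) * (r * r) * emb (c j)" for i j
    by (simp add: emb_arith w adj_mult r(1) mult.assoc)
  then have "emb (adj (w i) * w j) = emb (adj (c i) * c j - adj (c i) * \<phi> (u * u) * c j)" for i j
    by (simp add: r emb_arith algebra_simps)
  then have ww: "adj (w i) * w j = adj (c i) * c j - adj (c i) * \<phi> (u * u) * c j" for i j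
    by simp
  have zz: "(\<Sum>y\<leftarrow>ys. adj (z y i) * z y j) =
      \<phi> (adj (e i) * e j) - adj (c i) * c j - adj (c i) * c j + adj (c i) * \<phi> (u * u) * c j"
    if ij: "i < n" "j < n" for i j
  proof -
    have "(\<Sum>y\<leftarrow>ys. adj (z y i) * z y j) = (\<Sum>y\<leftarrow>ys. adj (y (Suc i)) * y (Suc j)
        - adj (y (Suc i)) * y 0 * c j - adj (c i) * (adj (y 0) * y (Suc j))
        + adj (c i) * (adj (y 0) * y 0) * c j)"
      by (simp add: z_def adj_diff adj_mult algebra_simps)
    also have "\<dots> = (\<Sum>y\<leftarrow>ys. adj (y (Suc i)) * y (Suc j)) - (\<Sum>y\<leftarrow>ys. adj (y (Suc i)) * y 0) * c j
        - adj (c i) * (\<Sum>y\<leftarrow>ys. adj (y 0) * y (Suc j))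
        + adj (c i) * (\<Sum>y\<leftarrow>ys. adj (y 0) * y 0) * c j"
      by (simp add: sum_list_addf sum_list_subtractf sum_list_const_mult sum_list_mult_const)
    finally show ?thesis
      by (simp flip: ee[OF ij] adj_c[OF ij(1)] c[OF ij(2)] uu)
  qed
  have "\<phi> (adj (e i) * e j) - adj (\<phi> (u * e i)) * \<phi> (u * e j) =
      (\<Sum>y\<leftarrow>w # map z ys. adj (y i) * y j)" if "i < n" "j < n" for i j
    using zz[OF that] by (simp add: ww o_def c_def)
  then show ?thesis
    unfolding gram_def by blast
qed

lemma limit_gram_schwarz_defect:
  "limit_gram n (\<lambda>i j. \<phi> (adj (e i) * e j) - adj (\<phi> (e i)) * \<phi> (e j))"
proof -
  obtain u where u: "\<And>m. adj (u m) = u m" "\<And>m. norm (u m) \<le> 1"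
    "\<And>i. i < n \<Longrightarrow> (\<lambda>m. u m * e i) \<longlonglongrightarrow> e i"
    using approximate_unit[of n e] by blast
  have "(\<lambda>m. \<phi> (adj (e i) * e j) - adj (\<phi> (u m * e i)) * \<phi> (u m * e j)) \<longlonglongrightarrow>
      \<phi> (adj (e i) * e j) - adj (\<phi> (e i)) * \<phi> (e j)" if "i < n" "j < n" for i j
    by (intro tendsto_diff tendsto_mult tendsto_const bounded_linear.tendsto[OF bounded_linear_adj]
        bounded_linear.tendsto[OF bounded_linear_phi] u that)
  then show ?thesis
    unfolding limit_gram_def
    by (intro exI[of _ "\<lambda>m i j. \<phi> (adj (e i) * e j) - adj (\<phi> (u m * e i)) * \<phi> (u m * e j)"])
      (auto intro: gram_schwarz_defect_approximate u)
qed

end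

section \<open>The moments of words\<close>

type_synonym 'a word = "(nat \<times> 'a) list"

abbreviation shift_word :: "'a word \<Rightarrow> 'a word"
  where "shift_word \<equiv> map (apfst Suc)"

definition adj_word :: "'a::cstar_algebra word \<Rightarrow> 'a word"
  where "adj_word w = rev (map (apsnd adj) w)"

lemma adj_word_simps [simp]:
  "adj_word [] = []"
  "adj_word (u @ v) = adj_word v @ adj_word u"
  "adj_word (l # v) = adj_word v @ [apsnd adj l]"
  "adj_word w = [] \<longleftrightarrow> w = []"
  "adj_word (shift_word w) = shift_word (adj_word w)"
  "adj_word (adj_word w) = w"
  by (auto simp: adj_word_def rev_map o_def apfst_def apsnd_def map_prod_def adj_adj split_beta)

lemma unshift_word:
  assumes "\<forall>l\<in>set w. fst l \<noteq> 0"
  shows "shift_word (map (apfst (\<lambda>k. k - 1)) w) = w"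
  using assms by (induction w) auto

lemma word_split_first:
  obtains (shifted) w' where "w = shift_word w'"
  | (split) u a v where "w = shift_word u @ (0, a) # v"
proof (cases "\<exists>l\<in>set w. fst l = 0")
  case True
  then obtain u l v where w: "w = u @ l # v" "fst l = 0" "\<forall>l\<in>set u. fst l \<noteq> 0"
    using split_list_first_prop[OF True] by blast
  have "w = shift_word (map (apfst (\<lambda>k. k - 1)) u) @ (0, snd l) # v"
    unfolding unshift_word[OF w(3)] using w(1,2) by (cases l) simp
  then show ?thesis
    by (rule split)
next
  case False
  then have "\<forall>l\<in>set w. fst l \<noteq> 0"
    by simp
  from unshift_word[OF this, symmetric] show ?thesis
    by (rule shifted)
qed

lemma word_split_last:
  obtains (shifted) w' where "w = shift_word w'"
  | (split) u a v where "w = u @ (0, a) # shift_word v"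
proof (cases "\<exists>l\<in>set w. fst l = 0")
  case True
  then obtain u l v where w: "w = u @ l # v" "fst l = 0" "\<forall>l\<in>set v. fst l \<noteq> 0"
    using split_list_last_prop[OF True] by blast
  have "w = u @ (0, snd l) # shift_word (map (apfst (\<lambda>k. k - 1)) v)"
    unfolding unshift_word[OF w(3)] using w(1,2) by (cases l) simp
  then show ?thesis
    by (rule split)
next
  case False
  then have "\<forall>l\<in>set w. fst l \<noteq> 0"
    by simp
  from unshift_word[OF this, symmetric] show ?thesis
    by (rule shifted)
qed

definition word_weight :: "'a word \<Rightarrow> nat"
  where "word_weight w = (\<Sum>l\<leftarrow>w. Suc (fst l))"

lemma word_weight_simps [simp]:
  "word_weight [] = 0"
  "word_weight (l # w) = Suc (fst l) + word_weight w"
  "word_weight (u @ v) = word_weight u + word_weight v"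
  "word_weight (shift_word w) = length w + word_weight w"
  by (induction w) (auto simp: word_weight_def)

lemma word_weight_take_drop:
  "word_weight w = word_weight (takeWhile P w) + word_weight (dropWhile P w)"
  by (simp flip: word_weight_simps(3))

text \<open>
  A word is empty, or a shift, or falls into two words at its first letter of index \<open>0\<close>.
\<close>

lemma word_induct [case_names Nil shift split]:
  assumes "P []"
    and shift: "\<And>w. w \<noteq> [] \<Longrightarrow> P w \<Longrightarrow> P (shift_word w)"
    and split: "\<And>u a v. P (shift_word u) \<Longrightarrow> P v \<Longrightarrow> P (shift_word u @ (0, a) # v)"
  shows "P w"
proof (induction "word_weight w" arbitrary: w rule: less_induct)
  case less
  show ?case
  proof (cases w rule: word_split_first)
    case (shifted w')
    then show ?thesis
      using less[of w'] shift[of w'] assms(1) by (cases "w' = []") auto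
  next
    case (split u a v)
    then show ?thesis
      using less[of "shift_word u"] less[of v] assms(3)[of u v a] by auto
  qed
qed

definition unital_extension :: "('a::cstar_algebra \<Rightarrow> 'a) \<Rightarrow> 'a unitization \<Rightarrow> 'a unitization"
  where "unital_extension \<phi> x = Unitize (\<phi> (alg x)) (scal x)"

lemma unital_extension_simps [simp]:
  "alg (unital_extension \<phi> x) = \<phi> (alg x)" "scal (unital_extension \<phi> x) = scal x"
  by (auto simp: unital_extension_def)

text \<open>
  The value at the empty word is \<open>1\<close> and \<open>\<phi>\<close> is extended to preserve \<open>1\<close>; then the empty word needs
  no separate treatment in \<open>moment_shift\<close> and \<open>moment_split\<close>, which are the properties to be used.
\<close>

function moment :: "('a::cstar_algebra \<Rightarrow> 'a) \<Rightarrow> 'a word \<Rightarrow> 'a unitization"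
  where "moment \<phi> w =
    (let u = takeWhile (\<lambda>l. fst l \<noteq> 0) w;
         e = (if u = [] then 1 else unital_extension \<phi> (moment \<phi> (map (apfst (\<lambda>k. k - 1)) u)))
     in case dropWhile (\<lambda>l. fst l \<noteq> 0) w of [] \<Rightarrow> e | l # v \<Rightarrow> e * emb (snd l) * moment \<phi> v)"
  by auto
termination
proof (relation "inv_image less_than (\<lambda>(\<phi>, w). word_weight w)", goal_cases)
  case 1
  then show ?case by simp
next
  case (2 \<phi> w u)
  define x where "x = map (apfst (\<lambda>k. k - 1 :: nat)) u"
  have "shift_word x = u"
    unfolding x_def by (rule unshift_word) (auto simp: 2 dest: set_takeWhileD)
  then have "word_weight x < word_weight u"
    using 2 word_weight_simps(4)[of x] by (auto simp: x_def)
  also have "word_weight u \<le> word_weight w"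
    using word_weight_take_drop[of w "\<lambda>l. fst l \<noteq> 0"] by (simp add: 2)
  finally show ?case
    by (simp add: x_def)
next
  case (3 \<phi> w u e l v)
  then show ?case
    using word_weight_take_drop[of w "\<lambda>l. fst l \<noteq> 0"] by simp
qed

declare moment.simps [simp del]

context cp_contraction
begin

abbreviation "\<phi>' \<equiv> unital_extension \<phi>"
abbreviation "\<mu> \<equiv> moment \<phi>"

lemma moment_Nil [simp]: "\<mu> [] = 1"
  by (simp add: moment.simps)

lemma unital_extension_linear:
  "\<phi>' (x + y) = \<phi>' x + \<phi>' y" "\<phi>' (z *\<^sub>C x) = z *\<^sub>C \<phi>' x" "\<phi>' (adj x) = adj (\<phi>' x)" "\<phi>' 1 = 1"
  by (auto simp: unitization_eq_iff phi_linear phi_adj)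

lemma moment_shift: "\<mu> (shift_word w) = \<phi>' (\<mu> w)"
proof -
  have "takeWhile (\<lambda>l. fst l \<noteq> 0) (shift_word w) = shift_word w"
    "dropWhile (\<lambda>l. fst l \<noteq> 0) (shift_word w) = []"
    by auto
  moreover have "map (apfst (\<lambda>k. k - 1)) (shift_word w) = w"
    by (induction w) auto
  ultimately show ?thesis
    by (cases "w = []", simp add: unital_extension_linear)
      (subst moment.simps, simp only: Let_def list.case map_is_Nil_conv if_False)
qed

lemma moment_split_shift: "\<mu> (shift_word u @ (0, a) # v) = \<mu> (shift_word u) * emb a * \<mu> v"
proof -
  have tw: "takeWhile (\<lambda>l. fst l \<noteq> 0) (shift_word u @ (0, a) # v) = shift_word u"
    "dropWhile (\<lambda>l. fst l \<noteq> 0) (shift_word u @ (0, a) # v) = (0, a) # v"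
    by (induction u) auto
  have tw': "takeWhile (\<lambda>l. fst l \<noteq> 0) (shift_word u) = shift_word u"
    "dropWhile (\<lambda>l. fst l \<noteq> 0) (shift_word u) = []"
    by auto
  show ?thesis
    by (subst (1 2) moment.simps) (simp only: tw tw' Let_def list.case snd_conv)
qed

lemma moment_split: "\<mu> (u @ (0, a) # v) = \<mu> u * emb a * \<mu> v"
proof (induction u rule: word_induct)
  case Nil
  then show ?case
    using moment_split_shift[of "[]"] by simp
next
  case (shift w)
  then show ?case
    by (rule_tac moment_split_shift)
next
  case (split u b w)
  then show ?case
    by (simp add: moment_split_shift mult.assoc)
qed

lemma scal_moment: "scal (\<mu> w) = (if w = [] then 1 else 0)"
  by (induction w rule: word_induct) (auto simp: moment_shift moment_split)

lemma moment_adj_word: "\<mu> (adj_word w) = adj (\<mu> w)"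
proof (induction w rule: word_induct)
  case (split u a v)
  then show ?case
    by (simp add: moment_split adj_mult emb_arith mult.assoc del: adj_word_simps(5))
qed (simp_all add: moment_shift unital_extension_linear)

text \<open>
  Consecutive letters with one index \<open>k\<close> enter only through the product of their entries, and
  linearly in it.
\<close>

lemma moment_block_factors:
  "\<exists>F. clinear F \<and> (\<forall>as. as \<noteq> [] \<longrightarrow> \<mu> (u @ map (Pair k) as @ v) = F (prod_list (map emb as)))"
proof (induction k arbitrary: u v)
  case 0
  have "\<mu> (u @ map (Pair 0) as @ v) = \<mu> u * prod_list (map emb as) * \<mu> v" if "as \<noteq> []" for as
    using that
  proof (induction as arbitrary: u rule: list_nonempty_induct)
    case (single a)
    then show ?case
      by (simp add: moment_split)
  next
    case (cons a as)
    then show ?case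
      using moment_split[of "[]" a "map (Pair 0) as @ v"] cons.IH[of "[]"]
      by (simp add: moment_split mult.assoc)
  qed
  then show ?case
    by (intro exI[of _ "\<lambda>x. \<mu> u * x * \<mu> v"])
      (auto simp: clinear_iff algebra_simps scaleC_simps)
next
  case (Suc k)
  obtain u' L where u: "\<And>w. \<mu> (u @ w) = L * \<mu> (shift_word u' @ w)"
  proof (cases u rule: word_split_last)
    case (shifted w)
    then show ?thesis
      using that[of 1 w] by simp
  next
    case (split w a v)
    then show ?thesis
      using that[of "\<mu> w * emb a" v] by (simp add: moment_split)
  qed
  obtain v' R where v: "\<And>w. \<mu> (w @ v) = \<mu> (w @ shift_word v') * R"
  proof (cases v rule: word_split_first)
    case (shifted w)
    then show ?thesis
      using that[of w 1] by simp
  next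
    case (split x a y)
    have "\<mu> (w @ v) = \<mu> (w @ shift_word x) * (emb a * \<mu> y)" for w
      using moment_split[of "w @ shift_word x" a y] by (simp add: split mult.assoc)
    then show ?thesis
      by (rule that)
  qed
  obtain F where F: "clinear F"
    "\<And>as. as \<noteq> [] \<Longrightarrow> \<mu> (u' @ map (Pair k) as @ v') = F (prod_list (map emb as))"
    using Suc.IH by blast
  have "\<mu> (u @ map (Pair (Suc k)) as @ v) = L * \<phi>' (F (prod_list (map emb as))) * R"
    if "as \<noteq> []" for as
  proof -
    have "\<mu> (u @ map (Pair (Suc k)) as @ v) = L * \<mu> ((shift_word u' @ map (Pair (Suc k)) as) @ v)"
      unfolding u by simp
    also have "\<dots> = L * \<mu> (shift_word (u' @ map (Pair k) as @ v')) * R"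
      unfolding v by (simp add: o_def mult.assoc)
    finally show ?thesis
      unfolding moment_shift F(2)[OF that] .
  qed
  then show ?case
    using F(1) by (intro exI[of _ "\<lambda>x. L * \<phi>' (F x) * R"])
      (auto simp: clinear_iff algebra_simps scaleC_simps unital_extension_linear)
qed

text \<open>
  Up to multiplication by fixed elements on both sides, the defect for the words \<open>w\<^sub>i\<close> is the defect for
  their initial segments \<open>u\<^sub>i\<close> without index \<open>0\<close>.  If \<open>u\<^sub>i\<close> is the shift of \<open>x\<^sub>i\<close>, then the latter is
  \<open>\<phi>\<close> of the defect for the \<open>x\<^sub>i\<close> plus the Schwarz defect of \<open>\<phi>\<close>.
\<close>

lemma limit_gram_moment_defect:
  assumes "\<And>i. i < n \<Longrightarrow> \<forall>l\<in>set (w i). fst l < N"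
  shows "limit_gram n (\<lambda>i j. alg (\<mu> (adj_word (w i) @ w j) - adj (\<mu> (w i)) * \<mu> (w j)))"
  using assms
proof (induction N arbitrary: w)
  case 0
  have "w i = []" if "i < n" for i
    using 0[OF that] by (cases "w i") auto
  then show ?case
    by (intro limit_gram_cong[OF gram_imp_limit_gram[OF gram_zero]]) simp
next
  case (Suc N)
  have "\<exists>x d. (\<forall>l\<in>set x. fst l < N) \<and> (\<forall>p. \<mu> (p @ w i) = \<mu> (p @ shift_word x) * d)" if "i < n" for i
  proof (cases "w i" rule: word_split_first)
    case (shifted x)
    then show ?thesis
      using Suc.prems[OF that] by (intro exI[of _ x] exI[of _ 1]) auto
  next
    case (split x a v)
    have "\<mu> (p @ w i) = \<mu> (p @ shift_word x) * (emb a * \<mu> v)" for p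
      using moment_split[of "p @ shift_word x" a v] by (simp add: split mult.assoc)
    moreover have "fst l < N" if "l \<in> set x" for l
    proof -
      have "apfst Suc l \<in> set (w i)"
        using that by (simp add: split)
      then show ?thesis
        using Suc.prems[OF \<open>i < n\<close>] by fastforce
    qed
    ultimately show ?thesis
      by blast
  qed
  then obtain x d where x: "\<And>i. i < n \<Longrightarrow> \<forall>l\<in>set (x i). fst l < N"
    and d: "\<And>i p. i < n \<Longrightarrow> \<mu> (p @ w i) = \<mu> (p @ shift_word (x i)) * d i"
    by metis
  have d': "\<mu> (adj_word (w i) @ p) = adj (d i) * \<mu> (adj_word (shift_word (x i)) @ p)" if "i < n" for i p
  proof -
    have "\<mu> (adj_word (w i) @ p) = adj (\<mu> (adj_word p @ w i))"
      by (simp flip: moment_adj_word)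
    also have "\<dots> = adj (d i) * adj (\<mu> (adj_word p @ shift_word (x i)))"
      by (simp add: d[OF that] adj_mult)
    finally show ?thesis
      by (simp flip: moment_adj_word)
  qed
  let ?m = "\<lambda>i. \<mu> (x i)" and ?mm = "\<lambda>i j. \<mu> (adj_word (x i) @ x j)"
  let ?defect = "\<lambda>i j. \<phi> (alg (?mm i j - adj (?m i) * ?m j)) +
    (\<phi> (adj (alg (?m i)) * alg (?m j)) - adj (\<phi> (alg (?m i))) * \<phi> (alg (?m j)))"
  have "limit_gram n ?defect"
    by (intro limit_gram_add limit_gram_phi limit_gram_schwarz_defect Suc.IH x)
  then have "limit_gram n (\<lambda>i j. alg (adj (d i) * emb (?defect i j) * d j))"
    by (rule limit_gram_conjugate)
  moreover have "adj (d i) * emb (?defect i j) * d j =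
      \<mu> (adj_word (w i) @ w j) - adj (\<mu> (w i)) * \<mu> (w j)" if ij: "i < n" "j < n" for i j
  proof -
    have defect: "emb (?defect i j) = \<phi>' (?mm i j) - adj (\<phi>' (?m i)) * \<phi>' (?m j)"
      by (auto simp: unitization_eq_iff phi_linear phi_diff phi_adj scal_moment)
    have w: "\<mu> (w i) = \<phi>' (?m i) * d i" if "i < n" for i
      using d[OF that, of "[]"] by (simp add: moment_shift)
    have ww: "\<mu> (adj_word (w i) @ w j) = adj (d i) * \<phi>' (?mm i j) * d j"
      using d[OF ij(2), of "adj_word (w i)"] d'[OF ij(1), of "shift_word (x j)"]
        moment_shift[of "adj_word (x i) @ x j"] by simp
    show ?thesis
      unfolding defect ww w[OF ij(1)] w[OF ij(2)] by (simp add: adj_mult algebra_simps)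
  qed
  ultimately show ?case
    by (elim limit_gram_cong) simp
qed

lemma emb_moment_defect:
  "emb (alg (\<mu> (adj_word v @ w) - adj (\<mu> v) * \<mu> w)) = \<mu> (adj_word v @ w) - adj (\<mu> v) * \<mu> w"
  by (rule emb_alg) (auto simp: scal_moment)

end

section \<open>The free *-algebra\<close>

text \<open>
  With concatenation as the addition of words, finitely supported functions on words carry the
  convolution product of the free algebra.
\<close>

instantiation list :: (type) monoid_add
begin

definition "0 = ([] :: 'a list)"
definition "u + v = (u @ v :: 'a list)"

instance
  by standard (auto simp: zero_list_def plus_list_def)

end

type_synonym 'a free_algebra = "'a word \<Rightarrow>\<^sub>0 complex"

abbreviation monomial :: "'a word \<Rightarrow> complex \<Rightarrow> 'a free_algebra"
  where "monomial \<equiv> Poly_Mapping.single"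

abbreviation coeff :: "'a free_algebra \<Rightarrow> 'a word \<Rightarrow> complex"
  where "coeff \<equiv> Poly_Mapping.lookup"

abbreviation words :: "'a free_algebra \<Rightarrow> 'a word set"
  where "words \<equiv> Poly_Mapping.keys"

abbreviation const :: "complex \<Rightarrow> 'a free_algebra"
  where "const \<equiv> monomial []"

lemma mono_mult [simp]: "monomial u a * monomial v b = monomial (u @ v) (a * b)"
  by (simp add: mult_single plus_list_def)

lemma const_one: "const 1 = 1"
  by (simp flip: zero_list_def)

lemma mono_as_sum: "x = (\<Sum>w\<in>words x. monomial w (coeff x w))"
  by (rule poly_mapping_eqI)
    (simp add: lookup_sum lookup_single when_def not_in_keys_iff_lookup_eq_zero sum.delta)

lemma free_algebra_induct [case_names zero monomial add]:
  assumes "P 0" "\<And>w c. P (monomial w c)" "\<And>x y. P x \<Longrightarrow> P y \<Longrightarrow> P (x + y)"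
  shows "P x"
proof -
  have "P (\<Sum>w\<in>S. monomial w (coeff x w))" if "finite S" for S
    using that by (induction S) (auto intro: assms)
  then show ?thesis
    by (subst mono_as_sum) simp
qed

lemma const_central: "x * const c = const c * (x :: 'a free_algebra)"
  by (induction x rule: free_algebra_induct) (auto simp: algebra_simps)

definition fscale :: "complex \<Rightarrow> 'a free_algebra \<Rightarrow> 'a free_algebra"
  where "fscale c x = const c * x"

lemma fscale_simps [simp]:
  "fscale c (x + y) = fscale c x + fscale c y"
  "fscale c (x - y) = fscale c x - fscale c y"
  "fscale c (- x) = - fscale c x"
  "fscale c (fscale d x) = fscale (c * d) x"
  "fscale c x * y = fscale c (x * y)"
  "x * fscale c y = fscale c (x * y)"
  "fscale c 0 = 0"
  "fscale 1 x = x"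
  "fscale c (monomial w d) = monomial w (c * d)"
proof -
  show "fscale c (fscale d x) = fscale (c * d) x"
    by (simp add: fscale_def flip: mult.assoc)
  show "x * fscale c y = fscale c (x * y)"
    unfolding fscale_def using const_central[of x c] by (simp only: mult.assoc[symmetric])
qed (auto simp: fscale_def distrib_left right_diff_distrib mult.assoc const_one)

lemma fscale_add_left: "fscale (c + d) x = fscale c x + fscale d x"
  by (simp add: fscale_def single_add distrib_right)

lemma fscale_minus_left: "fscale (- c) x = - fscale c x"
  by (simp add: fscale_def single_uminus)

lemma mono_eq_fscale: "monomial w c = fscale c (monomial w 1)"
  by simp

lemma coeff_fscale: "coeff (fscale c x) w = c * coeff x w"
  by (induction x rule: free_algebra_induct) (auto simp: lookup_add lookup_single when_def distrib_left)

definition extend :: "('a word \<Rightarrow> complex \<Rightarrow> 'b::comm_monoid_add) \<Rightarrow> 'a free_algebra \<Rightarrow> 'b"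
  where "extend f x = (\<Sum>w\<in>words x. f w (coeff x w))"

lemma extend_superset:
  assumes "\<And>w. f w 0 = 0" "finite S" "words x \<subseteq> S"
  shows "extend f x = (\<Sum>w\<in>S. f w (coeff x w))"
  unfolding extend_def
  by (rule sum.mono_neutral_left) (use assms in \<open>auto simp: not_in_keys_iff_lookup_eq_zero\<close>)

lemma extend_mono: "f w 0 = 0 \<Longrightarrow> extend f (monomial w c) = f w c"
  by (simp add: extend_def)

lemma extend_zero [simp]: "extend f 0 = 0"
  by (simp add: extend_def)

lemma extend_add:
  assumes "\<And>w. f w 0 = 0" "\<And>w a b. f w (a + b) = f w a + f w b"
  shows "extend f (x + y) = extend f x + extend f y"
proof -
  have "extend f z = (\<Sum>w\<in>words x \<union> words y. f w (coeff z w))"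
    if "z \<in> {x, y, x + y}" for z
    by (rule extend_superset) (use assms(1) that keys_add[of x y] in auto)
  then show ?thesis
    by (simp add: lookup_add assms(2) sum.distrib)
qed

definition linear_extension :: "('a word \<Rightarrow> 'b::cstar_algebra) \<Rightarrow> 'a free_algebra \<Rightarrow> 'b"
  where "linear_extension g = extend (\<lambda>w c. c *\<^sub>C g w)"

lemma linear_extension_simps [simp]:
  "linear_extension g 0 = 0"
  "linear_extension g (monomial w c) = c *\<^sub>C g w"
  "linear_extension g (x + y) = linear_extension g x + linear_extension g y"
  by (auto simp: linear_extension_def extend_mono extend_add scaleC_add_left)

lemma linear_extension_fscale [simp]:
  "linear_extension g (fscale c x) = c *\<^sub>C linear_extension g x"
  by (induction x rule: free_algebra_induct) (auto simp: scaleC_simps scaleC_add_right)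

lemma linear_extension_minus [simp]:
  "linear_extension g (- x) = - linear_extension g x"
  using linear_extension_fscale[of g "-1" x] by (simp add: fscale_minus_left scaleC_minus_one)

lemma linear_extension_diff [simp]:
  "linear_extension g (x - y) = linear_extension g x - linear_extension g y"
  using linear_extension_simps(3)[of g x "- y"] by simp

definition fadj :: "'a::cstar_algebra free_algebra \<Rightarrow> 'a free_algebra"
  where "fadj = extend (\<lambda>w c. monomial (adj_word w) (cnj c))"

lemma fadj_simps [simp]:
  "fadj 0 = 0"
  "fadj (monomial w c) = monomial (adj_word w) (cnj c)"
  "fadj (x + y) = fadj x + fadj y"
  by (auto simp: fadj_def extend_mono extend_add single_add)

lemma fadj_fadj [simp]: "fadj (fadj x) = x"
  by (induction x rule: free_algebra_induct) auto

lemma fadj_fscale [simp]: "fadj (fscale c x) = fscale (cnj c) (fadj x)"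
  by (induction x rule: free_algebra_induct) auto

lemma fadj_mult [simp]: "fadj (x * y) = fadj y * fadj x"
proof (induction x rule: free_algebra_induct)
  case (monomial u a)
  show ?case
    by (induction y rule: free_algebra_induct) (auto simp: algebra_simps)
qed (auto simp: algebra_simps)

lemma fadj_diff [simp]: "fadj (x - y) = fadj x - fadj y"
  using fadj_simps(3)[of "x - y" y] by (simp add: algebra_simps)

lemma fadj_one [simp]: "fadj 1 = (1 :: 'a::cstar_algebra free_algebra)"
  by (simp flip: const_one)

section \<open>The operator seminorm of the moments\<close>

text \<open>
  The right-hand side is smallest for \<open>t = b / a\<close>; both \<open>a\<close> and \<open>b\<close> are increased by \<open>e\<close> to make this
  choice possible.
\<close>

lemma sqrt_triangle:
  assumes "0 \<le> a" "0 \<le> b" and le: "\<And>t::real. 0 < t \<Longrightarrow> s \<le> (1 + t) * a\<^sup>2 + (1 + 1 / t) * b\<^sup>2"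
  shows "s \<le> (a + b)\<^sup>2"
proof -
  have "s \<le> (a + b + 2 * (1 / real (Suc n)))\<^sup>2" for n
  proof -
    define e where "e = 1 / real (Suc n)"
    have e: "e > 0"
      by (simp add: e_def)
    define t where "t = (b + e) / (a + e)"
    have t: "t > 0"
      using e assms by (simp add: t_def)
    have "s \<le> (1 + t) * (a + e)\<^sup>2 + (1 + 1 / t) * (b + e)\<^sup>2"
      using e t assms(1,2)
      by (intro order_trans[OF le[OF t]] add_mono mult_left_mono power_mono) auto
    also have "t * (a + e)\<^sup>2 = (b + e) * (a + e)"
      using e assms(1) by (simp add: t_def power2_eq_square)
    then have "(1 + t) * (a + e)\<^sup>2 = (a + e)\<^sup>2 + (b + e) * (a + e)"
      by (simp add: distrib_right)
    also have "1 / t * (b + e)\<^sup>2 = (a + e) * (b + e)"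
      using e assms(2) by (simp add: t_def power2_eq_square)
    then have "(1 + 1 / t) * (b + e)\<^sup>2 = (b + e)\<^sup>2 + (a + e) * (b + e)"
      by (simp only: distrib_right mult_1_left)
    finally show ?thesis
      unfolding e_def[symmetric] by (simp add: power2_eq_square algebra_simps)
  qed
  moreover have lim: "(\<lambda>n. (a + b + 2 * (1 / real (Suc n)))\<^sup>2) \<longlonglongrightarrow> (a + b + 2 * 0)\<^sup>2"
    using LIMSEQ_inverse_real_of_nat
    by (intro tendsto_intros) (simp add: inverse_eq_divide)
  ultimately have "s \<le> (a + b + 2 * 0)\<^sup>2"
    using LIMSEQ_le_const[OF lim] by blast
  then show ?thesis
    by simp
qed

context cp_contraction
begin

abbreviation "E \<equiv> linear_extension \<mu>"

lemma E_one [simp]: "E 1 = 1"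
  by (simp add: scaleC_one flip: const_one)

text \<open>
  For \<open>x\<close> a combination of words \<open>w\<^sub>i\<close>, this is a value of the quadratic form of the matrix in
  \<open>limit_gram_moment_defect\<close>.
\<close>

lemma E_schwarz: "pos (E (fadj x * x) - adj (E x) * E x)"
proof -
  obtain w where w: "bij_betw w {..<card (words x)} (words x)"
    using ex_bij_betw_nat_finite[of "words x"] by (auto simp: atLeast0LessThan)
  define n where "n = card (words x)"
  define c where "c i = coeff x (w i)" for i
  have x: "x = (\<Sum>i<n. monomial (w i) (c i))"
    unfolding n_def c_def by (subst mono_as_sum) (rule sum.reindex_bij_betw[OF w, symmetric])
  have E_sum: "E (\<Sum>i\<in>I. f i) = (\<Sum>i\<in>I. E (f i))" for f and I :: "nat set"
    by (induction I rule: infinite_finite_induct) auto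
  have fadj_sum: "fadj (\<Sum>i\<in>I. f i) = (\<Sum>i\<in>I. fadj (f i))"
    for f :: "nat \<Rightarrow> 'a free_algebra" and I
    by (induction I rule: infinite_finite_induct) auto
  have "E (fadj x * x) - adj (E x) * E x =
      (\<Sum>i<n. \<Sum>j<n. (cnj (c i) * c j) *\<^sub>C (\<mu> (adj_word (w i) @ w j) - adj (\<mu> (w i)) * \<mu> (w j)))"
    unfolding x
    by (simp add: E_sum fadj_sum adj_sum adj_scaleC sum_product scaleC_simps sum_subtractf
        complex_vector.scale_right_diff_distrib mult.commute)
  moreover obtain N where "\<And>i. i < n \<Longrightarrow> \<forall>l\<in>set (w i). fst l < N"
  proof
    fix i assume "i < n"
    then have i: "(\<Sum>l\<leftarrow>w i. fst l) \<le> (\<Sum>i<n. \<Sum>l\<leftarrow>w i. fst l)"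
      by (intro member_le_sum) auto
    have "fst l \<le> (\<Sum>l\<leftarrow>w i. fst l)" if "l \<in> set (w i)" for l
      using that by (intro member_le_sum_list) auto
    with i show "\<forall>l\<in>set (w i). fst l < Suc (\<Sum>i<n. \<Sum>l\<leftarrow>w i. fst l)"
      by (meson le_imp_less_Suc order_trans)
  qed
  then have "pos (\<Sum>i<n. \<Sum>j<n. (cnj (c i) * c j) *\<^sub>C
      emb (alg (\<mu> (adj_word (w i) @ w j) - adj (\<mu> (w i)) * \<mu> (w j))))"
    by (intro limit_gram_quadratic_form limit_gram_moment_defect[of n w N]) blast
  ultimately show ?thesis
    by (simp only: emb_moment_defect)
qed

text \<open>
  The square of the vector \<open>x\<close> in the Hilbert module of \<open>E\<close>, with values in the unitization.
\<close>

definition Q :: "'a free_algebra \<Rightarrow> 'a unitization"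
  where "Q x = E (fadj x * x)"

definition vnorm :: "'a free_algebra \<Rightarrow> real"
  where "vnorm x = sqrt (norm (Q x))"

lemma pos_Q: "pos (Q x)"
  using pos_add[OF E_schwarz[of x] pos_adj_mult[of "E x"]] by (simp add: Q_def)

lemma vnorm_nonneg [simp]: "0 \<le> vnorm x"
  by (simp add: vnorm_def)

lemma vnorm_power2: "(vnorm x)\<^sup>2 = norm (Q x)"
  by (simp add: vnorm_def)

lemma Q_fscale: "Q (fscale c x) = (cnj c * c) *\<^sub>C Q x"
  by (simp add: Q_def mult.commute)

lemma vnorm_fscale: "vnorm (fscale c x) = cmod c * vnorm x"
  by (simp add: vnorm_def Q_fscale norm_scaleC norm_mult real_sqrt_mult)

text \<open>
  For \<open>t > 0\<close> the element \<open>(1 + t) Q x + (1 + 1/t) Q y - Q (x + y)\<close> equals \<open>Q (t x - y) / t\<close>, hence is positive.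
\<close>

lemma vnorm_add: "vnorm (x + y) \<le> vnorm x + vnorm y"
proof -
  have "(vnorm (x + y))\<^sup>2 \<le> (vnorm x + vnorm y)\<^sup>2"
  proof (rule sqrt_triangle)
    fix t :: real assume t: "0 < t"
    let ?rhs = "(1 + t) *\<^sub>R Q x + (1 + 1 / t) *\<^sub>R Q y"
    let ?z = "fscale (of_real t) x - y"
    have "Q ?z = (t * t) *\<^sub>R Q x - t *\<^sub>R (E (fadj x * y) + E (fadj y * x)) + Q y"
      by (simp add: Q_def algebra_simps scaleR_eq_scaleC scaleC_simps scaleC_add_right)
    moreover have "Q (x + y) = Q x + (E (fadj x * y) + E (fadj y * x)) + Q y"
      by (simp add: Q_def algebra_simps)
    ultimately have "?rhs - Q (x + y) = (1 / t) *\<^sub>R Q ?z"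
      using t by (simp add: scaleR_add_left scaleR_add_right scaleR_diff_right)
    then have "pos (?rhs - Q (x + y))"
      using pos_scaleR[OF pos_Q, of "1 / t" ?z] t by simp
    then have "norm (Q (x + y)) \<le> norm ?rhs"
      by (rule norm_mono[OF pos_Q])
    also have "\<dots> \<le> (1 + t) * norm (Q x) + (1 + 1 / t) * norm (Q y)"
      using t by (intro order_trans[OF norm_triangle_ineq]) simp
    finally show "(vnorm (x + y))\<^sup>2 \<le> (1 + t) * (vnorm x)\<^sup>2 + (1 + 1 / t) * (vnorm y)\<^sup>2"
      by (simp add: vnorm_power2)
  qed auto
  then show ?thesis
    by (rule power2_le_imp_le) simp
qed

text \<open>
  Left multiplication by a null element is zero in the Hilbert module of \<open>E\<close>.
\<close>

definition null :: "'a free_algebra \<Rightarrow> bool"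
  where "null x \<longleftrightarrow> (\<forall>y z. E (y * x * z) = 0)"

lemma nullI:
  assumes "\<And>u v. E (monomial u 1 * x * monomial v 1) = 0"
  shows "null x"
proof -
  have monomial: "E (monomial u c * x * monomial v d) = 0" for u v c d
  proof -
    have "monomial u c * x * monomial v d = fscale (c * d) (monomial u 1 * x * monomial v 1)"
      by (simp add: mono_eq_fscale[of u c] mono_eq_fscale[of v d] mult.commute del: fscale_simps(9))
    then show ?thesis
      using assms[of u v] by simp
  qed
  have "E (monomial u c * x * z) = 0" for u c z
    by (induction z rule: free_algebra_induct) (auto simp: monomial distrib_left)
  then have "E (y * x * z) = 0" for y z
    by (induction y rule: free_algebra_induct) (auto simp: distrib_right)
  then show ?thesis
    by (simp add: null_def)
qed

abbreviation letter :: "nat \<Rightarrow> 'a \<Rightarrow> 'a free_algebra"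
  where "letter k a \<equiv> monomial [(k, a)] 1"

text \<open>
  Formal sums of blocks of letters with one index are null as soon as they cancel in the unitization of
  the algebra.  All relations that hold in one copy of the algebra are instances.
\<close>

lemma block_relation:
  assumes "(\<Sum>(c, as)\<leftarrow>xs. c *\<^sub>C prod_list (map emb as)) = 0" "\<forall>(c, as)\<in>set xs. as \<noteq> []"
  shows "null (\<Sum>(c, as)\<leftarrow>xs. monomial (map (Pair k) as) c)"
proof (rule nullI)
  fix u v
  obtain F where F: "clinear F"
    "\<And>as. as \<noteq> [] \<Longrightarrow> \<mu> (u @ map (Pair k) as @ v) = F (prod_list (map emb as))"
    using moment_block_factors by blast
  have F0: "F 0 = 0"
    using F(1) by (metis clinear_iff scaleC_zero_left)
  have "E (monomial u 1 * (\<Sum>(c, as)\<leftarrow>xs. monomial (map (Pair k) as) c) * monomial v 1) =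
      F (\<Sum>(c, as)\<leftarrow>xs. c *\<^sub>C prod_list (map emb as))"
    using assms(2)
  proof (induction xs)
    case (Cons x xs)
    obtain c as where x: "x = (c, as)"
      by (cases x)
    then have "\<mu> (u @ map (Pair k) as @ v) = F (prod_list (map emb as))"
      using Cons.prems by (intro F(2)) auto
    moreover have "E (monomial u 1 * (\<Sum>(c, as)\<leftarrow>xs. monomial (map (Pair k) as) c) * monomial v 1) =
        F (\<Sum>(c, as)\<leftarrow>xs. c *\<^sub>C prod_list (map emb as))"
      using Cons by simp
    ultimately show ?case
      using F(1) by (simp add: x distrib_left distrib_right clinear_iff)
  qed (simp add: F0)
  then show "E (monomial u 1 * (\<Sum>(c, as)\<leftarrow>xs. monomial (map (Pair k) as) c) * monomial v 1) = 0"
    by (simp add: assms(1) F0)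
qed

lemma letter_relations:
  "null (letter k (a + b) - (letter k a + letter k b))"
  "null (letter k (z *\<^sub>C a) - fscale z (letter k a))"
  "null (letter k (a * b) - letter k a * letter k b)"
proof -
  show "null (letter k (a + b) - (letter k a + letter k b))"
    using block_relation[of "[(1, [a + b]), (-1, [a]), (-1, [b])]" k]
    by (simp add: emb_arith scaleC_one scaleC_minus_one single_uminus algebra_simps)
  show "null (letter k (z *\<^sub>C a) - fscale z (letter k a))"
    using block_relation[of "[(1, [z *\<^sub>C a]), (- z, [a])]" k]
    by (simp add: emb_arith scaleC_one complex_vector.scale_minus_left single_uminus)
  show "null (letter k (a * b) - letter k a * letter k b)"
    using block_relation[of "[(1, [a * b]), (-1, [a, b])]" k]
    by (simp add: emb_arith scaleC_one scaleC_minus_one single_uminus)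
qed

lemma null_E: "null (x - y) \<Longrightarrow> E (u * x * v) = E (u * y * v)"
  using linear_extension_diff[of \<mu> "u * x * v" "u * y * v"]
  by (simp add: null_def left_diff_distrib right_diff_distrib del: linear_extension_diff)

text \<open>
  With \<open>s\<close> in the unitization such that \<open>s\<^sup>* s = \<parallel>a\<parallel>\<^sup>2 - a\<^sup>* a\<close> and \<open>q\<close> the element of the free algebra
  that represents \<open>s\<close> in the copy \<open>k\<close>, \<open>Q (a y)\<close> and \<open>Q (q y)\<close> add up to \<open>\<parallel>a\<parallel>\<^sup>2 Q y\<close>.
\<close>

lemma vnorm_letter: "vnorm (letter k a * y) \<le> norm a * vnorm y"
proof -
  define r2 where "r2 = (norm a)\<^sup>2"
  have "pos (of_real r2 - adj (emb a) * emb a)"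
    by (rule pos_norm_minus) (auto simp: adj_mult adj_adj cstar_identity r2_def)
  then obtain s where s: "adj s = s" "s * s = of_real r2 - adj (emb a) * emb a"
    by (auto simp: pos_def)
  define l where "l = scal s"
  define b where "b = alg s"
  have s_eq: "s = emb b + l *\<^sub>C 1"
    by (simp add: unitization_eq_iff l_def b_def)
  have ll: "cnj l * l = of_real r2"
  proof -
    have "scal (adj s * s) = scal (of_real r2 - adj (emb a) * emb a)"
      by (simp only: s)
    then show ?thesis
      by (simp add: l_def of_real_eq_scaleC)
  qed
  define L where "L = letter k a"
  define q where "q = letter k b + fscale l 1"
  define xs where "xs = [(1, [adj b, b]), (l, [adj b]), (cnj l, [b]), (1, [adj a, a])]"
  have "(\<Sum>(c, as)\<leftarrow>xs. c *\<^sub>C prod_list (map emb as)) =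
      adj s * s - (cnj l * l) *\<^sub>C 1 + adj (emb a) * emb a"
    by (simp add: xs_def s_eq emb_arith scaleC_one adj_add adj_scaleC algebra_simps scaleC_simps)
  also have "\<dots> = 0"
    by (simp only: s ll of_real_eq_scaleC) simp
  finally have "null (\<Sum>(c, as)\<leftarrow>xs. monomial (map (Pair k) as) c)"
    by (rule block_relation) (simp add: xs_def)
  moreover have "(\<Sum>(c, as)\<leftarrow>xs. monomial (map (Pair k) as) c) =
      fadj q * q + fadj (L) * L - fscale (of_real r2) 1"
    by (simp add: xs_def q_def L_def algebra_simps flip: ll)
  ultimately have "E (fadj y * (fadj q * q + fadj (L) * L) * y) =
      E (fadj y * fscale (of_real r2) 1 * y)"
    by (intro null_E) simp
  then have "Q (q * y) + Q (L * y) = of_real r2 *\<^sub>C Q y"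
    by (simp add: Q_def algebra_simps)
  then have "r2 *\<^sub>R Q y - Q (L * y) = Q (q * y)"
    by (simp add: scaleR_eq_scaleC algebra_simps)
  then have "norm (Q (L * y)) \<le> norm (r2 *\<^sub>R Q y)"
    using pos_Q[of "q * y"] by (intro norm_mono pos_Q) simp
  also have "\<dots> = (norm a * vnorm y)\<^sup>2"
    by (simp add: r2_def power_mult_distrib vnorm_power2)
  finally show ?thesis
    unfolding vnorm_power2[symmetric] L_def by (rule power2_le_imp_le) simp
qed

definition bounds :: "'a free_algebra \<Rightarrow> real set"
  where "bounds x = {K. 0 \<le> K \<and> (\<forall>y. vnorm (x * y) \<le> K * vnorm y)}"

text \<open>
  The operator norm of left multiplication by \<open>x\<close>.
\<close>

definition p :: "'a free_algebra \<Rightarrow> real"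
  where "p x = Inf (bounds x)"

lemma bounds_nonempty: "bounds x \<noteq> {}"
proof (induction x rule: free_algebra_induct)
  case zero
  have "0 \<in> bounds 0"
    by (simp add: bounds_def vnorm_def Q_def)
  then show ?case
    by blast
next
  case (monomial w c)
  have "\<exists>K\<ge>0. \<forall>y. vnorm (monomial w 1 * y) \<le> K * vnorm y"
  proof (induction w)
    case Nil
    show ?case
      by (rule exI[of _ 1]) (simp add: const_one)
  next
    case (Cons l w)
    obtain K where K: "0 \<le> K" "\<And>y. vnorm (monomial w 1 * y) \<le> K * vnorm y"
      using Cons by blast
    obtain k a where l: "l = (k, a)"
      by (cases l)
    have "vnorm (monomial (l # w) 1 * y) \<le> norm a * K * vnorm y" for y
    proof -
      have "monomial (l # w) 1 * y = letter k a * (monomial w 1 * y)"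
        by (simp add: l flip: mult.assoc)
      then have "vnorm (monomial (l # w) 1 * y) \<le> norm a * vnorm (monomial w 1 * y)"
        by (simp add: vnorm_letter)
      also have "\<dots> \<le> norm a * (K * vnorm y)"
        by (intro mult_left_mono K) simp
      finally show ?thesis
        by (simp add: mult.assoc)
    qed
    then show ?case
      using K(1) by (intro exI[of _ "norm a * K"]) auto
  qed
  then obtain K where K: "0 \<le> K" "\<And>y. vnorm (monomial w 1 * y) \<le> K * vnorm y"
    by blast
  have "vnorm (monomial w c * y) \<le> cmod c * K * vnorm y" for y
  proof -
    have "monomial w c * y = fscale c (monomial w 1 * y)"
      by (simp flip: fscale_simps(5))
    then show ?thesis
      using mult_left_mono[OF K(2)[of y], of "cmod c"] by (simp add: vnorm_fscale mult.assoc)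
  qed
  then have "cmod c * K \<in> bounds (monomial w c)"
    using K(1) by (simp add: bounds_def)
  then show ?case
    by blast
next
  case (add x y)
  then obtain K L where "K \<in> bounds x" "L \<in> bounds y"
    by blast
  then have "K + L \<in> bounds (x + y)"
    by (auto simp: bounds_def distrib_right intro: order_trans[OF vnorm_add] add_mono)
  then show ?case
    by blast
qed

lemma p_nonneg [simp]: "0 \<le> p x"
  unfolding p_def by (rule cInf_greatest[OF bounds_nonempty]) (simp add: bounds_def)

lemma vnorm_mult_le: "vnorm (x * y) \<le> p x * vnorm y"
proof (cases "vnorm y = 0")
  case True
  obtain K where "K \<in> bounds x"
    using bounds_nonempty by blast
  then have "vnorm (x * y) \<le> K * vnorm y"
    by (simp add: bounds_def)
  with True show ?thesis
    by simp
next
  case False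
  then have pos: "vnorm y > 0"
    using vnorm_nonneg[of y] by linarith
  have "vnorm (x * y) / vnorm y \<le> p x"
    unfolding p_def
    by (rule cInf_greatest[OF bounds_nonempty]) (use pos in \<open>simp add: bounds_def field_simps\<close>)
  then show ?thesis
    using pos by (simp add: field_simps)
qed

lemma p_le: "0 \<le> K \<Longrightarrow> (\<And>y. vnorm (x * y) \<le> K * vnorm y) \<Longrightarrow> p x \<le> K"
  unfolding p_def by (rule cInf_lower) (auto simp: bounds_def intro: bdd_belowI[of _ 0])

lemma p_add: "p (x + y) \<le> p x + p y"
  by (rule p_le) (auto simp: distrib_right intro!: order_trans[OF vnorm_add] add_mono vnorm_mult_le)

lemma p_mult: "p (x * y) \<le> p x * p y"
proof (rule p_le)
  show "vnorm (x * y * z) \<le> p x * p y * vnorm z" for z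
    using order_trans[OF vnorm_mult_le[of x "y * z"] mult_left_mono[OF vnorm_mult_le[of y z]]]
    by (simp add: mult.assoc)
qed simp

lemma p_fscale: "p (fscale c x) = cmod c * p x"
proof -
  have le: "p (fscale c x) \<le> cmod c * p x" for c x
    by (rule p_le) (auto simp: mult.assoc vnorm_fscale intro!: mult_left_mono vnorm_mult_le)
  show ?thesis
  proof (cases "c = 0")
    case True
    then show ?thesis
      using le[of 0 x] p_nonneg[of "fscale 0 x"] by simp
  next
    case False
    then have "x = fscale (inverse c) (fscale c x)"
      by simp
    then have "p x \<le> cmod (inverse c) * p (fscale c x)"
      using le by metis
    with le[of c x] False show ?thesis
      by (simp add: norm_inverse norm_divide field_simps)
  qed
qed

lemma p_null: "null x \<Longrightarrow> p x = 0"
proof -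
  assume x: "null x"
  have "vnorm (x * y) = 0" for y
  proof -
    have "E (fadj (x * y) * x * y) = 0"
      using x unfolding null_def by blast
    then show ?thesis
      by (simp add: vnorm_def Q_def mult.assoc)
  qed
  then have "p x \<le> 0"
    by (intro p_le) auto
  then show ?thesis
    using p_nonneg[of x] by simp
qed

text \<open>
  With \<open>w = x\<^sup>* x y\<close>, positivity of \<open>Q (w - t y) = Q w - 2 t Q (x y) + t\<^sup>2 Q y\<close> replaces the
  Cauchy-Schwarz inequality of the Hilbert module; the best bound arises for \<open>t\<close> close to \<open>p (x\<^sup>* x)\<close>.
\<close>

lemma p_power2_le: "(p x)\<^sup>2 \<le> p (fadj x * x)"
proof (rule dense_ge)
  fix t assume t: "p (fadj x * x) < t"
  then have t0: "0 < t"
    using p_nonneg[of "fadj x * x"] by linarith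
  have square: "(vnorm (x * y))\<^sup>2 \<le> t * (vnorm y)\<^sup>2" for y
  proof -
    define w where "w = fadj x * x * y"
    let ?z = "w - fscale (of_real t) y"
    have "E (fadj y * w) = Q (x * y)" "E (fadj w * y) = Q (x * y)"
      by (simp_all add: w_def Q_def mult.assoc)
    then have Qz: "Q ?z = Q w - (2 * t) *\<^sub>R Q (x * y) + (t * t) *\<^sub>R Q y"
      by (simp add: Q_def[of ?z] Q_def[of w] Q_def[of y] algebra_simps scaleR_eq_scaleC
          scaleC_simps flip: scaleC_add_left)
    have "(Q w + (t * t) *\<^sub>R Q y) - (2 * t) *\<^sub>R Q (x * y) = Q ?z"
      unfolding Qz by simp
    then have "pos ((Q w + (t * t) *\<^sub>R Q y) - (2 * t) *\<^sub>R Q (x * y))"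
      using pos_Q[of ?z] by (simp only:)
    then have "norm ((2 * t) *\<^sub>R Q (x * y)) \<le> norm (Q w + (t * t) *\<^sub>R Q y)"
      using t0 by (intro norm_mono pos_scaleR pos_Q) auto
    also have "\<dots> \<le> norm (Q w) + t * t * norm (Q y)"
      by (intro order_trans[OF norm_triangle_ineq]) simp
    also have "norm (Q w) \<le> (t * vnorm y)\<^sup>2"
    proof -
      have "vnorm w \<le> p (fadj x * x) * vnorm y"
        unfolding w_def by (rule vnorm_mult_le)
      also have "\<dots> \<le> t * vnorm y"
        using t by (intro mult_right_mono) auto
      finally show ?thesis
        unfolding vnorm_power2[symmetric] by (intro power_mono) auto
    qed
    finally have "2 * t * (vnorm (x * y))\<^sup>2 \<le> 2 * t * (t * (vnorm y)\<^sup>2)"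
      using t0 by (simp add: vnorm_power2[symmetric] power2_eq_square)
    then show ?thesis
      using t0 by simp
  qed
  have "vnorm (x * y) \<le> sqrt t * vnorm y" for y
  proof (rule power2_le_imp_le)
    show "(vnorm (x * y))\<^sup>2 \<le> (sqrt t * vnorm y)\<^sup>2"
      using square[of y] t0 by (simp add: power_mult_distrib)
  qed (use t0 in simp)
  then have "p x \<le> sqrt t"
    using t0 by (intro p_le) simp_all
  then have "(p x)\<^sup>2 \<le> (sqrt t)\<^sup>2"
    by (intro power_mono) auto
  then show "(p x)\<^sup>2 \<le> t"
    using t0 by simp
qed

lemma p_fadj: "p (fadj x) = p x"
proof -
  have le: "p y \<le> p (fadj y)" for y
    using order_trans[OF p_power2_le p_mult, of y] by (rule_tac le_of_square_le_mult) auto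
  show ?thesis
    using le[of x] le[of "fadj x"] by simp
qed

lemma p_cstar: "p (fadj x * x) = (p x)\<^sup>2"
  using p_power2_le[of x] p_mult[of "fadj x" x] by (simp add: p_fadj power2_eq_square)

text \<open>
  \<open>E x\<^sup>* E x \<le> E (x\<^sup>* x) = Q (x 1)\<close>, and \<open>1\<close> is a unit vector.
\<close>

lemma norm_E_le: "norm (E x) \<le> p x"
proof -
  have "(norm (E x))\<^sup>2 = norm (adj (E x) * E x)"
    by (simp add: cstar_identity)
  also have "\<dots> \<le> norm (Q x)"
    using E_schwarz[of x] by (intro norm_mono pos_adj_mult) (simp add: Q_def)
  also have "\<dots> = (vnorm (x * 1))\<^sup>2"
    by (simp add: vnorm_power2)
  also have "\<dots> \<le> (p x * vnorm 1)\<^sup>2"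
    by (intro power_mono vnorm_mult_le) simp
  also have "vnorm 1 = 1"
    by (simp add: vnorm_def Q_def)
  finally show ?thesis
    by (intro power2_le_imp_le[of "norm (E x)"]) auto
qed

end

section \<open>Completion of a *-algebra with a C*-seminorm\<close>

text \<open>
  The completion is to be an algebra on a type of the form \<open>nat \<Rightarrow> 'c\<close>.  To this end, each element of
  the given algebra \<open>S\<close> has, up to elements of seminorm \<open>0\<close>, a code of type \<open>'c\<close>.
\<close>

locale star_algebra_seminorm =
  fixes S :: "'f::ring set"
    and sc :: "complex \<Rightarrow> 'f \<Rightarrow> 'f"
    and st :: "'f \<Rightarrow> 'f"
    and p :: "'f \<Rightarrow> real"
    and decode :: "'c \<Rightarrow> 'f"
  assumes S_closed: "0 \<in> S" "x \<in> S \<Longrightarrow> y \<in> S \<Longrightarrow> x + y \<in> S" "x \<in> S \<Longrightarrow> sc z x \<in> S"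
      "x \<in> S \<Longrightarrow> y \<in> S \<Longrightarrow> x * y \<in> S" "x \<in> S \<Longrightarrow> st x \<in> S"
    and sc: "sc z (x + y) = sc z x + sc z y" "sc (w + z) x = sc w x + sc z x"
      "sc w (sc z x) = sc (w * z) x" "sc 1 x = x" "sc z x * y = sc z (x * y)" "x * sc z y = sc z (x * y)"
    and st: "st (st x) = x" "st (x + y) = st x + st y" "st (sc z x) = sc (cnj z) (st x)"
      "st (x * y) = st y * st x"
    and p_nonneg: "0 \<le> p x"
    and p_add: "p (x + y) \<le> p x + p y"
    and p_sc: "p (sc z x) = cmod z * p x"
    and p_mult: "p (x * y) \<le> p x * p y"
    and p_cstar: "p (st x * x) = (p x)\<^sup>2"
    and p_st: "p (st x) = p x"
    and decodable: "x \<in> S \<Longrightarrow> \<exists>c. p (x - decode c) = 0"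
begin

lemma sc_minus_one: "sc (-1) x = - x"
proof -
  have "sc 0 x = 0"
    using sc(2)[of 0 0 x] by simp
  then have "sc (-1) x + sc 1 x = 0"
    by (simp flip: sc(2))
  then show ?thesis
    by (simp add: sc(4) eq_neg_iff_add_eq_0)
qed

lemma sc_diff: "sc z (x - y) = sc z x - sc z y"
  using sc(1)[of z "x - y" y] by (simp add: algebra_simps)

lemma st_diff: "st (x - y) = st x - st y"
  using st(2)[of "x - y" y] by (simp add: algebra_simps)

lemma p_zero: "p 0 = 0"
  using p_sc[of 0 0] sc(2)[of 0 0 0] by simp

lemma p_minus: "p (- x) = p x"
  using p_sc[of "-1" x] by (simp add: sc_minus_one)

lemma p_diff_commute: "p (x - y) = p (y - x)"
  using p_minus[of "x - y"] by simp

lemma p_triangle: "p (x - z) \<le> p (x - y) + p (y - z)"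
  using p_add[of "x - y" "y - z"] by simp

lemma p_diff_le: "\<bar>p x - p y\<bar> \<le> p (x - y)"
  using p_triangle[of x 0 y] p_triangle[of y 0 x] p_diff_commute[of x y] by simp

definition cauchy :: "(nat \<Rightarrow> 'f) \<Rightarrow> bool"
  where "cauchy s \<longleftrightarrow> range s \<subseteq> S \<and> (\<forall>e>0. \<exists>N. \<forall>m\<ge>N. \<forall>n\<ge>N. p (s m - s n) < e)"

definition near :: "(nat \<Rightarrow> 'f) \<Rightarrow> (nat \<Rightarrow> 'f) \<Rightarrow> bool"
  where "near s t \<longleftrightarrow> (\<lambda>n. p (s n - t n)) \<longlonglongrightarrow> 0"

lemma near_refl: "near s s"
  by (simp add: near_def p_zero)

lemma near_sym: "near s t \<Longrightarrow> near t s"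
  by (simp add: near_def p_diff_commute)

lemma near_bound:
  assumes "\<And>n. p (u n - v n) \<le> f n" "f \<longlonglongrightarrow> 0"
  shows "near u v"
  unfolding near_def
  by (rule Lim_null_comparison[OF _ assms(2)]) (use assms(1) p_nonneg in auto)

lemma near_trans:
  assumes "near s t" "near t u"
  shows "near s u"
proof (rule near_bound)
  show "p (s n - u n) \<le> p (s n - t n) + p (t n - u n)" for n
    by (rule p_triangle)
  show "(\<lambda>n. p (s n - t n) + p (t n - u n)) \<longlonglongrightarrow> 0"
    using tendsto_add[OF assms[unfolded near_def]] by simp
qed

lemma cauchy_in: "cauchy s \<Longrightarrow> s n \<in> S"
  by (auto simp: cauchy_def)

lemma cauchy_convergent_p:
  assumes "cauchy s"
  shows "convergent (\<lambda>n. p (s n))"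
proof -
  have "Cauchy (\<lambda>n. p (s n))"
  proof (rule metric_CauchyI)
    fix e :: real assume "0 < e"
    then obtain N where N: "\<forall>m\<ge>N. \<forall>n\<ge>N. p (s m - s n) < e"
      using assms by (auto simp: cauchy_def)
    have "dist (p (s m)) (p (s n)) < e" if "m \<ge> N" "n \<ge> N" for m n
      using N that order_le_less_trans[OF p_diff_le] by (simp add: dist_real_def)
    then show "\<exists>M. \<forall>m\<ge>M. \<forall>n\<ge>M. dist (p (s m)) (p (s n)) < e"
      by blast
  qed
  then show ?thesis
    by (simp add: Cauchy_convergent)
qed

lemma cauchy_bounded:
  assumes "cauchy s"
  obtains K where "0 \<le> K" "\<And>n. p (s n) \<le> K"
proof -
  obtain K where "\<And>n. norm (p (s n)) \<le> K"
    using convergent_imp_Bseq[OF cauchy_convergent_p[OF assms]] by (auto simp: Bseq_def)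
  then show ?thesis
    using that[of K] p_nonneg by (metis abs_ge_zero abs_le_D1 order_trans real_norm_def)
qed

lemma cauchyI:
  assumes "\<And>n. u n \<in> S" "cauchy s" "cauchy t"
    and "\<And>m n. p (u m - u n) \<le> K * p (s m - s n) + L * p (t m - t n)"
  shows "cauchy u"
  unfolding cauchy_def
proof (intro conjI allI impI)
  show "range u \<subseteq> S"
    using assms(1) by blast
  fix e :: real assume e: "0 < e"
  define M where "M = \<bar>K\<bar> + \<bar>L\<bar> + 1"
  have M: "M > 0"
    by (simp add: M_def)
  obtain N1 N2 where N: "\<forall>m\<ge>N1. \<forall>n\<ge>N1. p (s m - s n) < e / M" "\<forall>m\<ge>N2. \<forall>n\<ge>N2. p (t m - t n) < e / M"
    using assms(2,3) e M unfolding cauchy_def by (meson divide_pos_pos)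
  have "p (u m - u n) < e" if "m \<ge> max N1 N2" "n \<ge> max N1 N2" for m n
  proof -
    have "K * p (s m - s n) \<le> \<bar>K\<bar> * (e / M)" "L * p (t m - t n) \<le> \<bar>L\<bar> * (e / M)"
      using N that p_nonneg by (intro mult_mono; fastforce)+
    then have "p (u m - u n) \<le> (\<bar>K\<bar> + \<bar>L\<bar>) * (e / M)"
      using assms(4)[of m n] by (simp add: distrib_right add_divide_distrib)
    also have "\<dots> < M * (e / M)"
      using e M by (intro mult_strict_right_mono) (auto simp: M_def)
    finally show ?thesis
      using M by simp
  qed
  then show "\<exists>N. \<forall>m\<ge>N. \<forall>n\<ge>N. p (u m - u n) < e"
    by blast
qed

lemma cauchy_const: "x \<in> S \<Longrightarrow> cauchy (\<lambda>_. x)"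
  by (auto simp: cauchy_def p_zero)

lemma cauchy_add: "cauchy s \<Longrightarrow> cauchy t \<Longrightarrow> cauchy (\<lambda>n. s n + t n)"
proof (rule cauchyI[of _ s t 1 1])
  show "p (s m + t m - (s n + t n)) \<le> 1 * p (s m - s n) + 1 * p (t m - t n)" for m n
    using p_add[of "s m - s n" "t m - t n"] by (simp add: algebra_simps)
qed (auto intro: S_closed cauchy_in)

lemma cauchy_sc: "cauchy s \<Longrightarrow> cauchy (\<lambda>n. sc z (s n))"
  by (rule cauchyI[of _ s s "cmod z" 0]) (auto intro: S_closed cauchy_in simp: p_sc simp flip: sc_diff)

lemma cauchy_st: "cauchy s \<Longrightarrow> cauchy (\<lambda>n. st (s n))"
  by (rule cauchyI[of _ s s 1 0]) (auto intro: S_closed cauchy_in simp: p_st simp flip: st_diff)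

lemma p_mult_diff_le: "p (x * y - x' * y') \<le> p x * p (y - y') + p (x - x') * p y'"
proof -
  have "x * y - x' * y' = x * (y - y') + (x - x') * y'"
    by (simp add: algebra_simps)
  then show ?thesis
    using p_add[of "x * (y - y')" "(x - x') * y'"] p_mult[of x "y - y'"] p_mult[of "x - x'" y'] by simp
qed

lemma cauchy_mult:
  assumes "cauchy s" "cauchy t"
  shows "cauchy (\<lambda>n. s n * t n)"
proof -
  obtain K where K: "0 \<le> K" "\<And>n. p (s n) \<le> K"
    using cauchy_bounded[OF assms(1)] by blast
  obtain L where L: "0 \<le> L" "\<And>n. p (t n) \<le> L"
    using cauchy_bounded[OF assms(2)] by blast
  show ?thesis
  proof (rule cauchyI[OF _ assms])
    show "p (s m * t m - s n * t n) \<le> L * p (s m - s n) + K * p (t m - t n)" for m n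
    proof -
      have "p (s m) * p (t m - t n) \<le> K * p (t m - t n)"
        by (intro mult_right_mono K p_nonneg)
      moreover have "p (s m - s n) * p (t n) \<le> p (s m - s n) * L"
        by (intro mult_left_mono L p_nonneg)
      ultimately show ?thesis
        using p_mult_diff_le[of "s m" "t m" "s n" "t n"] by (simp add: mult.commute)
    qed
  qed (auto intro: S_closed cauchy_in assms)
qed

lemma near_add:
  assumes "near s s'" "near t t'"
  shows "near (\<lambda>n. s n + t n) (\<lambda>n. s' n + t' n)"
proof (rule near_bound)
  show "p (s n + t n - (s' n + t' n)) \<le> p (s n - s' n) + p (t n - t' n)" for n
    using p_add[of "s n - s' n" "t n - t' n"] by (simp add: algebra_simps)
  show "(\<lambda>n. p (s n - s' n) + p (t n - t' n)) \<longlonglongrightarrow> 0"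
    using tendsto_add[OF assms[unfolded near_def]] by simp
qed

lemma near_sc: "near s s' \<Longrightarrow> near (\<lambda>n. sc z (s n)) (\<lambda>n. sc z (s' n))"
  unfolding near_def
  by (simp add: p_sc tendsto_mult_right_zero flip: sc_diff)

lemma near_st: "near s s' \<Longrightarrow> near (\<lambda>n. st (s n)) (\<lambda>n. st (s' n))"
  unfolding near_def by (simp add: p_st flip: st_diff)

lemma near_mult:
  assumes "near s s'" "near t t'" "cauchy s" "cauchy t'"
  shows "near (\<lambda>n. s n * t n) (\<lambda>n. s' n * t' n)"
proof -
  obtain K where K: "0 \<le> K" "\<And>n. p (s n) \<le> K"
    using cauchy_bounded[OF assms(3)] by blast
  obtain L where L: "0 \<le> L" "\<And>n. p (t' n) \<le> L"
    using cauchy_bounded[OF assms(4)] by blast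
  show ?thesis
  proof (rule near_bound)
    show "p (s n * t n - s' n * t' n) \<le> K * p (t n - t' n) + p (s n - s' n) * L" for n
    proof -
      have "p (s n) * p (t n - t' n) \<le> K * p (t n - t' n)"
        by (intro mult_right_mono K p_nonneg)
      moreover have "p (s n - s' n) * p (t' n) \<le> p (s n - s' n) * L"
        by (intro mult_left_mono L p_nonneg)
      ultimately show ?thesis
        using p_mult_diff_le[of "s n" "t n" "s' n" "t' n"] by simp
    qed
    have "(\<lambda>n. K * p (t n - t' n) + p (s n - s' n) * L) \<longlonglongrightarrow> K * 0 + 0 * L"
      by (intro tendsto_intros assms(1,2)[unfolded near_def])
    then show "(\<lambda>n. K * p (t n - t' n) + p (s n - s' n) * L) \<longlonglongrightarrow> 0"
      by simp
  qed
qed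

lemma near_lim:
  assumes "near s t" "cauchy s" "cauchy t"
  shows "lim (\<lambda>n. p (s n)) = lim (\<lambda>n. p (t n))"
proof -
  have "(\<lambda>n. p (s n) - p (t n)) \<longlonglongrightarrow> 0"
    by (rule Lim_null_comparison[OF _ assms(1)[unfolded near_def]]) (simp add: p_diff_le)
  from tendsto_add[OF this cauchy_convergent_p[OF assms(3), unfolded convergent_LIMSEQ_iff]]
  show ?thesis
    by (simp add: limI)
qed

text \<open>
  The class of a Cauchy sequence is represented by the codes of the terms of one chosen sequence in
  it, whence the carrier of the completion consists of sequences of codes.
\<close>

definition cls :: "(nat \<Rightarrow> 'f) \<Rightarrow> nat \<Rightarrow> 'c"
  where "cls s n = (SOME c. p ((SOME t. cauchy t \<and> near t s) n - decode c) = 0)"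

definition rep :: "(nat \<Rightarrow> 'c) \<Rightarrow> nat \<Rightarrow> 'f"
  where "rep b = (SOME s. cauchy s \<and> cls s = b)"

text \<open>
  Decoding the class of \<open>s\<close> yields a sequence near to \<open>s\<close>, so that the codes determine the class.
\<close>

lemma cls_eq_iff:
  assumes "cauchy s" "cauchy t"
  shows "cls s = cls t \<longleftrightarrow> near s t"
proof
  assume "near s t"
  then have "(\<lambda>u. cauchy u \<and> near u s) = (\<lambda>u. cauchy u \<and> near u t)"
    using near_trans near_sym by blast
  then show "cls s = cls t"
    by (simp add: cls_def fun_eq_iff)
next
  have decode: "near s (\<lambda>n. decode (cls s n))" if "cauchy s" for s
  proof -
    define t where "t = (SOME t. cauchy t \<and> near t s)"
    have t: "cauchy t" "near t s"
      using someI[of "\<lambda>t. cauchy t \<and> near t s" s] that by (auto simp: t_def near_refl)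
    have "p (t n - decode (cls s n)) = 0" for n
      unfolding cls_def t_def[symmetric] by (rule someI_ex[OF decodable[OF cauchy_in[OF t(1)]]])
    then have "near t (\<lambda>n. decode (cls s n))"
      by (simp add: near_def)
    with t(2) show ?thesis
      using near_sym near_trans by blast
  qed
  assume "cls s = cls t"
  then show "near s t"
    using decode[OF assms(1)] decode[OF assms(2)] near_sym near_trans by metis
qed

lemma rep_cls:
  assumes "cauchy s"
  shows "cauchy (rep (cls s))" "near (rep (cls s)) s"
proof -
  have "cauchy (rep (cls s)) \<and> cls (rep (cls s)) = cls s"
    unfolding rep_def by (rule someI[of "\<lambda>t. cauchy t \<and> cls t = cls s" s]) (simp add: assms)
  then show "cauchy (rep (cls s))" "near (rep (cls s)) s"
    using cls_eq_iff assms by auto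
qed

definition completed :: "(nat \<Rightarrow> 'c) star_structure"
  where "completed = \<lparr>carrier = cls ` Collect cauchy,
    add = (\<lambda>b c. cls (\<lambda>n. rep b n + rep c n)),
    zero = cls (\<lambda>_. 0),
    scale = (\<lambda>z b. cls (\<lambda>n. sc z (rep b n))),
    mul = (\<lambda>b c. cls (\<lambda>n. rep b n * rep c n)),
    star = (\<lambda>b. cls (\<lambda>n. st (rep b n))),
    nrm = (\<lambda>b. lim (\<lambda>n. p (rep b n)))\<rparr>"

lemma in_carrier_completed: "cauchy s \<Longrightarrow> cls s \<in> carrier completed"
  by (simp add: completed_def)

lemma completed_cls:
  assumes "cauchy s"
  shows "scale completed z (cls s) = cls (\<lambda>n. sc z (s n))"
    "star completed (cls s) = cls (\<lambda>n. st (s n))"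
    "nrm completed (cls s) = lim (\<lambda>n. p (s n))"
    "cauchy t \<Longrightarrow> add completed (cls s) (cls t) = cls (\<lambda>n. s n + t n)"
    "cauchy t \<Longrightarrow> mul completed (cls s) (cls t) = cls (\<lambda>n. s n * t n)"
  using assms rep_cls[OF assms] rep_cls[of t]
  by (auto simp: completed_def cls_eq_iff cauchy_add cauchy_sc cauchy_st cauchy_mult
      intro!: near_add near_sc near_st near_mult near_lim)

lemma zero_completed: "zero completed = cls (\<lambda>_. 0)"
  by (simp add: completed_def)

lemma cauchy_zero: "cauchy (\<lambda>_. 0)"
  by (simp add: cauchy_const S_closed)

lemma cauchy_diff: "cauchy s \<Longrightarrow> cauchy t \<Longrightarrow> cauchy (\<lambda>n. s n - t n)"
  using cauchy_add[of s "\<lambda>n. sc (-1) (t n)"] cauchy_sc[of t "-1"] by (simp add: sc_minus_one)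

lemma sdist_cls:
  assumes "cauchy s" "cauchy t"
  shows "(\<lambda>n. p (s n - t n)) \<longlonglongrightarrow> sdist completed (cls s) (cls t)"
proof -
  have "sdist completed (cls s) (cls t) = lim (\<lambda>n. p (s n - t n))"
    using assms cauchy_sc[of t "-1"] cauchy_diff[OF assms]
    by (simp add: sdist_def completed_cls cauchy_add sc_minus_one)
  then show ?thesis
    using cauchy_convergent_p[OF cauchy_diff[OF assms]] by (simp add: convergent_LIMSEQ_iff)
qed

lemma sdist_triangle:
  assumes "cauchy s" "cauchy t" "cauchy u"
  shows "sdist completed (cls s) (cls u) \<le> sdist completed (cls s) (cls t) + sdist completed (cls t) (cls u)"
  by (rule LIMSEQ_le[OF sdist_cls[OF assms(1,3)]
        tendsto_add[OF sdist_cls[OF assms(1,2)] sdist_cls[OF assms(2,3)]]])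
    (use p_triangle in blast)

lemma sdist_commute:
  assumes "cauchy s" "cauchy t"
  shows "sdist completed (cls s) (cls t) = sdist completed (cls t) (cls s)"
  using sdist_cls[OF assms] sdist_cls[OF assms(2,1)]
  by (simp add: p_diff_commute LIMSEQ_unique)

lemma sdist_const:
  assumes "x \<in> S" "y \<in> S"
  shows "sdist completed (cls (\<lambda>_. x)) (cls (\<lambda>_. y)) = p (x - y)"
  using sdist_cls[OF cauchy_const[OF assms(1)] cauchy_const[OF assms(2)]]
  by (simp add: LIMSEQ_const_iff)

lemma cauchy_approx:
  assumes "cauchy s" "0 < e"
  obtains N where "\<And>n. n \<ge> N \<Longrightarrow> sdist completed (cls (\<lambda>_. s n)) (cls s) \<le> e"
proof -
  obtain N where N: "\<forall>m\<ge>N. \<forall>n\<ge>N. p (s m - s n) < e"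
    using assms by (auto simp: cauchy_def)
  have "sdist completed (cls (\<lambda>_. s n)) (cls s) \<le> e" if "n \<ge> N" for n
  proof (rule LIMSEQ_le_const2[OF sdist_cls])
    show "\<exists>M. \<forall>m\<ge>M. p (s n - s m) \<le> e"
      using N that by (meson less_imp_le)
  qed (auto intro: cauchy_const cauchy_in assms)
  then show ?thesis
    using that by blast
qed

text \<open>
  Let \<open>x k\<close> be an element whose class is within \<open>1 / (k + 1)\<close> of \<open>b k\<close>.  Then \<open>x\<close> is a Cauchy sequence, and its
  class is the limit of \<open>b\<close>.
\<close>

lemma completed_complete:
  assumes b: "range b \<subseteq> carrier completed"
    and cau: "\<forall>e>0. \<exists>N. \<forall>m\<ge>N. \<forall>n\<ge>N. sdist completed (b m) (b n) < e"
  shows "\<exists>x\<in>carrier completed. (\<lambda>n. sdist completed (b n) x) \<longlonglongrightarrow> 0"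
proof -
  let ?d = "sdist completed" and ?c = "\<lambda>x. cls (\<lambda>_. x)"
  have "\<exists>s. cauchy s \<and> b k = cls s" for k
    using b by (auto simp: completed_def)
  then obtain s where s: "\<And>k. cauchy (s k)" "\<And>k. b k = cls (s k)"
    by metis
  have "\<exists>x\<in>S. ?d (?c x) (b k) \<le> 1 / real (Suc k)" for k
    using cauchy_approx[OF s(1)[of k], of "1 / real (Suc k)"] s cauchy_in
    by (metis divide_pos_pos of_nat_0_less_iff order_refl zero_less_Suc zero_less_one)
  then obtain x where x: "\<And>k. x k \<in> S" "\<And>k. ?d (?c (x k)) (b k) \<le> 1 / real (Suc k)"
    by metis
  note cx = cauchy_const[OF x(1)]
  have small: "\<exists>N. \<forall>n\<ge>N. 1 / real (Suc n) < e" if "0 < e" for e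
    using LIMSEQ_inverse_real_of_nat that unfolding LIMSEQ_def
    by (auto simp: inverse_eq_divide dist_real_def)
  have "cauchy x"
    unfolding cauchy_def
  proof (intro conjI allI impI)
    fix e :: real assume "0 < e"
    then obtain N1 N2 where N: "\<forall>m\<ge>N1. \<forall>n\<ge>N1. ?d (b m) (b n) < e / 3" "\<forall>n\<ge>N2. 1 / real (Suc n) < e / 3"
      using cau small by (metis divide_pos_pos zero_less_numeral)
    have "p (x m - x n) < e" if "m \<ge> max N1 N2" "n \<ge> max N1 N2" for m n
    proof -
      have "p (x m - x n) = ?d (?c (x m)) (?c (x n))"
        by (simp add: sdist_const x)
      also have "\<dots> \<le> ?d (?c (x m)) (b m) + (?d (b m) (b n) + ?d (b n) (?c (x n)))"
        unfolding s(2)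
          by (intro order_trans[OF sdist_triangle[OF cx[of m] s(1)[of m] cx[of n]]] add_left_mono
              sdist_triangle[OF s(1)[of m] s(1)[of n] cx[of n]])
      also have "\<dots> < e / 3 + (e / 3 + e / 3)"
        using N that x(2)[of m] x(2)[of n] sdist_commute[OF s(1) cx, of n n, folded s(2)]
        by (intro add_strict_mono) (auto intro: order_le_less_trans)
      finally show ?thesis
        by simp
    qed
    then show "\<exists>N. \<forall>m\<ge>N. \<forall>n\<ge>N. p (x m - x n) < e"
      by blast
  qed (use x in blast)
  have "(\<lambda>n. ?d (b n) (cls x)) \<longlonglongrightarrow> 0"
  proof (rule LIMSEQ_I)
    fix e :: real assume "0 < e"
    then obtain N1 where N1: "\<And>n. n \<ge> N1 \<Longrightarrow> ?d (?c (x n)) (cls x) \<le> e / 3"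
      using cauchy_approx[OF \<open>cauchy x\<close>, of "e / 3"] by (metis divide_pos_pos zero_less_numeral)
    obtain N2 where N2: "\<forall>n\<ge>N2. 1 / real (Suc n) < e / 3"
      using small \<open>0 < e\<close> by (metis divide_pos_pos zero_less_numeral)
    have "norm (?d (b n) (cls x) - 0) < e" if "n \<ge> max N1 N2" for n
    proof -
      have "?d (b n) (cls x) \<le> ?d (b n) (?c (x n)) + ?d (?c (x n)) (cls x)"
        unfolding s(2) by (rule sdist_triangle[OF s(1) cx \<open>cauchy x\<close>])
      also have "?d (b n) (?c (x n)) = ?d (?c (x n)) (b n)"
        unfolding s(2) by (rule sdist_commute[OF s(1) cx])
      also have "?d (?c (x n)) (b n) + ?d (?c (x n)) (cls x) < e / 3 + e / 3 + e / 3"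
        using N1[of n] N2 x(2)[of n] that \<open>0 < e\<close> by fastforce
      finally have "?d (b n) (cls x) < e"
        by simp
      moreover have "0 \<le> ?d (b n) (cls x)"
        unfolding s(2)
        by (rule LIMSEQ_le_const[OF sdist_cls[OF s(1) \<open>cauchy x\<close>]]) (use p_nonneg in blast)
      ultimately show ?thesis
        by simp
    qed
    then show "\<exists>N. \<forall>n\<ge>N. norm (?d (b n) (cls x) - 0) < e"
      by blast
  qed
  then show ?thesis
    using in_carrier_completed[OF \<open>cauchy x\<close>] by blast
qed

lemma carrier_completedE:
  assumes "b \<in> carrier completed"
  obtains s where "cauchy s" "b = cls s"
  using assms by (auto simp: completed_def)

lemma nrm_cls: "cauchy s \<Longrightarrow> (\<lambda>n. p (s n)) \<longlonglongrightarrow> nrm completed (cls s)"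
  using cauchy_convergent_p by (simp add: completed_cls convergent_LIMSEQ_iff)

lemmas completed_simps = completed_cls zero_completed in_carrier_completed
  cauchy_add cauchy_sc cauchy_st cauchy_mult cauchy_zero

theorem cstar_structure_completed: "cstar_structure completed"
proof
  fix x y u :: "nat \<Rightarrow> 'c" and w z :: complex
  assume x: "x \<in> carrier completed"
  then obtain s where s: "cauchy s" "x = cls s"
    by (rule carrier_completedE)
  show "scale completed z x \<in> carrier completed" "star completed x \<in> carrier completed"
    "add completed x (zero completed) = x"
    "add completed x (scale completed (-1) x) = zero completed"
    "scale completed (w + z) x = add completed (scale completed w x) (scale completed z x)"
    "scale completed w (scale completed z x) = scale completed (w * z) x"
    "scale completed 1 x = x"
    "star completed (star completed x) = x"
    "star completed (scale completed z x) = scale completed (cnj z) (star completed x)"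
    using s cauchy_sc[OF s(1), of "-1"] by (simp_all add: completed_simps sc st sc_minus_one)
  show "0 \<le> nrm completed x"
    unfolding s by (rule LIMSEQ_le_const[OF nrm_cls[OF s(1)]]) (use p_nonneg in blast)
  show "nrm completed x = 0 \<longleftrightarrow> x = zero completed"
    using nrm_cls[OF s(1)] s
    by (auto simp: zero_completed cls_eq_iff cauchy_zero near_def intro: LIMSEQ_unique)
  show "nrm completed (scale completed z x) = cmod z * nrm completed x"
    using tendsto_mult_left[OF nrm_cls[OF s(1)], of "cmod z"] nrm_cls[OF cauchy_sc[OF s(1), of z]] s
    by (auto simp: completed_cls(1) p_sc intro: LIMSEQ_unique)
  show "nrm completed (mul completed (star completed x) x) = (nrm completed x)\<^sup>2"
    using tendsto_power[OF nrm_cls[OF s(1)], of 2] nrm_cls[OF cauchy_mult[OF cauchy_st[OF s(1)] s(1)]] s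
    by (auto simp: completed_cls cauchy_st p_cstar intro: LIMSEQ_unique)
  assume "y \<in> carrier completed"
  then obtain t where t: "cauchy t" "y = cls t"
    by (rule carrier_completedE)
  show "add completed x y \<in> carrier completed" "mul completed x y \<in> carrier completed"
    "add completed x y = add completed y x"
    "scale completed z (add completed x y) = add completed (scale completed z x) (scale completed z y)"
    "mul completed (scale completed z x) y = scale completed z (mul completed x y)"
    "mul completed x (scale completed z y) = scale completed z (mul completed x y)"
    "star completed (add completed x y) = add completed (star completed x) (star completed y)"
    "star completed (mul completed x y) = mul completed (star completed y) (star completed x)"
    using s t by (simp_all add: completed_simps sc st add.commute)
  show "nrm completed (add completed x y) \<le> nrm completed x + nrm completed y"
    unfolding s t completed_cls(4)[OF s(1) t(1)]
    by (rule LIMSEQ_le[OF nrm_cls[OF cauchy_add[OF s(1) t(1)]] tendsto_add[OF nrm_cls[OF s(1)] nrm_cls[OF t(1)]]])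
      (use p_add in blast)
  show "nrm completed (mul completed x y) \<le> nrm completed x * nrm completed y"
    unfolding s t completed_cls(5)[OF s(1) t(1)]
    by (rule LIMSEQ_le[OF nrm_cls[OF cauchy_mult[OF s(1) t(1)]] tendsto_mult[OF nrm_cls[OF s(1)] nrm_cls[OF t(1)]]])
      (use p_mult in blast)
  assume "u \<in> carrier completed"
  then obtain v where v: "cauchy v" "u = cls v"
    by (rule carrier_completedE)
  show "add completed (add completed x y) u = add completed x (add completed y u)"
    "mul completed (mul completed x y) u = mul completed x (mul completed y u)"
    "mul completed (add completed x y) u = add completed (mul completed x u) (mul completed y u)"
    "mul completed u (add completed x y) = add completed (mul completed u x) (mul completed u y)"
    using s t v by (simp_all add: completed_simps algebra_simps)
next
  show "zero completed \<in> carrier completed"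
    by (simp add: completed_simps)
qed (rule completed_complete)

end

section \<open>Bounding the moments by the norm of the free product\<close>

definition augmentation_ideal :: "'a free_algebra set"
  where "augmentation_ideal = {x. coeff x [] = 0}"

lemma coeff_mono_Nil [simp]: "coeff (monomial w c) [] = (if w = [] then c else 0)"
  by (auto simp: lookup_single when_def)

lemma coeff_mult_Nil [simp]: "coeff (x * y) [] = coeff x [] * coeff y []"
proof (induction x rule: free_algebra_induct)
  case (monomial u a)
  show ?case
    by (induction y rule: free_algebra_induct) (auto simp: lookup_add distrib_left)
qed (auto simp: lookup_add distrib_right)

lemma coeff_fadj_Nil [simp]: "coeff (fadj x) [] = cnj (coeff x [])"
  by (induction x rule: free_algebra_induct) (auto simp: lookup_add)

lemma augmentation_ideal_closed:
  "0 \<in> augmentation_ideal"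
  "x \<in> augmentation_ideal \<Longrightarrow> y \<in> augmentation_ideal \<Longrightarrow> x + y \<in> augmentation_ideal"
  "x \<in> augmentation_ideal \<Longrightarrow> y \<in> augmentation_ideal \<Longrightarrow> x - y \<in> augmentation_ideal"
  "x \<in> augmentation_ideal \<Longrightarrow> fscale z x \<in> augmentation_ideal"
  "x \<in> augmentation_ideal \<Longrightarrow> x * y \<in> augmentation_ideal"
  "y \<in> augmentation_ideal \<Longrightarrow> x * y \<in> augmentation_ideal"
  "z' \<in> augmentation_ideal \<Longrightarrow> fadj z' \<in> augmentation_ideal"
  "w \<noteq> [] \<Longrightarrow> monomial w c \<in> augmentation_ideal"
  by (auto simp: augmentation_ideal_def lookup_add lookup_minus coeff_fscale)

lemma augmentation_ideal_induct [consumes 1, case_names zero monomial add]: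
  assumes "x \<in> augmentation_ideal" "P 0" "\<And>w c. w \<noteq> [] \<Longrightarrow> P (monomial w c)"
    "\<And>x y. x \<in> augmentation_ideal \<Longrightarrow> y \<in> augmentation_ideal \<Longrightarrow> P x \<Longrightarrow> P y \<Longrightarrow> P (x + y)"
  shows "P x"
proof -
  have "P (\<Sum>w\<in>S. monomial w (coeff x w)) \<and> (\<Sum>w\<in>S. monomial w (coeff x w)) \<in> augmentation_ideal"
    if "finite S" "[] \<notin> S" for S
    using that by (induction S) (auto intro: assms augmentation_ideal_closed)
  moreover have "[] \<notin> words x"
    using assms(1) by (simp add: augmentation_ideal_def in_keys_iff)
  ultimately show ?thesis
    by (subst mono_as_sum) simp
qed

definition decode :: "'a word list \<Rightarrow> 'a free_algebra"
  where "decode ws = (\<Sum>w\<leftarrow>ws. monomial w 1)"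

context cp_contraction
begin

lemma null_add: "null x \<Longrightarrow> null y \<Longrightarrow> null (x + y)"
  by (simp add: null_def distrib_left distrib_right)

lemma null_mult_right: "null x \<Longrightarrow> null (x * y)"
  by (simp add: null_def mult.assoc)

text \<open>
  The coefficient of a nonempty word is absorbed in its first letter.
\<close>

lemma decode_augmentation_ideal:
  "x \<in> augmentation_ideal \<Longrightarrow> \<exists>ws. null (x - decode ws)"
proof (induction x rule: augmentation_ideal_induct)
  case zero
  show ?case
    by (rule exI[of _ "[]"]) (simp add: decode_def null_def)
next
  case (monomial w c)
  then obtain k a v where w: "w = (k, a) # v"
    by (metis list.exhaust prod.exhaust)
  have "monomial w c - decode [(k, c *\<^sub>C a) # v] = - ((letter k (c *\<^sub>C a) - fscale c (letter k a)) * monomial v 1)"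
    by (simp add: decode_def w left_diff_distrib)
  moreover have "null (- ((letter k (c *\<^sub>C a) - fscale c (letter k a)) * monomial v 1))"
    using null_mult_right[OF letter_relations(2)] by (simp add: null_def del: fscale_simps)
  ultimately show ?case
    by metis
next
  case (add x y)
  then obtain us vs where "null (x - decode us)" "null (y - decode vs)"
    by blast
  from null_add[OF this] have "null (x + y - decode (us @ vs))"
    by (simp add: decode_def algebra_simps)
  then show ?case
    by blast
qed

sublocale C: star_algebra_seminorm augmentation_ideal fscale fadj p decode
proof
  fix x :: "'a free_algebra"
  assume "x \<in> augmentation_ideal"
  then show "\<exists>ws. p (x - decode ws) = 0"
    using decode_augmentation_ideal p_null by blast
qed (auto simp: augmentation_ideal_closed fscale_add_left p_add p_fscale p_mult p_cstar p_fadj)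

abbreviation const_cls :: "'a free_algebra \<Rightarrow> 'a test_type"
  where "const_cls x \<equiv> C.cls (\<lambda>_. x)"

lemma const_cls_eq:
  assumes "x \<in> augmentation_ideal" "y \<in> augmentation_ideal" "null (x - y)"
  shows "const_cls x = const_cls y"
  using assms by (simp add: C.cls_eq_iff C.cauchy_const C.near_def p_null)

lemma const_cls_arith:
  assumes "x \<in> augmentation_ideal"
  shows "scale C.completed z (const_cls x) = const_cls (fscale z x)"
    "star C.completed (const_cls x) = const_cls (fadj x)"
    "nrm C.completed (const_cls x) = p x"
    "y \<in> augmentation_ideal \<Longrightarrow> add C.completed (const_cls x) (const_cls y) = const_cls (x + y)"
    "y \<in> augmentation_ideal \<Longrightarrow> mul C.completed (const_cls x) (const_cls y) = const_cls (x * y)"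
  using assms by (simp_all add: C.completed_cls C.cauchy_const)

lemma letter_in_augmentation_ideal [simp]: "letter k a \<in> augmentation_ideal"
  by (simp add: augmentation_ideal_closed)

lemma star_hom_into_completed: "star_hom_into C.completed (\<lambda>a. const_cls (letter k a))"
  unfolding star_hom_into_def
proof (intro conjI allI)
  show "range (\<lambda>a. const_cls (letter k a)) \<subseteq> carrier C.completed"
    by (intro image_subsetI C.in_carrier_completed C.cauchy_const letter_in_augmentation_ideal)
  fix a b z
  show "const_cls (letter k (a + b)) = add C.completed (const_cls (letter k a)) (const_cls (letter k b))"
    by (simp add: const_cls_arith)
      (intro const_cls_eq letter_relations letter_in_augmentation_ideal augmentation_ideal_closed)
  show "const_cls (letter k (z *\<^sub>C a)) = scale C.completed z (const_cls (letter k a))"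
    by (simp only: const_cls_arith letter_in_augmentation_ideal)
      (intro const_cls_eq letter_relations letter_in_augmentation_ideal augmentation_ideal_closed)
  show "const_cls (letter k (a * b)) = mul C.completed (const_cls (letter k a)) (const_cls (letter k b))"
    by (simp only: const_cls_arith letter_in_augmentation_ideal)
      (intro const_cls_eq letter_relations letter_in_augmentation_ideal augmentation_ideal_closed)
  show "const_cls (letter k (adj a)) = star C.completed (const_cls (letter k a))"
    by (simp add: const_cls_arith)
qed

end

lemma star_hom_unital_extension:
  assumes "star_hom f"
  shows "unital_extension f (x * y) = unital_extension f x * unital_extension f y"
    "unital_extension f 1 = 1" "unital_extension f (x + y) = unital_extension f x + unital_extension f y"
    "unital_extension f (z *\<^sub>C x) = z *\<^sub>C unital_extension f x"
  by (auto simp: unitization_eq_iff star_hom_simps[OF assms])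

lemma cstar_seminorm_of_star_hom_into:
  assumes "cstar_structure B" "star_hom_into B f"
  shows "cstar_seminorm (\<lambda>x. nrm B (f x))"
proof -
  interpret cstar_structure B by fact
  have f: "f x \<in> carrier B" "f (x + y) = add B (f x) (f y)" "f (z *\<^sub>C x) = scale B z (f x)"
    "f (x * y) = mul B (f x) (f y)" "f (adj x) = star B (f x)" for x y z
    using assms(2) by (auto simp: star_hom_into_def)
  show ?thesis
    by unfold_locales (simp_all add: f nrm_nonneg nrm_triangle nrm_mul nrm_scale nrm_cstar)
qed

locale free_product_with_map = cp_contraction \<phi> for \<phi> :: "'a::cstar_algebra \<Rightarrow> 'a" +
  fixes \<theta> :: "nat \<Rightarrow> 'a \<Rightarrow> 'p::cstar_algebra"
  assumes free: "free_product \<theta>"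
begin

lemma star_hom_theta: "star_hom (\<theta> k)"
  using free by (simp add: free_product_def)

lemmas theta_simps = star_hom_simps[OF star_hom_theta]

definition eval_word :: "'a word \<Rightarrow> 'p unitization"
  where "eval_word w = prod_list (map (\<lambda>(k, a). emb (\<theta> k a)) w)"

abbreviation eval1 :: "'a free_algebra \<Rightarrow> 'p unitization"
  where "eval1 \<equiv> linear_extension eval_word"

definition eval :: "'a free_algebra \<Rightarrow> 'p"
  where "eval x = alg (eval1 x)"

lemma eval_word_simps [simp]:
  "eval_word [] = 1"
  "eval_word (u @ v) = eval_word u * eval_word v"
  "eval_word ((k, a) # v) = emb (\<theta> k a) * eval_word v"
  by (auto simp: eval_word_def)

lemma eval1_mult [simp]: "eval1 (x * y) = eval1 x * eval1 y"
proof (induction x rule: free_algebra_induct)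
  case (monomial u a)
  show ?case
    by (induction y rule: free_algebra_induct) (auto simp: distrib_left scaleC_simps)
qed (auto simp: distrib_right)

lemma eval1_fadj [simp]: "eval1 (fadj x) = adj (eval1 x)"
proof (induction x rule: free_algebra_induct)
  case (monomial w c)
  have "eval_word (adj_word w) = adj (eval_word w)"
    by (induction w) (auto simp: adj_mult theta_simps emb_arith split_paired_all)
  then show ?case
    by (simp add: adj_scaleC)
qed (auto simp: adj_add)

lemma scal_eval1: "scal (eval1 x) = coeff x []"
proof (induction x rule: free_algebra_induct)
  case (monomial w c)
  show ?case
    by (cases w) (auto simp: split_paired_all)
qed (auto simp: lookup_add)

lemma scal_E: "scal (E x) = coeff x []"
  by (induction x rule: free_algebra_induct) (auto simp: lookup_add scal_moment)

lemma eval_linear: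
  "eval (x + y) = eval x + eval y" "eval (x - y) = eval x - eval y" "eval (fscale z x) = z *\<^sub>C eval x"
  "eval 0 = 0" "eval (fadj x) = adj (eval x)" "eval (letter k a) = \<theta> k a"
  by (simp_all add: eval_def scaleC_one)

lemma eval_mult:
  "x \<in> augmentation_ideal \<Longrightarrow> y \<in> augmentation_ideal \<Longrightarrow> eval (x * y) = eval x * eval y"
  by (simp add: eval_def scal_eval1 augmentation_ideal_def)

text \<open>
  The universal property, applied to the completion of the free algebra, yields a *-homomorphism \<open>\<rho>\<close> with
  \<open>nrm (\<rho> (eval x)) = p x\<close>, and *-homomorphisms are contractive.
\<close>

lemma p_le_norm_eval:
  assumes "x \<in> augmentation_ideal"
  shows "p x \<le> norm (eval x)"
proof -
  let ?B = "C.completed :: 'a test_type star_structure"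
  have "universal_at TYPE('a test_type) \<theta>"
    using free by (simp add: free_product_def)
  note this[unfolded universal_at_def, rule_format, OF C.cstar_structure_completed,
      of "\<lambda>k a. const_cls (letter k a)", OF star_hom_into_completed]
  then obtain \<rho> where \<rho>: "star_hom_into ?B \<rho>" "\<And>k. (\<lambda>a. const_cls (letter k a)) = \<rho> \<circ> \<theta> k"
    by blast
  have rho_simps: "\<rho> (x + y) = add ?B (\<rho> x) (\<rho> y)" "\<rho> (z *\<^sub>C x) = scale ?B z (\<rho> x)"
    "\<rho> (x * y) = mul ?B (\<rho> x) (\<rho> y)" for x y z
    using \<rho>(1) by (auto simp: star_hom_into_def)
  have rho_letter: "\<rho> (\<theta> k a) = const_cls (letter k a)" for k a
    using fun_cong[OF \<rho>(2)] by simp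
  have rho_word: "\<rho> (eval (monomial w 1)) = const_cls (monomial w 1)" if "w \<noteq> []" for w
    using that
  proof (induction w rule: list_nonempty_induct)
    case (single l)
    then show ?case
      by (cases l) (simp add: eval_linear rho_letter)
  next
    case (cons l w)
    obtain k a where l: "l = (k, a)"
      by (cases l)
    have w: "monomial w 1 \<in> augmentation_ideal"
      using cons.hyps by (simp add: augmentation_ideal_closed)
    have eq: "monomial (l # w) 1 = letter k a * monomial w 1"
      by (simp add: l)
    show ?case
      unfolding eq eval_mult[OF letter_in_augmentation_ideal w] rho_simps eval_linear rho_letter cons.IH
      by (rule const_cls_arith(5)[OF letter_in_augmentation_ideal w])
  qed
  have "\<rho> (eval x) = const_cls x"
    using assms
  proof (induction x rule: augmentation_ideal_induct)
    case zero
    have "\<rho> (0 *\<^sub>C \<theta> 0 0) = const_cls (fscale 0 (letter 0 0))"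
      unfolding rho_simps rho_letter by (simp only: const_cls_arith letter_in_augmentation_ideal)
    then show ?case
      by (simp add: eval_linear fscale_def)
  next
    case (monomial w c)
    then have "monomial w 1 \<in> augmentation_ideal"
      by (simp add: augmentation_ideal_closed)
    then show ?case
      unfolding mono_eq_fscale[of w c] eval_linear rho_simps rho_word[OF monomial]
      by (rule const_cls_arith(1))
  next
    case (add x y)
    then show ?case
      by (simp add: eval_linear rho_simps const_cls_arith)
  qed
  then have "nrm ?B (\<rho> (eval x)) = p x"
    using assms by (simp add: const_cls_arith)
  moreover have "nrm ?B (\<rho> (eval x)) \<le> norm (eval x)"
    by (rule cstar_seminorm.le_norm[OF cstar_seminorm_of_star_hom_into])
      (rule C.cstar_structure_completed \<rho>(1))+
  ultimately show ?thesis
    by simp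
qed

lemma norm_E_le_norm_eval: "x \<in> augmentation_ideal \<Longrightarrow> norm (E x) \<le> norm (eval x)"
  using order_trans[OF norm_E_le p_le_norm_eval] .

text \<open>
  The closure is a C*-subalgebra that contains the generators of the free product.
\<close>

lemma dense: "closure (eval ` augmentation_ideal) = UNIV"
proof -
  let ?D = "eval ` augmentation_ideal"
  have limit: "z \<in> closure ?D \<longleftrightarrow> (\<exists>x. (\<forall>n. x n \<in> ?D) \<and> x \<longlonglongrightarrow> z)" for z
    by (rule closure_sequential)
  have add: "x + y \<in> ?D" and mult: "x * y \<in> ?D" if "x \<in> ?D" "y \<in> ?D" for x y
  proof -
    obtain u v where uv: "x = eval u" "y = eval v" "u \<in> augmentation_ideal" "v \<in> augmentation_ideal"
      using \<open>x \<in> ?D\<close> \<open>y \<in> ?D\<close> by blast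
    show "x + y \<in> ?D"
      using uv by (intro image_eqI[of _ _ "u + v"]) (auto simp: eval_linear augmentation_ideal_closed)
    show "x * y \<in> ?D"
      using uv by (intro image_eqI[of _ _ "u * v"]) (auto simp: eval_mult augmentation_ideal_closed)
  qed
  have scale: "z *\<^sub>C x \<in> ?D" and star: "adj x \<in> ?D" if "x \<in> ?D" for x z
  proof -
    obtain u where u: "x = eval u" "u \<in> augmentation_ideal"
      using \<open>x \<in> ?D\<close> by blast
    show "z *\<^sub>C x \<in> ?D"
      using u by (intro image_eqI[of _ _ "fscale z u"]) (auto simp: eval_linear augmentation_ideal_closed)
    show "adj x \<in> ?D"
      using u by (intro image_eqI[of _ _ "fadj u"]) (auto simp: eval_linear augmentation_ideal_closed)
  qed
  have "cstar_subalgebra (closure ?D)"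
    unfolding cstar_subalgebra_def complex_vector.subspace_def
  proof (intro conjI ballI allI)
    show "0 \<in> closure ?D"
      by (intro subsetD[OF closure_subset] image_eqI[of _ _ 0]) (auto simp: eval_linear augmentation_ideal_closed)
    fix x assume "x \<in> closure ?D"
    then obtain xs where x: "\<And>n. xs n \<in> ?D" "xs \<longlonglongrightarrow> x"
      unfolding limit by blast
    show "z *\<^sub>C x \<in> closure ?D" for z
      unfolding limit by (intro exI[of _ "\<lambda>n. z *\<^sub>C xs n"] conjI allI scale x
          bounded_linear.tendsto[OF bounded_linear_scaleC])
    show "adj x \<in> closure ?D"
      unfolding limit by (intro exI[of _ "\<lambda>n. adj (xs n)"] conjI allI star x
          bounded_linear.tendsto[OF bounded_linear_adj])
    fix y assume "y \<in> closure ?D"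
    then obtain ys where y: "\<And>n. ys n \<in> ?D" "ys \<longlonglongrightarrow> y"
      unfolding limit by blast
    show "x + y \<in> closure ?D"
      unfolding limit by (intro exI[of _ "\<lambda>n. xs n + ys n"] conjI allI add x y tendsto_add)
    show "x * y \<in> closure ?D"
      unfolding limit by (intro exI[of _ "\<lambda>n. xs n * ys n"] conjI allI mult x y tendsto_mult)
  qed simp
  moreover have "(\<Union>k. range (\<theta> k)) \<subseteq> closure ?D"
  proof (intro UN_least image_subsetI subsetD[OF closure_subset])
    fix k a
    show "\<theta> k a \<in> ?D"
      by (rule image_eqI[of _ _ "letter k a"]) (simp_all add: eval_linear)
  qed
  ultimately have "cstar_subalgebra hull (\<Union>k. range (\<theta> k)) \<subseteq> closure ?D"
    by (intro hull_minimal)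
  then show ?thesis
    using free by (auto simp: free_product_def)
qed

lemma eval_approximation:
  "\<exists>x. (\<forall>n. x n \<in> augmentation_ideal) \<and> (\<lambda>n. eval (x n)) \<longlonglongrightarrow> z"
proof -
  have "z \<in> closure (eval ` augmentation_ideal)"
    by (simp add: dense)
  then obtain y where y: "\<forall>n. y n \<in> eval ` augmentation_ideal" "y \<longlonglongrightarrow> z"
    unfolding closure_sequential by blast
  then have "\<forall>n. \<exists>x. x \<in> augmentation_ideal \<and> y n = eval x"
    by blast
  from choice[OF this] obtain x where x: "\<forall>n. x n \<in> augmentation_ideal \<and> y n = eval (x n)"
    by blast
  then have "y = (\<lambda>n. eval (x n))"
    by blast
  with x y(2) show ?thesis
    by blast
qed

section \<open>Existence of the expectation\<close>

text \<open>
  By \<open>norm_E_le_norm_eval\<close>, \<open>E (x n)\<close> converges along with \<open>eval (x n)\<close>, to a limit that depends only on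
  \<open>z\<close>; its scalar part is \<open>0\<close>.
\<close>

lemma E_extends:
  obtains e :: "'p \<Rightarrow> 'a" where
    "\<And>x z. (\<And>n. x n \<in> augmentation_ideal) \<Longrightarrow> (\<lambda>n. eval (x n)) \<longlonglongrightarrow> z \<Longrightarrow> (\<lambda>n. E (x n)) \<longlonglongrightarrow> emb (e z)"
proof -
  obtain X where X: "\<And>z n. X z n \<in> augmentation_ideal" "\<And>z. (\<lambda>n. eval (X z n)) \<longlonglongrightarrow> z"
    using eval_approximation by metis
  have conv: "convergent (\<lambda>n. E (X z n))" for z
  proof -
    have "Cauchy (\<lambda>n. E (X z n))"
    proof (rule CauchyI)
      fix r :: real assume "0 < r"
      then obtain M where M: "\<forall>m\<ge>M. \<forall>n\<ge>M. norm (eval (X z m) - eval (X z n)) < r"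
        using CauchyD[OF LIMSEQ_imp_Cauchy[OF X(2)]] by blast
      have "norm (E (X z m) - E (X z n)) \<le> norm (eval (X z m) - eval (X z n))" for m n
        using norm_E_le_norm_eval[OF augmentation_ideal_closed(3)[OF X(1) X(1)], of z m z n]
        by (simp add: eval_linear)
      then show "\<exists>M. \<forall>m\<ge>M. \<forall>n\<ge>M. norm (E (X z m) - E (X z n)) < r"
        using M by (meson order_le_less_trans)
    qed
    then show ?thesis
      by (simp add: Cauchy_convergent)
  qed
  define e where "e z = alg (lim (\<lambda>n. E (X z n)))" for z
  have lim: "(\<lambda>n. E (X z n)) \<longlonglongrightarrow> emb (e z)" for z
  proof -
    have *: "(\<lambda>n. E (X z n)) \<longlonglongrightarrow> lim (\<lambda>n. E (X z n))"
      using conv by (simp add: convergent_LIMSEQ_iff)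
    from bounded_linear.tendsto[OF bounded_linear_scal this]
    have "scal (lim (\<lambda>n. E (X z n))) = 0"
      using X(1) by (simp add: scal_E augmentation_ideal_def LIMSEQ_const_iff)
    with * show ?thesis
      by (simp add: e_def emb_alg)
  qed
  show ?thesis
  proof (rule that[of e])
    fix x z assume x: "\<And>n. x n \<in> augmentation_ideal" "(\<lambda>n. eval (x n)) \<longlonglongrightarrow> z"
    have "(\<lambda>n. E (x n - X z n)) \<longlonglongrightarrow> 0"
    proof (rule Lim_null_comparison)
      show "\<forall>\<^sub>F n in sequentially. norm (E (x n - X z n)) \<le> norm (eval (x n - X z n))"
        by (intro always_eventually allI norm_E_le_norm_eval augmentation_ideal_closed x X)
      show "(\<lambda>n. norm (eval (x n - X z n))) \<longlonglongrightarrow> 0"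
        using tendsto_norm[OF tendsto_diff[OF x(2) X(2)[of z]]] by (simp add: eval_linear)
    qed
    from tendsto_add[OF this lim[of z]] show "(\<lambda>n. E (x n)) \<longlonglongrightarrow> emb (e z)"
      by simp
  qed
qed

definition fshift :: "'a free_algebra \<Rightarrow> 'a free_algebra"
  where "fshift = extend (\<lambda>w c. monomial (shift_word w) c)"

lemma fshift_simps [simp]:
  "fshift 0 = 0"
  "fshift (monomial w c) = monomial (shift_word w) c"
  "fshift (x + y) = fshift x + fshift y"
  by (auto simp: fshift_def extend_mono extend_add single_add)

lemma coeff_fshift_Nil [simp]: "coeff (fshift x) [] = coeff x []"
  by (induction x rule: free_algebra_induct) (auto simp: lookup_add)

lemma E_fshift: "E (fshift x) = \<phi>' (E x)"
proof (induction x rule: free_algebra_induct)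
  case zero
  show ?case
    using unital_extension_linear(2)[of 0 0] by simp
qed (auto simp: moment_shift unital_extension_linear)

lemma eval_fshift:
  assumes "is_shift \<theta> \<sigma>"
  shows "eval (fshift x) = \<sigma> (eval x)"
proof -
  have \<sigma>: "star_hom \<sigma>" "\<And>k a. \<sigma> (\<theta> k a) = \<theta> (Suc k) a"
    using assms by (auto simp: is_shift_def fun_eq_iff)
  note ext = star_hom_unital_extension[OF \<sigma>(1)]
  have word: "eval_word (shift_word w) = unital_extension \<sigma> (eval_word w)" for w
  proof (induction w)
    case (Cons l w)
    obtain k a where l: "l = (k, a)"
      by (cases l)
    have "emb (\<theta> (Suc k) a) = unital_extension \<sigma> (emb (\<theta> k a))"
      by (simp add: unitization_eq_iff \<sigma>(2))
    then show ?case
      by (simp only: l list.map apfst_conv eval_word_simps ext Cons.IH)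
  qed (simp add: ext)
  have "eval1 (fshift x) = unital_extension \<sigma> (eval1 x)"
  proof (induction x rule: free_algebra_induct)
    case zero
    show ?case
      using ext(4)[of 0 0] by simp
  qed (simp_all add: word ext)
  then show ?thesis
    by (simp add: eval_def)
qed

lemma E_letter_0: "E (x * letter 0 a * y) = E x * emb a * E y"
proof (induction x rule: free_algebra_induct)
  case (monomial u c)
  show ?case
  proof (induction y rule: free_algebra_induct)
    case (monomial v d)
    then show ?case
      by (simp add: moment_split scaleC_simps)
  qed (auto simp: distrib_left distrib_right)
qed (auto simp: distrib_right)

text \<open>
  The expectation is \<open>\<theta> 0 \<circ> e\<close>, where \<open>e\<close> is the extension of \<open>E\<close>.  Each property of \<open>e\<close> is
  inherited from \<open>E\<close> along sequences \<open>eval (u n)\<close>.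
\<close>

theorem existence:
  assumes "is_shift \<theta> \<sigma>"
  shows "\<exists>T. alpha_expectation (range (\<theta> 0)) \<sigma> T \<and> (\<forall>a. \<theta> 0 (\<phi> a) = T (\<sigma> (\<theta> 0 a)))"
proof -
  have \<sigma>: "star_hom \<sigma>" "\<And>k a. \<sigma> (\<theta> k a) = \<theta> (Suc k) a"
    using assms by (auto simp: is_shift_def fun_eq_iff)
  obtain e where e: "\<And>x z. (\<And>n. x n \<in> augmentation_ideal) \<Longrightarrow> (\<lambda>n. eval (x n)) \<longlonglongrightarrow> z
      \<Longrightarrow> (\<lambda>n. E (x n)) \<longlonglongrightarrow> emb (e z)"
    using E_extends by blast
  have e_eval: "emb (e (eval x)) = E x" if "x \<in> augmentation_ideal" for x
    using e[of "\<lambda>_. x" "eval x"] that by (simp add: LIMSEQ_const_iff)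
  have e_add: "e (x + y) = e x + e y" for x y
  proof -
    obtain u v where uv: "\<forall>n. u n \<in> augmentation_ideal" "(\<lambda>n. eval (u n)) \<longlonglongrightarrow> x"
      "\<forall>n. v n \<in> augmentation_ideal" "(\<lambda>n. eval (v n)) \<longlonglongrightarrow> y"
      using eval_approximation by metis
    have "(\<lambda>n. E (u n + v n)) \<longlonglongrightarrow> emb (e (x + y))"
      using uv by (intro e) (auto simp: eval_linear augmentation_ideal_closed tendsto_add)
    moreover have "(\<lambda>n. E (u n + v n)) \<longlonglongrightarrow> emb (e x) + emb (e y)"
      using uv by (auto intro!: tendsto_add e)
    ultimately show ?thesis
      using LIMSEQ_unique by (fastforce simp flip: emb_arith)
  qed
  have e_scale: "e (z *\<^sub>C x) = z *\<^sub>C e x" for x z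
  proof -
    obtain u where u: "\<forall>n. u n \<in> augmentation_ideal" "(\<lambda>n. eval (u n)) \<longlonglongrightarrow> x"
      using eval_approximation by metis
    have "(\<lambda>n. E (fscale z (u n))) \<longlonglongrightarrow> emb (e (z *\<^sub>C x))"
      using u by (intro e) (auto simp: eval_linear augmentation_ideal_closed
          intro!: bounded_linear.tendsto[OF bounded_linear_scaleC])
    moreover have "(\<lambda>n. E (fscale z (u n))) \<longlonglongrightarrow> z *\<^sub>C emb (e x)"
      using u by (auto intro!: bounded_linear.tendsto[OF bounded_linear_scaleC] e)
    ultimately show ?thesis
      using LIMSEQ_unique by (fastforce simp flip: emb_arith)
  qed
  have e_norm: "norm (e x) \<le> norm x" for x
  proof -
    obtain u where u: "\<forall>n. u n \<in> augmentation_ideal" "(\<lambda>n. eval (u n)) \<longlonglongrightarrow> x"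
      using eval_approximation by metis
    have "(\<lambda>n. norm (E (u n))) \<longlonglongrightarrow> norm (emb (e x))"
      using u by (intro tendsto_norm e) auto
    then have "norm (emb (e x)) \<le> norm x"
      by (rule LIMSEQ_le[OF _ tendsto_norm[OF u(2)]]) (use u(1) norm_E_le_norm_eval in blast)
    then show ?thesis
      by simp
  qed
  have e_theta: "e (x * \<theta> 0 a * y) = e x * a * e y" for x y a
  proof -
    obtain u v where uv: "\<forall>n. u n \<in> augmentation_ideal" "(\<lambda>n. eval (u n)) \<longlonglongrightarrow> x"
      "\<forall>n. v n \<in> augmentation_ideal" "(\<lambda>n. eval (v n)) \<longlonglongrightarrow> y"
      using eval_approximation by metis
    have "(\<lambda>n. E (u n * letter 0 a * v n)) \<longlonglongrightarrow> emb (e (x * \<theta> 0 a * y))"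
      using uv by (intro e) (auto simp: eval_mult eval_linear augmentation_ideal_closed intro!: tendsto_intros)
    moreover have "(\<lambda>n. E (u n * letter 0 a * v n)) \<longlonglongrightarrow> emb (e x) * emb a * emb (e y)"
      unfolding E_letter_0 using uv by (intro tendsto_intros e) auto
    ultimately show ?thesis
      using LIMSEQ_unique by (fastforce simp flip: emb_arith)
  qed
  have e_theta_left: "e (\<theta> 0 a * y) = a * e y" for y a
  proof -
    obtain v where v: "\<forall>n. v n \<in> augmentation_ideal" "(\<lambda>n. eval (v n)) \<longlonglongrightarrow> y"
      using eval_approximation by metis
    have "(\<lambda>n. E (letter 0 a * v n)) \<longlonglongrightarrow> emb (e (\<theta> 0 a * y))"
      using v by (intro e) (auto simp: eval_mult eval_linear augmentation_ideal_closed intro!: tendsto_intros)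
    moreover have "E (letter 0 a * v n) = emb a * E (v n)" for n
      using E_letter_0[of 1 a "v n"] by simp
    then have "(\<lambda>n. E (letter 0 a * v n)) \<longlonglongrightarrow> emb a * emb (e y)"
      using v by (auto intro!: tendsto_intros e)
    ultimately show ?thesis
      using LIMSEQ_unique by (fastforce simp flip: emb_arith)
  qed
  have e_theta_right: "e (x * \<theta> 0 a) = e x * a" for x a
  proof -
    obtain u where u: "\<forall>n. u n \<in> augmentation_ideal" "(\<lambda>n. eval (u n)) \<longlonglongrightarrow> x"
      using eval_approximation by metis
    have "(\<lambda>n. E (u n * letter 0 a)) \<longlonglongrightarrow> emb (e (x * \<theta> 0 a))"
      using u by (intro e) (auto simp: eval_mult eval_linear augmentation_ideal_closed intro!: tendsto_intros)
    moreover have "E (u n * letter 0 a) = E (u n) * emb a" for n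
      using E_letter_0[of "u n" a 1] by simp
    then have "(\<lambda>n. E (u n * letter 0 a)) \<longlonglongrightarrow> emb (e x) * emb a"
      using u by (auto intro!: tendsto_intros e)
    ultimately show ?thesis
      using LIMSEQ_unique by (fastforce simp flip: emb_arith)
  qed
  have e_id: "e (\<theta> 0 a) = a" for a
  proof -
    have "emb (e (eval (letter 0 a))) = emb a"
      using e_eval[OF letter_in_augmentation_ideal, of 0 a] E_letter_0[of 1 a 1] by simp
    then show ?thesis
      by (simp add: eval_linear)
  qed
  have e_shift: "e (\<sigma> x) = \<phi> (e x)" for x
  proof -
    obtain u where u: "\<forall>n. u n \<in> augmentation_ideal" "(\<lambda>n. eval (u n)) \<longlonglongrightarrow> x"
      using eval_approximation by metis
    have "(\<lambda>n. E (fshift (u n))) \<longlonglongrightarrow> emb (e (\<sigma> x))"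
      using u by (intro e) (auto simp: eval_fshift[OF assms] augmentation_ideal_def
          intro!: bounded_linear.tendsto[OF star_hom_bounded_linear[OF \<sigma>(1)]])
    from bounded_linear.tendsto[OF bounded_linear_alg this]
    have 1: "(\<lambda>n. \<phi> (alg (E (u n)))) \<longlonglongrightarrow> e (\<sigma> x)"
      by (simp add: E_fshift)
    have "(\<lambda>n. E (u n)) \<longlonglongrightarrow> emb (e x)"
      using u by (intro e) auto
    from bounded_linear.tendsto[OF bounded_linear_phi bounded_linear.tendsto[OF bounded_linear_alg this]]
    have "(\<lambda>n. \<phi> (alg (E (u n)))) \<longlonglongrightarrow> \<phi> (e x)"
      by simp
    with 1 show ?thesis
      by (rule LIMSEQ_unique)
  qed
  have e_positive: "positive (e (adj x * x))" for x
  proof -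
    obtain u where u: "\<forall>n. u n \<in> augmentation_ideal" "(\<lambda>n. eval (u n)) \<longlonglongrightarrow> x"
      using eval_approximation by metis
    have "(\<lambda>n. E (fadj (u n) * u n)) \<longlonglongrightarrow> emb (e (adj x * x))"
      using u by (intro e) (auto simp: eval_mult eval_linear augmentation_ideal_closed
          intro!: tendsto_mult bounded_linear.tendsto[OF bounded_linear_adj])
    then have "pos (emb (e (adj x * x)))"
      by (rule pos_limit[rotated]) (use pos_Q in \<open>simp add: Q_def del: linear_extension_simps\<close>)
    then show ?thesis
      by (simp add: positive_iff_pos_emb)
  qed
  define T where "T x = \<theta> 0 (e x)" for x
  have T_norm: "norm (T x) \<le> norm x" for x
    unfolding T_def by (rule order_trans[OF star_hom_norm_le[OF star_hom_theta] e_norm])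
  have T_clinear: "clinear T"
    by (simp add: clinear_iff T_def e_add e_scale theta_simps)
  have T_bl: "bounded_linear T"
    by (rule clinear_bounded_linear[OF T_clinear, of 1]) (simp add: T_norm)
  have "conditional_expectation (range (\<theta> 0)) T"
    unfolding conditional_expectation_def
  proof (intro conjI allI impI ballI T_clinear)
    fix x :: 'p assume "positive x"
    then obtain y where "x = adj y * y"
      by (auto simp: positive_def)
    then obtain r where "e x = adj r * r"
      using e_positive[of y] by (auto simp: positive_def)
    then have "T x = adj (\<theta> 0 r) * \<theta> 0 r"
      by (simp add: T_def theta_simps)
    then show "positive (T x)"
      by (auto simp: positive_def)
  next
    show "T \<circ> T = T"
      by (simp add: fun_eq_iff T_def e_id)
    show "range T = range (\<theta> 0)"
    proof (intro set_eqI iffI)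
      fix x assume "x \<in> range (\<theta> 0)"
      then obtain a where "x = \<theta> 0 a"
        by blast
      then have "x = T (\<theta> 0 a)"
        by (simp add: T_def e_id)
      then show "x \<in> range T"
        by blast
    qed (auto simp: T_def)
    fix a x assume "a \<in> range (\<theta> 0)"
    then obtain b where "a = \<theta> 0 b"
      by blast
    then show "T (a * x) = a * T x"
      by (simp add: T_def e_theta_left theta_simps)
  qed
  moreover have "T \<circ> \<sigma> = T \<circ> \<sigma> \<circ> T"
    by (simp add: fun_eq_iff T_def e_shift e_id)
  moreover have "T (x * y) = T x * T y"
    if her: "x \<in> hereditary (range (\<theta> 0))" "y \<in> hereditary (range (\<theta> 0))" for x y
  proof -
    define G where "G = {a * x * b | a x b. a \<in> range (\<theta> 0) \<and> b \<in> range (\<theta> 0)}"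
    have T_simps: "T (x + y) = T x + T y" "T (z *\<^sub>C x) = z *\<^sub>C T x" "T 0 = 0" for x y z
      using T_clinear bounded_linear.linear[OF T_bl] by (auto simp: clinear_iff linear_0)
    have base: "T (x * y) = T x * T y" if G: "x \<in> G" "y \<in> G" for x y
    proof -
      obtain a v b where x: "x = \<theta> 0 a * v * \<theta> 0 b"
        using G(1) by (auto simp: G_def)
      obtain c w d where y: "y = \<theta> 0 c * w * \<theta> 0 d"
        using G(2) by (auto simp: G_def)
      have eq: "\<theta> 0 a * v * \<theta> 0 b * (\<theta> 0 c * w * \<theta> 0 d) =
          \<theta> 0 a * (v * \<theta> 0 (b * c) * w) * \<theta> 0 d"
        by (simp add: theta_simps mult.assoc)
      show ?thesis
        unfolding x y eq T_def e_theta_left e_theta_right e_theta by (simp add: theta_simps mult.assoc)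
    qed
    have left: "T (x * y) = T x * T y" if "x \<in> complex_vector.span G" "y \<in> G" for x y
      using that(1)
      by (induction rule: complex_vector.span_induct_alt)
        (auto simp: T_simps distrib_right scaleC_simps base that)
    have span: "T (x * y) = T x * T y" if "x \<in> complex_vector.span G" "y \<in> complex_vector.span G" for x y
      using that(2)
      by (induction rule: complex_vector.span_induct_alt)
        (auto simp: T_simps distrib_left scaleC_simps left that)
    obtain u where u: "\<forall>n. u n \<in> complex_vector.span G" "u \<longlonglongrightarrow> x"
      using her(1) unfolding hereditary_def G_def[symmetric] closure_sequential by blast
    obtain v where v: "\<forall>n. v n \<in> complex_vector.span G" "v \<longlonglongrightarrow> y"
      using her(2) unfolding hereditary_def G_def[symmetric] closure_sequential by blast
    have "(\<lambda>n. T (u n * v n)) \<longlonglongrightarrow> T (x * y)"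
      by (intro bounded_linear.tendsto[OF T_bl] tendsto_mult u v)
    moreover have "(\<lambda>n. T (u n) * T (v n)) \<longlonglongrightarrow> T x * T y"
      by (intro bounded_linear.tendsto[OF T_bl] tendsto_mult u v)
    moreover have "(\<lambda>n. T (u n * v n)) = (\<lambda>n. T (u n) * T (v n))"
      using u v span by blast
    ultimately show ?thesis
      using LIMSEQ_unique by metis
  qed
  ultimately have "alpha_expectation (range (\<theta> 0)) \<sigma> T"
    unfolding alpha_expectation_def by blast
  moreover have "\<theta> 0 (\<phi> a) = T (\<sigma> (\<theta> 0 a))" for a
    by (simp add: T_def e_shift e_id)
  ultimately show ?thesis
    by blast
qed

end

section \<open>Conditional expectations and uniqueness\<close>

locale cond_exp =
  fixes f :: "'a::cstar_algebra \<Rightarrow> 'p::cstar_algebra" and T :: "'p \<Rightarrow> 'p"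
  assumes f: "star_hom f" and T: "conditional_expectation (range f) T"
begin

lemma T_simps: "T (x + y) = T x + T y" "T (z *\<^sub>C x) = z *\<^sub>C T x" "T (f a * x) = f a * T x"
    "T (T x) = T x"
  using T by (auto simp: conditional_expectation_def clinear_iff fun_eq_iff)

lemma T_diff: "T (x - y) = T x - T y"
  using T_simps(1)[of x "- y"] T_simps(2)[of "-1" y] by (simp add: scaleC_minus_one)

lemma T_range: obtains a where "T x = f a"
  using T unfolding conditional_expectation_def by blast

lemma T_f: "T (f a) = f a"
proof -
  have "f a \<in> range T"
    using T by (auto simp: conditional_expectation_def)
  then show ?thesis
    using T_simps(4) by auto
qed

lemma T_positive: "positive x \<Longrightarrow> positive (T x)"
  using T by (auto simp: conditional_expectation_def)

lemma T_self_adjoint_square: "adj (T (adj x * x)) = T (adj x * x)"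
proof -
  have "positive (T (adj x * x))"
    by (rule T_positive) (auto simp: positive_def)
  then show ?thesis
    by (auto simp: positive_def adj_mult adj_adj)
qed

text \<open>
  Positivity makes \<open>T\<close> real on all \<open>(y + c x)\<^sup>* (y + c x)\<close>; compare \<open>c = 1\<close> and \<open>c = \<i>\<close>.
\<close>

lemma T_polarization: "adj (T (adj x * y)) = T (adj y * x)"
proof -
  let ?u = "T (adj x * y)" and ?v = "T (adj y * x)"
  have exp: "T (adj (y + c *\<^sub>C x) * (y + c *\<^sub>C x)) =
      T (adj y * y) + (cnj c * c) *\<^sub>C T (adj x * x) + cnj c *\<^sub>C ?u + c *\<^sub>C ?v" for c
    by (simp add: adj_add adj_scaleC distrib_left distrib_right scaleC_simps T_simps scaleC_add_right
        mult.commute add_ac)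
  have 1: "adj ?u + adj ?v = ?u + ?v"
    using T_self_adjoint_square[of "y + 1 *\<^sub>C x"] T_self_adjoint_square[of x] T_self_adjoint_square[of y]
    unfolding exp by (simp add: adj_add scaleC_one add.assoc)
  have "\<i> *\<^sub>C adj ?u - \<i> *\<^sub>C adj ?v = \<i> *\<^sub>C ?v - \<i> *\<^sub>C ?u"
    using T_self_adjoint_square[of "y + \<i> *\<^sub>C x"] T_self_adjoint_square[of x] T_self_adjoint_square[of y]
    unfolding exp
    by (simp add: adj_add adj_diff adj_minus adj_scaleC scaleC_one complex_vector.scale_minus_left add.assoc)
  then have "(-\<i>) *\<^sub>C \<i> *\<^sub>C (adj ?u - adj ?v) = (-\<i>) *\<^sub>C \<i> *\<^sub>C (?v - ?u)"
    by (simp only: complex_vector.scale_right_diff_distrib)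
  then have 2: "adj ?u - adj ?v = ?v - ?u"
    by (simp add: scaleC_simps)
  have "2 *\<^sub>R adj ?u = (adj ?u + adj ?v) + (adj ?u - adj ?v)"
    by (simp add: scaleR_2)
  also have "\<dots> = 2 *\<^sub>R ?v"
    unfolding 1 2 by (simp add: scaleR_2)
  finally show ?thesis
    by simp
qed

lemma range_cancel:
  assumes "\<And>b c. f b * f d * f c = 0"
  shows "f d = 0"
proof -
  let ?h = "f (adj d * d)"
  have "adj ?h * ?h = ?h * ?h"
    by (simp add: star_hom_simps[OF f] adj_mult adj_adj)
  also have "\<dots> = 0"
    using assms[of "adj d" "adj d * d"] by (simp add: star_hom_simps[OF f] mult.assoc)
  finally have "?h = 0"
    by (simp only: adj_mult_eq_zero)
  then show ?thesis
    using adj_mult_eq_zero[of "f d"] by (simp add: star_hom_simps[OF f])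
qed

text \<open>
  Multiplying by elements of the range on both sides replaces the unit that the range may not have.
\<close>

lemma range_eqI:
  assumes "\<And>b c. f b * x * f c = f b * y * f c" "x \<in> range f" "y \<in> range f"
  shows "x = y"
proof -
  obtain d where d: "x - y = f d"
    using assms(2,3) by (auto simp flip: star_hom_simps(5)[OF f])
  have "f d = 0"
    by (rule range_cancel) (use assms(1) in \<open>simp add: right_diff_distrib left_diff_distrib flip: d\<close>)
  with d show ?thesis
    by simp
qed

lemma adj_in_range: "x \<in> range f \<Longrightarrow> adj x \<in> range f"
  by (auto simp flip: star_hom_simps(4)[OF f])

lemma mult_in_range: "x \<in> range f \<Longrightarrow> y \<in> range f \<Longrightarrow> x * y \<in> range f"
  by (auto simp flip: star_hom_simps(3)[OF f])

lemma T_in_range: "T x \<in> range f"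
  by (rule T_range[of x]) simp

lemma T_right_weak: "T (x * f b) = adj (T (adj x)) * f b"
proof -
  have "adj (T (x * f b)) = T (f (adj b) * adj x)"
    using T_polarization[of "adj x" "f b"] by (simp add: adj_adj star_hom_simps[OF f])
  also have "\<dots> = f (adj b) * T (adj x)"
    by (rule T_simps)
  finally have "adj (adj (T (x * f b))) = adj (f (adj b) * T (adj x))"
    by simp
  then show ?thesis
    by (simp add: adj_adj adj_mult star_hom_simps[OF f])
qed

text \<open>
  The module property is assumed on the left only, and the algebra may lack a unit, so that polarization gives
  \<open>T (x\<^sup>*) = (T x)\<^sup>*\<close> only after multiplication by elements of the range on both sides.
\<close>

lemma T_adj: "T (adj x) = adj (T x)"
proof (rule range_eqI)
  fix b c
  have "f b * T (adj x) * f c = T (f b * adj x) * f c"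
    by (simp add: T_simps)
  also have "T (f b * adj x) = adj (T (adj (f b * adj x)))"
  proof (rule sym)
    have "T (adj (f b * adj x)) = T (adj (adj x) * f (adj b))"
      by (simp add: adj_mult star_hom_simps[OF f])
    then show "adj (T (adj (f b * adj x))) = T (f b * adj x)"
      using T_polarization[of "adj x" "f (adj b)"] by (simp add: adj_adj star_hom_simps[OF f])
  qed
  also have "\<dots> * f c = T (f b * adj x * f c)"
    by (rule T_right_weak[symmetric])
  also have "\<dots> = f b * T (adj x * f c)"
    by (simp add: mult.assoc T_simps)
  also have "\<dots> = f b * adj (T x) * f c"
    by (simp add: T_right_weak adj_adj mult.assoc)
  finally show "f b * T (adj x) * f c = f b * adj (T x) * f c" .
qed (auto intro: T_in_range adj_in_range)

lemma T_right: "T (x * f b) = T x * f b"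
  by (simp add: T_right_weak T_adj adj_adj)

text \<open>
  For \<open>e = T z\<close> and \<open>n = norm z\<close> the inequality \<open>e z e \<le> n e\<^sup>2\<close> is mapped to \<open>e\<^sup>3 \<le> n e\<^sup>2\<close> by \<open>T\<close>.
\<close>

lemma norm_T_positive_le:
  assumes "positive z"
  shows "norm (T z) \<le> norm z"
proof -
  define n where "n = norm z"
  obtain a where a: "T z = f a"
    by (rule T_range)
  let ?e = "T z"
  have pe: "pos (emb ?e)"
    using T_positive[OF assms] by (simp add: positive_iff_pos_emb)
  have ae: "adj ?e = ?e"
    using pos_adj[OF pe] by (simp flip: emb_arith)
  have pz: "pos (emb z)"
    using assms by (simp add: positive_iff_pos_emb)
  have "pos (of_real n - emb z)"
    by (rule pos_norm_minus[OF pos_adj[OF pz]]) (simp add: n_def)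
  then have "pos (adj (emb ?e) * (of_real n - emb z) * emb ?e)"
    by (rule pos_conjugate)
  also have "adj (emb ?e) * (of_real n - emb z) * emb ?e = emb (of_real n *\<^sub>C (?e * ?e) - ?e * z * ?e)"
    by (simp add: emb_arith ae algebra_simps of_real_eq_scaleC scaleC_simps flip: emb_arith(7))
  finally have "positive (of_real n *\<^sub>C (?e * ?e) - ?e * z * ?e)"
    by (simp only: positive_iff_pos_emb)
  then have "positive (T (of_real n *\<^sub>C (?e * ?e) - ?e * z * ?e))"
    by (rule T_positive)
  moreover have "T (?e * z * ?e) = ?e * ?e * ?e"
    unfolding a by (simp add: T_right T_simps) (simp add: a)
  moreover have "T (?e * ?e) = ?e * ?e"
    unfolding a by (simp add: T_simps T_f)
  ultimately have "positive (of_real n *\<^sub>C (?e * ?e) - ?e * ?e * ?e)"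
    by (simp add: T_diff T_simps)
  then have "pos (of_real n *\<^sub>C emb (?e * ?e) - emb (?e * ?e * ?e))"
    by (simp add: positive_iff_pos_emb emb_arith)
  moreover have "pos (emb (?e * ?e * ?e))"
    using pos_conjugate[OF pe, of "emb ?e"] by (simp add: emb_arith flip: emb_arith(7) add: ae)
  ultimately have "norm (emb (?e * ?e * ?e)) \<le> norm (of_real n *\<^sub>C emb (?e * ?e))"
    by (intro norm_mono)
  moreover have "norm (emb (?e * ?e * ?e)) = norm ?e ^ 3"
    using norm_self_adjoint_power[OF pos_adj[OF pe], of 3]
    by (simp add: emb_arith power3_eq_cube)
  moreover have "norm (of_real n *\<^sub>C emb (?e * ?e)) = n * (norm ?e)\<^sup>2"
    using norm_self_adjoint_square[OF pos_adj[OF pe]]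
    by (simp add: norm_scaleC n_def emb_arith)
  ultimately have "norm ?e * (norm ?e)\<^sup>2 \<le> n * (norm ?e)\<^sup>2"
    by (simp add: power3_eq_cube power2_eq_square mult.assoc)
  then show ?thesis
    by (cases "?e = 0") (auto simp: n_def)
qed

text \<open>
  The Schwarz inequality for \<open>T\<close>, which is positivity of \<open>T\<close> on \<open>(x - T x)\<^sup>* (x - T x)\<close>, reduces this to
  positive elements.
\<close>

lemma norm_T_le: "norm (T x) \<le> norm x"
proof -
  obtain a where a: "T x = f a"
    by (rule T_range)
  have "T (adj (x - T x) * (x - T x)) = T (adj x * x) - adj (T x) * T x"
  proof -
    have *: "adj (f a) = f (adj a)"
      by (simp add: star_hom_simps[OF f])
    have "adj (x - f a) * (x - f a) = adj x * x - adj x * f a - f (adj a) * x + f (adj a) * f a"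
      by (simp add: adj_diff algebra_simps *)
    then have "T (adj (x - f a) * (x - f a)) = T (adj x * x) - adj (f a) * f a - f (adj a) * f a + f (adj a) * f a"
      by (simp add: T_diff T_simps(1,3) T_right T_adj T_f a)
    then show ?thesis
      unfolding a by simp
  qed
  moreover have "positive (T (adj (x - T x) * (x - T x)))"
    by (rule T_positive) (auto simp: positive_def)
  ultimately have "pos (emb (T (adj x * x)) - emb (adj (T x) * T x))"
    by (simp add: positive_iff_pos_emb emb_arith)
  moreover have "pos (emb (adj (T x) * T x))"
    using pos_adj_mult[of "emb (T x)"] by (simp add: emb_arith)
  ultimately have "norm (emb (adj (T x) * T x)) \<le> norm (emb (T (adj x * x)))"
    by (intro norm_mono)
  also have "\<dots> \<le> norm (adj x * x)"
    using norm_T_positive_le[of "adj x * x"] by (auto simp: positive_def)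
  finally have "(norm (T x))\<^sup>2 \<le> (norm x)\<^sup>2"
    by (simp add: cstar_identity)
  then show ?thesis
    by (rule power2_le_imp_le) simp
qed

lemma bounded_linear_T: "bounded_linear T"
  by (rule clinear_bounded_linear[of _ 1]) (auto simp: clinear_iff T_simps norm_T_le)

text \<open>
  If \<open>a\<close> is a product \<open>a\<^sub>1 a\<^sub>2\<close> of elements of the range, then \<open>b x a\<^sub>1\<close> and \<open>a\<^sub>2 y c\<close> lie in the hereditary
  subalgebra for all \<open>b\<close>, \<open>c\<close> in the range.  Such products are dense in the range.
\<close>

lemma T_multiplicative_over_range:
  assumes "\<And>x y. x \<in> hereditary (range f) \<Longrightarrow> y \<in> hereditary (range f) \<Longrightarrow> T (x * y) = T x * T y"
  shows "T (x * f a * y) = T x * f a * T y"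
proof -
  have her: "f b * x * f c \<in> hereditary (range f)" for b x c
    unfolding hereditary_def
    by (intro subsetD[OF closure_subset] complex_vector.span_base) blast
  have product: "T (x * f (a * b) * y) = T x * f (a * b) * T y" for a b
  proof (rule range_eqI)
    fix c d
    have "f c * T (x * f (a * b) * y) * f d = T (f c * (x * f (a * b) * y) * f d)"
      by (simp add: T_right T_simps)
    also have "f c * (x * f (a * b) * y) * f d = (f c * x * f a) * (f b * y * f d)"
      by (simp add: star_hom_simps[OF f] mult.assoc)
    also have "T \<dots> = T (f c * x * f a) * T (f b * y * f d)"
      by (rule assms[OF her her])
    also have "\<dots> = f c * (T x * f (a * b) * T y) * f d"
      by (simp add: T_right T_simps) (simp add: star_hom_simps[OF f] mult.assoc)
    finally show "f c * T (x * f (a * b) * y) * f d = f c * (T x * f (a * b) * T y) * f d" .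
  qed (auto intro: T_in_range mult_in_range)
  obtain u where u: "(\<lambda>m. u m * a) \<longlonglongrightarrow> a"
    by (rule limit_of_products)
  have fu: "(\<lambda>m. f (u m * a)) \<longlonglongrightarrow> f a"
    by (rule bounded_linear.tendsto[OF star_hom_bounded_linear[OF f] u])
  have "(\<lambda>m. T (x * f (u m * a) * y)) \<longlonglongrightarrow> T (x * f a * y)"
    by (intro bounded_linear.tendsto[OF bounded_linear_T] tendsto_mult tendsto_const fu)
  moreover have "(\<lambda>m. T x * f (u m * a) * T y) \<longlonglongrightarrow> T x * f a * T y"
    by (intro tendsto_mult tendsto_const fu)
  ultimately show ?thesis
    unfolding product by (rule LIMSEQ_unique)
qed

end

context free_product_with_map
begin

text \<open>
  The two expectations agree on words by induction, hence on a dense subspace, and they are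
  continuous.
\<close>

theorem uniqueness:
  assumes \<sigma>: "is_shift \<theta> \<sigma>"
    and S: "alpha_expectation (range (\<theta> 0)) \<sigma> S" "\<And>a. \<theta> 0 (\<phi> a) = S (\<sigma> (\<theta> 0 a))"
    and T: "alpha_expectation (range (\<theta> 0)) \<sigma> T" "\<And>a. \<theta> 0 (\<phi> a) = T (\<sigma> (\<theta> 0 a))"
  shows "S = T"
proof -
  interpret S: cond_exp "\<theta> 0" S
    using S(1) star_hom_theta by unfold_locales (auto simp: alpha_expectation_def)
  interpret T: cond_exp "\<theta> 0" T
    using T(1) star_hom_theta by unfold_locales (auto simp: alpha_expectation_def)
  have S_mult: "S (x * \<theta> 0 a * y) = S x * \<theta> 0 a * S y" for x a y
    using S(1) by (intro S.T_multiplicative_over_range) (auto simp: alpha_expectation_def)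
  have T_mult: "T (x * \<theta> 0 a * y) = T x * \<theta> 0 a * T y" for x a y
    using T(1) by (intro T.T_multiplicative_over_range) (auto simp: alpha_expectation_def)
  have S_shift: "S (\<sigma> x) = S (\<sigma> (S x))" and T_shift: "T (\<sigma> x) = T (\<sigma> (T x))" for x
    using S(1) T(1) by (auto simp: alpha_expectation_def fun_eq_iff)
  have word: "w \<noteq> [] \<Longrightarrow> S (eval (monomial w 1)) = T (eval (monomial w 1))" for w
  proof (induction w rule: word_induct)
    case (shift w)
    have "eval (monomial (shift_word w) 1) = \<sigma> (eval (monomial w 1))"
      using eval_fshift[OF \<sigma>, of "monomial w 1"] by simp
    moreover obtain b where "S (eval (monomial w 1)) = \<theta> 0 b"
      by (rule S.T_range)
    ultimately show ?case
      using shift S_shift[of "eval (monomial w 1)"] T_shift[of "eval (monomial w 1)"] S(2)[of b] T(2)[of b]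
      by simp
  next
    case (split u a v)
    let ?u = "monomial (shift_word u) 1" and ?v = "monomial v 1"
    have v: "v \<noteq> [] \<Longrightarrow> ?v \<in> augmentation_ideal" and u: "u \<noteq> [] \<Longrightarrow> ?u \<in> augmentation_ideal"
      by (simp_all add: augmentation_ideal_closed)
    have eq: "monomial (shift_word u @ (0, a) # v) 1 = ?u * letter 0 a * ?v"
      by simp
    have letter: "eval (letter 0 a) = \<theta> 0 a"
      by (simp add: eval_linear)
    show ?case
    proof (cases "u = []"; cases "v = []")
      assume "u = []" "v = []"
      then show ?thesis
        by (simp add: letter S.T_f T.T_f)
    next
      assume uv: "u = []" "v \<noteq> []"
      then have "eval (monomial (shift_word u @ (0, a) # v) 1) = \<theta> 0 a * eval ?v"
        using eval_mult[OF letter_in_augmentation_ideal v, of 0 a] by (simp add: letter)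
      then show ?thesis
        using split uv by (simp add: S.T_simps(3) T.T_simps(3))
    next
      assume uv: "u \<noteq> []" "v = []"
      then have "eval (monomial (shift_word u @ (0, a) # v) 1) = eval ?u * \<theta> 0 a"
        using eval_mult[OF u letter_in_augmentation_ideal, of 0 a] by (simp add: letter)
      then show ?thesis
        using split uv by (simp add: S.T_right T.T_right)
    next
      assume uv: "u \<noteq> []" "v \<noteq> []"
      then have "eval (monomial (shift_word u @ (0, a) # v) 1) = eval ?u * \<theta> 0 a * eval ?v"
        unfolding eq
        using eval_mult[OF augmentation_ideal_closed(5)[OF u[OF uv(1)]] v[OF uv(2)], of "letter 0 a"]
          eval_mult[OF u[OF uv(1)] letter_in_augmentation_ideal, of 0 a]
        by (simp only: letter)
      then show ?thesis
        using split uv by (simp add: S_mult T_mult)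
    qed
  qed simp
  have "S (eval x) = T (eval x)" if "x \<in> augmentation_ideal" for x
    using that
  proof (induction x rule: augmentation_ideal_induct)
    case zero
    show ?case
      using S.T_f[of 0] T.T_f[of 0] by (simp add: eval_linear theta_simps)
  next
    case (monomial w c)
    have "S (eval (fscale c (monomial w 1))) = T (eval (fscale c (monomial w 1)))"
      by (simp only: eval_linear S.T_simps T.T_simps word[OF monomial])
    then show ?case
      by simp
  qed (simp add: eval_linear S.T_simps T.T_simps)
  moreover have "S z = T z"
    if eq: "\<And>x. x \<in> augmentation_ideal \<Longrightarrow> S (eval x) = T (eval x)" for z
  proof -
    obtain u where u: "\<forall>n. u n \<in> augmentation_ideal" "(\<lambda>n. eval (u n)) \<longlonglongrightarrow> z"
      using eval_approximation by metis
    have lim: "(\<lambda>n. S (eval (u n))) \<longlonglongrightarrow> S z" "(\<lambda>n. T (eval (u n))) \<longlonglongrightarrow> T z"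
      by (intro bounded_linear.tendsto[OF S.bounded_linear_T]
          bounded_linear.tendsto[OF T.bounded_linear_T] u(2))+
    then show ?thesis
      using eq u(1) by (simp add: LIMSEQ_unique)
  qed
  ultimately have "S z = T z" for z
    by blast
  then show ?thesis
    by (rule ext)
qed

end

theorem theorem1p3:
  fixes \<theta> :: "nat \<Rightarrow> 'a::cstar_algebra \<Rightarrow> 'p::cstar_algebra"
    and \<sigma> :: "'p \<Rightarrow> 'p"
    and \<phi> :: "'a \<Rightarrow> 'a"
  assumes "free_product \<theta>"
    and "is_shift \<theta> \<sigma>"
    and "completely_positive \<phi>"
    and "contraction \<phi>"
  shows "\<exists>!E. alpha_expectation (range (\<theta> 0)) \<sigma> E \<and> (\<forall>a. \<theta> 0 (\<phi> a) = E (\<sigma> (\<theta> 0 a)))"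
proof -
  interpret free_product_with_map \<phi> \<theta>
    using assms by unfold_locales
  show ?thesis
    using existence[OF assms(2)] uniqueness[OF assms(2)] by blast
qed

end
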